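(* Let $\Phi$, $\varphi$, $V$ be as in the standing assumption (see context), and suppose $\varphi\in\mathcal Z_{C_1}(\mathbb R^d)$ for every $C_1\in(0,1)$. Suppose that there exist $\alpha\in(0,2)$ and a function $\ell$ slowly varying at zero such that $\Phi(u)\sim u^{\alpha/2}\ell(u)$ as $u\downarrow0$. Assume that there exist $C_\varphi>0$, $\kappa\in\left(\frac{d-1}2,\frac d2\right)$ and a decreasing function $\rho:\mathbb R^+\to\mathbb R^+$ such that $\varphi(x)=\rho(|x|)$ with $\rho(r)\sim C_\varphi r^{-2\kappa}$ as $r\to\infty$. Moreover, suppose that for every $C_1\in(0,1)$ the function $L_\varphi$ associated with $\varphi\in\mathcal Z_{C_1}(\mathbb R^d)$ satisfies $$L_\varphi(x)\sim\frac{C_\varphi\,4\kappa(2\kappa+1)d^2}{(1-C_1)^{2\kappa+2}|x|^{2\kappa+2}},\qquad|x|\to\infty.$$ Define for $t\in(0,1)$ $$\begin{aligned}H_+(t)={}&\frac{(1-t)^{d-2\kappa}(1+t)^{2\kappa+\alpha}(2\kappa+\alpha+1)^{2\kappa+\alpha}+(2\kappa+\alpha)^{2\kappa+\alpha}(2-t)^{d+\alpha}(d-2\kappa)}{(2-t)^{d+\alpha}(1+t)^{2\kappa+\alpha}(d-2\kappa)(2\kappa+\alpha+1)^{2\kappa+\alpha}}\\&-\frac{\alpha(1-t)^{d+2\kappa+2}(2-\alpha)+dt^d(2-\alpha)(1-t)^{2\kappa+2}+2\kappa(2\kappa+1)d^3\alpha t^{d+2}}{d\alpha(2-\alpha)t^{d+\alpha}(1-t)^{2\kappa+2}}.\end{aligned}$$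 If $$K_+(d,\alpha,\kappa):=\max_{t\in(0,1)}H_+(t)>0,$$ then there exists $R>0$ such that $V(x)>0$ for every $x\in B^c_R(0)$.
   Context: Notation: $\mathbb R^+=[0,\infty)$; $B_r(a)$ is the open ball in $\mathbb R^d$, $B_r^c(a)$ its complement; $D_hf(x)=f(x+h)-2f(x)+f(x-h)$. $f\sim g$ means the ratio tends to $1$. A measurable $\ell:(0,\infty)\to(0,\infty)$ is slowly varying at zero if $\widetilde\ell(t)=\ell(1/t)$ satisfies $\lim_{t\to\infty}\widetilde\ell(ct)/\widetilde\ell(t)=1$ for every $c>0$. $\Phi$ is a complete Bernstein function with Lévy pair $(0,\mu)$: $\Phi(u)=\int_0^\infty(1-e^{-ut})\mu(t)\,dt$ with $\mu:(0,\infty)\to[0,\infty)$ completely monotone and $\int_0^\infty\min(1,t)\mu(t)\,dt<\infty$. The jump kernel is $j(r)=(4\pi)^{-d/2}\int_0^\infty t^{-d/2}e^{-r^2/(4t)}\mu(t)\,dt$, $r>0$. $\Phi(-\Delta)$ is the operator on $L^2(\mathbb R^d)$ with Fourier multiplier $\Phi(|y|^2)$. Standing assumption: $V:\mathbb R^d\to\mathbb R$ is a potential, $H=\Phi(-\Delta)+V$, and $\varphi\in L^2(\mathbb R^d)\cap L^\infty(\mathbb R^d)$, $\varphi>0$, satisfies $H\varphi=0$. The potential is understood through the pointwise expression $V(x)=-\frac{1}{\varphi(x)}\Phi(-\Delta)\varphi(x)=\frac{1}{2\varphi(x)}\int_{\mathbb R^d}D_h\varphi(x)\,j(|h|)\,dh$.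 Space: for $C\in(0,1)$, $\mathcal Z_C(\mathbb R^d)$ is the set of $f\in L^\infty(\mathbb R^d)$ for which there exist $M_f>0$ and $L_f\in L^\infty(B^c_{M_f}(0))$ (both may depend on $C$) such that $|D_hf(x)|\le L_f(x)|h|^2$ for all $x\in B^c_{M_f}(0)$ and $h\in B_{C|x|}(0)$. *)

theory Defs
  imports "HOL-Analysis.Analysis" "HOL-Library.Landau_Symbols"
begin

text \<open>
  The space of dimension \<open>d\<close> is an arbitrary type of class \<open>euclidean_space\<close>, with
  \<open>d = DIM('a)\<close>. Measurability on it is Lebesgue measurability.
\<close>

subsection \<open>Lebesgue spaces\<close>

definition in_L2 :: "('a::euclidean_space \<Rightarrow> 'b::{banach, second_countable_topology}) \<Rightarrow> bool" where
  "in_L2 f \<longleftrightarrow> f \<in> borel_measurable lebesgue \<and> integrable lebesgue (\<lambda>x. (norm (f x))\<^sup>2)"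

definition in_Linf_on :: "'a::euclidean_space set \<Rightarrow> ('a \<Rightarrow> real) \<Rightarrow> bool" where
  "in_Linf_on S f \<longleftrightarrow>
     set_borel_measurable lebesgue S f \<and> (\<exists>K. AE x in lebesgue. x \<in> S \<longrightarrow> \<bar>f x\<bar> \<le> K)"

subsection \<open>Complete Bernstein functions and slow variation\<close>

text \<open>
  Functions on \<open>(0,\<infinity>)\<close> are total functions on the reals whose values on \<open>(-\<infinity>,0]\<close> are
  never used; iterated derivatives at \<open>t > 0\<close> only depend on the values near \<open>t\<close>.
\<close>

definition completely_monotone :: "(real \<Rightarrow> real) \<Rightarrow> bool" where
  "completely_monotone \<mu> \<longleftrightarrow>
     (\<forall>n. \<forall>t>0. ((deriv ^^ n) \<mu>) differentiable (at t) \<and> 0 \<le> (-1) ^ n * (deriv ^^ n) \<mu> t)"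

definition complete_bernstein :: "(real \<Rightarrow> real) \<Rightarrow> (real \<Rightarrow> real) \<Rightarrow> bool" where
  "complete_bernstein \<Phi> \<mu> \<longleftrightarrow>
     completely_monotone \<mu> \<and>
     set_integrable lborel {0<..} (\<lambda>t. min 1 t * \<mu> t) \<and>
     (\<forall>u>0. \<Phi> u = (LINT t:{0<..}|lborel. (1 - exp (- (u * t))) * \<mu> t))"

definition slowly_varying_at_zero :: "(real \<Rightarrow> real) \<Rightarrow> bool" where
  "slowly_varying_at_zero l \<longleftrightarrow>
     set_borel_measurable lebesgue {0<..} l \<and> (\<forall>t>0. 0 < l t) \<and>
     (\<forall>c>0. ((\<lambda>t. l (1 / (c * t)) / l (1 / t)) \<longlongrightarrow> 1) at_top)"

definition jump_kernel :: "nat \<Rightarrow> (real \<Rightarrow> real) \<Rightarrow> real \<Rightarrow> real" where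
  "jump_kernel d \<mu> r =
     (4 * pi) powr (- (real d / 2)) *
     (LINT t:{0<..}|lborel. t powr (- (real d / 2)) * exp (- (r\<^sup>2 / (4 * t))) * \<mu> t)"

subsection \<open>Fourier multipliers and the equation \<open>H \<phi> = 0\<close>\<close>

text \<open>
  \<open>F\<close> is the Fourier--Plancherel transform of \<open>f\<close>: the transforms of the truncations of \<open>f\<close> to
  balls converge to \<open>F\<close> in \<open>L\<^sup>2\<close>. The distance is a nonnegative Lebesgue integral, so that its
  vanishing in the limit cannot be an artefact of non-integrability.
\<close>

definition has_L2_fourier ::
    "('a::euclidean_space \<Rightarrow> complex) \<Rightarrow> ('a \<Rightarrow> complex) \<Rightarrow> bool" where
  "has_L2_fourier f F \<longleftrightarrow>
     in_L2 f \<and> in_L2 F \<and>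
     ((\<lambda>R. \<integral>\<^sup>+ y. ennreal ((norm (F y -
          complex_of_real ((2 * pi) powr (- (real DIM('a) / 2))) *
          (LINT x:cball 0 R|lebesgue. cis (- (x \<bullet> y)) * f x)))\<^sup>2) \<partial>lebesgue)
        \<longlongrightarrow> 0) at_top"

text \<open>
  \<open>g = \<Phi>(-\<Delta>) f\<close> in \<open>L\<^sup>2\<close>; in particular \<open>f\<close> lies in the domain of \<open>\<Phi>(-\<Delta>)\<close>. As a relation it
  determines \<open>g\<close> only almost everywhere.
\<close>

definition Phi_laplacian ::
    "(real \<Rightarrow> real) \<Rightarrow> ('a::euclidean_space \<Rightarrow> real) \<Rightarrow> ('a \<Rightarrow> real) \<Rightarrow> bool" where
  "Phi_laplacian \<Phi> f g \<longleftrightarrow>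
     (\<exists>F. has_L2_fourier (\<lambda>x. complex_of_real (f x)) F \<and>
          has_L2_fourier (\<lambda>x. complex_of_real (g x))
            (\<lambda>y. complex_of_real (\<Phi> ((norm y)\<^sup>2)) * F y))"

definition schroedinger_zero ::
    "(real \<Rightarrow> real) \<Rightarrow> ('a::euclidean_space \<Rightarrow> real) \<Rightarrow> ('a \<Rightarrow> real) \<Rightarrow> bool" where
  "schroedinger_zero \<Phi> V \<phi> \<longleftrightarrow>
     (\<exists>g. Phi_laplacian \<Phi> \<phi> g \<and> (AE x in lebesgue. g x + V x * \<phi> x = 0))"

subsection \<open>Centred second differences\<close>

definition second_diff :: "'a::euclidean_space \<Rightarrow> ('a \<Rightarrow> real) \<Rightarrow> 'a \<Rightarrow> real" where
  "second_diff h f x = f (x + h) - 2 * f x + f (x - h)"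

definition nonlocal_potential ::
    "(real \<Rightarrow> real) \<Rightarrow> ('a::euclidean_space \<Rightarrow> real) \<Rightarrow> 'a \<Rightarrow> real" where
  "nonlocal_potential \<mu> \<phi> x =
     1 / (2 * \<phi> x) * (LINT h|lebesgue. second_diff h \<phi> x * jump_kernel DIM('a) \<mu> (norm h))"

definition Z_bound :: "real \<Rightarrow> ('a::euclidean_space \<Rightarrow> real) \<Rightarrow> real \<Rightarrow> ('a \<Rightarrow> real) \<Rightarrow> bool" where
  "Z_bound C f M L \<longleftrightarrow>
     0 < M \<and> in_Linf_on (- ball 0 M) L \<and>
     (\<forall>x \<in> - ball 0 M. \<forall>h \<in> ball 0 (C * norm x). \<bar>second_diff h f x\<bar> \<le> L x * (norm h)\<^sup>2)"

definition Z_space :: "real \<Rightarrow> ('a::euclidean_space \<Rightarrow> real) set" where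
  "Z_space C = {f. in_Linf_on UNIV f \<and> (\<exists>M L. Z_bound C f M L)}"

subsection \<open>The function \<open>H\<^sub>+\<close> and its maximum\<close>

definition H_plus :: "nat \<Rightarrow> real \<Rightarrow> real \<Rightarrow> real \<Rightarrow> real" where
  "H_plus d \<alpha> \<kappa> t =
     ((1 - t) powr (d - 2*\<kappa>) * (1 + t) powr (2*\<kappa> + \<alpha>) * (2*\<kappa> + \<alpha> + 1) powr (2*\<kappa> + \<alpha>)
        + (2*\<kappa> + \<alpha>) powr (2*\<kappa> + \<alpha>) * (2 - t) powr (d + \<alpha>) * (d - 2*\<kappa>))
     / ((2 - t) powr (d + \<alpha>) * (1 + t) powr (2*\<kappa> + \<alpha>) * (d - 2*\<kappa>)
        * (2*\<kappa> + \<alpha> + 1) powr (2*\<kappa> + \<alpha>))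
     - (\<alpha> * (1 - t) powr (d + 2*\<kappa> + 2) * (2 - \<alpha>)
        + d * t ^ d * (2 - \<alpha>) * (1 - t) powr (2*\<kappa> + 2)
        + 2*\<kappa> * (2*\<kappa> + 1) * d ^ 3 * \<alpha> * t ^ (d + 2))
     / (d * \<alpha> * (2 - \<alpha>) * t powr (d + \<alpha>) * (1 - t) powr (2*\<kappa> + 2))"

text \<open>
  \<open>GREATEST\<close> denotes an attained maximum. For \<open>\<alpha> \<in> (0,2)\<close> and \<open>0 < \<kappa> < d/2\<close> it exists:
  \<open>H\<^sub>+\<close> is continuous on \<open>(0,1)\<close> and tends to \<open>-\<infinity>\<close> at both end points.
\<close>

definition K_plus :: "nat \<Rightarrow> real \<Rightarrow> real \<Rightarrow> real" where
  "K_plus d \<alpha> \<kappa> = (GREATEST y. y \<in> H_plus d \<alpha> \<kappa> ` {0<..<1})"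

end

theory Submission
  imports Defs "HOL-Real_Asymp.Real_Asymp"
begin

text \<open>
  Fix \<open>t\<close> with \<open>H_plus d \<alpha> \<kappa> t > 0\<close> and let \<open>R = |x|\<close> be large. In \<open>2 \<phi>(x) V(x)\<close>, the integral of the second
  difference against the jump kernel, substitute \<open>h = R z\<close>.
  
  \<^item> Where \<open>|z| < t\<close>, the second difference is at least \<open>- L(x) R\<^sup>2 |z|\<^sup>2\<close>.
  
  \<^item> Where \<open>|z| \<ge> t\<close>, the value \<open>-2 \<phi>(x)\<close> is subtracted, and the values \<open>\<phi>(x + h)\<close> contribute
    positively. Because \<open>2 \<kappa> < d\<close>, the function \<open>\<phi>\<close> carries mass of order \<open>R\<close> to the power \<open>d - 2 \<kappa>\<close>
    in the ball of radius \<open>(1 - t) R\<close> around the origin, all of it at distance at most \<open>(2 - t) R\<close> from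
    \<open>x\<close>. This is the term that can win when \<open>\<kappa>\<close> is close to \<open>d/2\<close>. The rest is bounded below by pairing
    \<open>z\<close> with \<open>-z\<close> (lemma \<open>integral_second_diff_lower_bound\<close>).
  
  To compare these contributions one needs the jump kernel at scale \<open>R\<close>, both pointwise and integrated.
  Writing \<open>\<mu>\<close> in units of \<open>R\<^sup>2\<close> and normalising gives densities whose Bernstein functions are
  \<open>\<Phi>(u/R\<^sup>2) / \<Phi>(1/R\<^sup>2)\<close>, and these tend to \<open>u\<close> to the power \<open>\<alpha>/2\<close>, the Bernstein function of a stable
  density. As in Karamata's proof of his Tauberian theorem, approximation by polynomials in \<open>exp (-t)\<close>
  turns this into convergence of integrals of continuous functions. The jump kernel at a fixed point
  is such an integral, and so is the integral of the jump kernel against \<open>1 - exp (-|z|\<^sup>2)\<close>; a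
  dominated convergence theorem with moving dominator then yields all weighted kernel integrals
  (lemma \<open>jump_kernel_scaling_limit\<close>).
  
  After division by the common scale, the lower bound has a limit in which the first, fourth and fifth
  terms of \<open>H_plus\<close>, as displayed in lemma \<open>H_plus_eq\<close>, appear as they are. The limit of the paired
  part has a different shape from the second and third terms, but it is at least as large for every
  \<open>t\<close> (lemma \<open>far_term_le\<close>). So the limit is at least a positive multiple of \<open>H_plus d \<alpha> \<kappa> t\<close>.
\<close>

section \<open>Integration: a moving dominator and radial integrals\<close>

text \<open>
  Dominated convergence with a dominating function that moves with the parameter, provided its
  integrals converge to the right limit (Pratt). Truncating \<open>f R\<close> at the level of the limiting
  dominator \<open>g'\<close> puts it under ordinary dominated convergence; what the truncation cuts off
  is at most the positive part of \<open>g R - g'\<close>, whose integral vanishes in the limit because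
  its negative part lies under \<open>g'\<close> and the difference of the integrals tends to zero.
\<close>

lemma tendsto_integral_varying_dominator:
  fixes f g :: "real \<Rightarrow> 'b \<Rightarrow> real" and f' g' :: "'b \<Rightarrow> real"
  assumes meas [measurable]: "\<And>R. f R \<in> borel_measurable M" "f' \<in> borel_measurable M"
    and int_g: "\<And>R. integrable M (g R)" "integrable M g'"
    and bound: "\<And>R x. \<bar>f R x\<bar> \<le> g R x"
    and lim_f: "\<And>x. ((\<lambda>R. f R x) \<longlongrightarrow> f' x) at_top"
    and lim_g: "\<And>x. ((\<lambda>R. g R x) \<longlongrightarrow> g' x) at_top"
    and lim_int: "((\<lambda>R. LINT x|M. g R x) \<longlongrightarrow> (LINT x|M. g' x)) at_top"
  shows "((\<lambda>R. LINT x|M. f R x) \<longlongrightarrow> (LINT x|M. f' x)) at_top"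
proof -
  have [measurable]: "\<And>R. g R \<in> borel_measurable M" "g' \<in> borel_measurable M"
    using int_g by auto
  have g0: "0 \<le> g R x" for R x
    using bound[of R x] by linarith
  have f'g': "\<bar>f' x\<bar> \<le> g' x" for x
    by (rule tendsto_le[OF _ lim_g tendsto_rabs[OF lim_f]]) (auto simp: bound)
  have g'0: "0 \<le> g' x" for x
    using f'g'[of x] by linarith
  have int_f: "integrable M (f R)" for R
  proof (rule Bochner_Integration.integrable_bound[OF int_g(1)[of R]])
    show "AE x in M. norm (f R x) \<le> norm (g R x)"
      using bound[of R] g0[of R] by (intro AE_I2) simp
  qed measurable
  \<comment> \<open>\<open>c\<close> is the truncation of \<open>f R\<close>, \<open>p\<close> the negative part of \<open>g R - g'\<close>.\<close>
  define c where "c R x = max (- g' x) (min (g' x) (f R x))" for R x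
  have [measurable]: "c R \<in> borel_measurable M" for R
    unfolding c_def by measurable
  have c_lim: "((\<lambda>R. c R x) \<longlongrightarrow> f' x) at_top" for x
  proof -
    have "((\<lambda>R. c R x) \<longlongrightarrow> max (- g' x) (min (g' x) (f' x))) at_top"
      unfolding c_def by (intro tendsto_intros lim_f)
    moreover have "max (- g' x) (min (g' x) (f' x)) = f' x"
      using f'g'[of x] by auto
    ultimately show ?thesis by simp
  qed
  have c_bd: "\<bar>c R x\<bar> \<le> g' x" for R x
    using g'0[of x] by (auto simp: c_def abs_le_iff)
  have c_int: "((\<lambda>R. LINT x|M. c R x) \<longlongrightarrow> (LINT x|M. f' x)) at_top"
    by (rule integral_dominated_convergence_at_top[where w=g'])
       (use c_lim c_bd int_g in \<open>auto intro!: AE_I2 always_eventually\<close>)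
  have int_c: "integrable M (c R)" for R
    by (rule Bochner_Integration.integrable_bound[OF int_g(2)]) (use c_bd g'0 in \<open>auto intro!: AE_I2\<close>)
  define p where "p R x = max 0 (g' x - g R x)" for R x
  have [measurable]: "p R \<in> borel_measurable M" for R
    unfolding p_def by measurable
  have p_bd: "\<bar>p R x\<bar> \<le> g' x" for R x
    using g0[of R x] g'0[of x] by (auto simp: p_def)
  have p_lim: "((\<lambda>R. p R x) \<longlongrightarrow> 0) at_top" for x
  proof -
    have "((\<lambda>R. p R x) \<longlongrightarrow> max 0 (g' x - g' x)) at_top"
      unfolding p_def by (intro tendsto_intros lim_g)
    thus ?thesis by simp
  qed
  have p_int: "((\<lambda>R. LINT x|M. p R x) \<longlongrightarrow> (LINT x|M. 0)) at_top"
    by (rule integral_dominated_convergence_at_top[where w=g'])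
       (use p_lim p_bd int_g in \<open>auto intro!: AE_I2 always_eventually\<close>)
  have int_p: "integrable M (p R)" for R
    by (rule Bochner_Integration.integrable_bound[OF int_g(2)]) (use p_bd g'0 in \<open>auto intro!: AE_I2\<close>)
  have est: "\<bar>f R x - c R x\<bar> \<le> g R x - g' x + p R x" for R x
    using bound[of R x] g'0[of x] by (auto simp: c_def p_def abs_le_iff max_def min_def)
  have est_int: "\<bar>(LINT x|M. f R x) - (LINT x|M. c R x)\<bar>
      \<le> (LINT x|M. g R x) - (LINT x|M. g' x) + (LINT x|M. p R x)" for R
  proof -
    have "\<bar>(LINT x|M. f R x) - (LINT x|M. c R x)\<bar> = \<bar>LINT x|M. f R x - c R x\<bar>"
      by (simp add: int_f int_c)
    also have "\<dots> \<le> (LINT x|M. \<bar>f R x - c R x\<bar>)"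
      by (rule integral_abs_bound)
    also have "\<dots> \<le> (LINT x|M. g R x - g' x + p R x)"
      by (intro integral_mono) (use est int_f int_c int_g int_p in auto)
    finally show ?thesis
      by (simp add: int_g int_p)
  qed
  have "((\<lambda>R. (LINT x|M. g R x) - (LINT x|M. g' x) + (LINT x|M. p R x)) \<longlongrightarrow> 
      (LINT x|M. g' x) - (LINT x|M. g' x) + (LINT x|M. 0)) at_top"
    by (intro tendsto_intros lim_int p_int)
  hence "((\<lambda>R. (LINT x|M. g R x) - (LINT x|M. g' x) + (LINT x|M. p R x)) \<longlongrightarrow> 0) at_top"
    by simp
  hence "((\<lambda>R. (LINT x|M. f R x) - (LINT x|M. c R x)) \<longlongrightarrow> 0) at_top"
  proof (rule tendsto_0_le[where K=1])
    show "\<forall>\<^sub>F R in at_top. norm ((LINT x|M. f R x) - (LINT x|M. c R x)) \<le>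
        norm ((LINT x|M. g R x) - (LINT x|M. g' x) + (LINT x|M. p R x)) * 1"
      unfolding real_norm_def mult_1_right
      by (intro always_eventually allI order_trans[OF est_int abs_ge_self])
  qed
  from tendsto_add[OF this c_int] show ?thesis by simp
qed

lemma lborel_integral_affine:
  fixes f :: "'a::euclidean_space \<Rightarrow> real"
  assumes [measurable]: "f \<in> borel_measurable borel" and c: "c \<noteq> 0"
  shows "(LINT x|lborel. f x) = \<bar>c\<bar> ^ DIM('a) * (LINT x|lborel. f (a + c *\<^sub>R x))"
  by (subst lborel_affine[OF c, of a]) (simp add: integral_density integral_distr)

lemma lborel_integrable_affine:
  fixes f :: "'a::euclidean_space \<Rightarrow> real"
  assumes [measurable]: "f \<in> borel_measurable borel" and c: "c \<noteq> 0"
  shows "integrable lborel (\<lambda>x. f (a + c *\<^sub>R x)) \<longleftrightarrow> integrable lborel f"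
proof -
  have "integrable lborel f \<longleftrightarrow>
      integrable (density (distr lborel borel (\<lambda>x. a + c *\<^sub>R x)) (\<lambda>_. ennreal (\<bar>c\<bar>^DIM('a)))) f"
    by (subst lborel_affine[OF c, of a]) simp
  also have "\<dots> \<longleftrightarrow> integrable lborel (\<lambda>x. \<bar>c\<bar>^DIM('a) * f (a + c *\<^sub>R x))"
    by (subst integrable_density) (auto simp: integrable_distr_eq)
  also have "\<dots> \<longleftrightarrow> integrable lborel (\<lambda>x. f (a + c *\<^sub>R x))"
    using c by simp
  finally show ?thesis by simp
qed

text \<open>
  Polar coordinates for radial functions: both measures give the ball of radius \<open>a\<close> the mass
  \<open>\<omega> a\<^sup>d\<close>, and the half-lines generate the Borel sets.
\<close>

lemma distr_norm_lborel:
  "distr (lborel :: 'a::euclidean_space measure) borel norm =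
     density lborel (\<lambda>r. ennreal (if 0 < r then real DIM('a) * unit_ball_vol DIM('a) * r ^ (DIM('a) - 1) else 0))"
  (is "?L = density lborel ?h")
proof (rule measure_eqI_generator_eq[where E="range atMost" and A="\<lambda>n. {..real n}" and \<Omega>=UNIV])
  show "Int_stable (range atMost :: real set set)"
    by (auto simp: Int_stable_def)
  show "sets ?L = sigma_sets UNIV (range atMost)"
    by (simp add: borel_eq_atMost)
  show "sets (density lborel ?h) = sigma_sets UNIV (range atMost)"
    by (simp add: borel_eq_atMost)
  have ball: "emeasure ?L {..a} = ennreal (if 0 \<le> a then unit_ball_vol DIM('a) * a ^ DIM('a) else 0)" for a
  proof -
    have "norm -` {..a} \<inter> space lborel = (cball 0 a :: 'a set)"
      by auto
    thus ?thesis
      by (auto simp: emeasure_distr emeasure_cball)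
  qed
  show "emeasure ?L X = emeasure (density lborel ?h) X" if "X \<in> range atMost" for X
  proof -
    from that obtain a where X: "X = {..a}" by auto
    have "emeasure (density lborel ?h) X = (\<integral>\<^sup>+r. ?h r * indicator {..a} r \<partial>lborel)"
      by (simp add: emeasure_density X)
    also have "\<dots> = ennreal (if 0 \<le> a then unit_ball_vol DIM('a) * a ^ DIM('a) else 0)"
    proof (cases "0 \<le> a")
      case True
      have "(\<integral>\<^sup>+r. ?h r * indicator {..a} r \<partial>lborel) =
          (\<integral>\<^sup>+r. ennreal (real DIM('a) * unit_ball_vol DIM('a) * r ^ (DIM('a) - 1)) * indicator {0..a} r \<partial>lborel)"
        by (intro nn_integral_cong_AE)
           (use AE_lborel_singleton[of "0::real"] in \<open>eventually_elim, auto simp: indicator_def\<close>)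
      also have "\<dots> = unit_ball_vol DIM('a) * a ^ DIM('a) - unit_ball_vol DIM('a) * 0 ^ DIM('a)"
        by (rule nn_integral_FTC_Icc)
           (use True in \<open>auto intro!: derivative_eq_intros simp: mult_ac\<close>)
      finally show ?thesis using True by simp
    next
      case False
      hence "?h r * indicator {..a} r = 0" for r by (auto simp: indicator_def)
      hence "(\<integral>\<^sup>+r. ?h r * indicator {..a} r \<partial>lborel) = (\<integral>\<^sup>+r. 0 \<partial>(lborel :: real measure))"
        by (intro nn_integral_cong)
      thus ?thesis using False by simp
    qed
    finally show ?thesis using ball X by simp
  qed
  show "(\<Union>i. {..real i}) = UNIV"
    by (auto simp: real_arch_simple)
  show "emeasure ?L {..real i} \<noteq> \<infinity>" for i
    by (simp add: ball)
qed auto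

lemma has_bochner_integral_radial:
  fixes g :: "real \<Rightarrow> real"
  assumes [measurable]: "g \<in> borel_measurable borel"
    and g0: "\<And>r. 0 \<le> g r"
    and I: "(\<integral>\<^sup>+ r. ennreal (r ^ (DIM('a) - 1) * g r) * indicator {0<..} r \<partial>lborel) = ennreal I" "0 \<le> I"
  shows "has_bochner_integral lborel (\<lambda>z::'a::euclidean_space. g (norm z)) (real DIM('a) * unit_ball_vol DIM('a) * I)"
proof (rule has_bochner_integral_nn_integral)
  have "(\<integral>\<^sup>+ z. ennreal (g (norm z)) \<partial>(lborel :: 'a measure)) = (\<integral>\<^sup>+ r. ennreal (g r) \<partial>distr (lborel :: 'a measure) borel norm)"
    by (simp add: nn_integral_distr)
  also have "\<dots> = (\<integral>\<^sup>+ r. ennreal (real DIM('a) * unit_ball_vol DIM('a)) * (ennreal (r ^ (DIM('a) - 1) * g r) * indicator {0<..} r) \<partial>lborel)"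
    unfolding distr_norm_lborel
    by (subst nn_integral_density)
       (auto intro!: nn_integral_cong simp: g0 ennreal_mult[symmetric] mult_ac split: split_indicator)
  also have "\<dots> = ennreal (real DIM('a) * unit_ball_vol DIM('a)) * ennreal I"
    by (subst nn_integral_cmult) (auto simp add: I(1)[unfolded One_nat_def])
  finally show "(\<integral>\<^sup>+ z. ennreal (g (norm z)) \<partial>(lborel :: 'a measure)) = ennreal (real DIM('a) * unit_ball_vol DIM('a) * I)"
    by (simp add: ennreal_mult I)
qed (auto simp: g0 I)

lemma power_pred_mult_powr:
  "0 < (r::real) \<Longrightarrow> 0 < n \<Longrightarrow> r ^ (n - 1) * r powr (p - real n) = r powr (p - 1)"
  by (subst powr_realpow[symmetric], simp, subst powr_add[symmetric]) (simp add: of_nat_diff)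

text \<open>
  The exponents are written relative to the critical exponent \<open>-d\<close>, so that the value is the
  power \<open>s\<^sup>p/p\<close> in every dimension, times the area \<open>d \<omega>\<close> of the unit sphere.
\<close>

lemma integral_norm_powr_ball:
  fixes s p :: real
  assumes "0 < s" "0 < p"
  shows "has_bochner_integral lborel
     (\<lambda>z::'a::euclidean_space. indicator {0..<s} (norm z) * norm z powr (p - DIM('a)))
     (real DIM('a) * unit_ball_vol DIM('a) * (s powr p / p))"
proof (rule has_bochner_integral_radial)
  have "(\<integral>\<^sup>+ r. ennreal (r ^ (DIM('a) - 1) * (indicator {0..<s} r * r powr (p - DIM('a)))) * indicator {0<..} r \<partial>lborel)
     = (\<integral>\<^sup>+ r. ennreal (indicator {0..s} r * r powr (p - 1)) \<partial>lborel)"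
    by (intro nn_integral_cong_AE)
       (use AE_lborel_singleton[of s] AE_lborel_singleton[of "0::real"] in \<open>eventually_elim,
         auto simp: indicator_def power_pred_mult_powr simp del: One_nat_def\<close>)
  also have "\<dots> = ennreal (s powr p / p)"
    using nn_integral_has_integral_lebesgue[OF _ has_integral_powr_from_0[of "p - 1" s]] assms
    by (simp add: nn_integral_completion)
  finally show "(\<integral>\<^sup>+ r. ennreal (r ^ (DIM('a) - 1) * (indicator {0..<s} r * r powr (p - DIM('a)))) * indicator {0<..} r \<partial>lborel)
     = ennreal (s powr p / p)" .
qed (use assms in auto)

lemma integral_norm_powr_outside:
  fixes s p :: real
  assumes "0 < s" "0 < p"
  shows "has_bochner_integral lborel
     (\<lambda>z::'a::euclidean_space. indicator {s..} (norm z) * norm z powr (- p - DIM('a)))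
     (real DIM('a) * unit_ball_vol DIM('a) * (s powr (- p) / p))"
proof (rule has_bochner_integral_radial)
  have "(\<integral>\<^sup>+ r. ennreal (r ^ (DIM('a) - 1) * (indicator {s..} r * r powr (- p - DIM('a)))) * indicator {0<..} r \<partial>lborel)
     = (\<integral>\<^sup>+ r. ennreal (r powr (- p - 1)) * indicator {s..} r \<partial>lborel)"
    by (intro nn_integral_cong)
       (use assms in \<open>auto simp: indicator_def power_pred_mult_powr simp del: One_nat_def\<close>)
  also have "\<dots> = ennreal (0 - (- (s powr (- p) / p)))"
  proof (rule nn_integral_FTC_atLeast)
    show "((\<lambda>r. - (r powr (- p) / p)) \<longlongrightarrow> 0) at_top"
      using assms by real_asymp
    show "((\<lambda>r. - (r powr (- p) / p)) has_real_derivative r powr (- p - 1)) (at r)" if "s \<le> r" for r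
      using that assms by (auto intro!: derivative_eq_intros)
  qed auto
  finally show "(\<integral>\<^sup>+ r. ennreal (r ^ (DIM('a) - 1) * (indicator {s..} r * r powr (- p - DIM('a)))) * indicator {0<..} r \<partial>lborel)
     = ennreal (s powr (- p) / p)" by simp
qed (use assms in auto)

lemma integrable_gaussian:
  "integrable lborel (\<lambda>z::'a::euclidean_space. exp (- (norm z)\<^sup>2))"
proof -
  have "integrable lborel (\<lambda>z::'a. indicator {0..<1} (norm z) * norm z powr (real DIM('a) - DIM('a)) 
     + real DIM('a) ^ DIM('a) * (indicator {1..} (norm z) * norm z powr (- real DIM('a) - DIM('a))))"
    by (intro Bochner_Integration.integrable_add integrable_mult_right 
        integral_norm_powr_ball[THEN integrable.intros] integral_norm_powr_outside[THEN integrable.intros]) auto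
  then show ?thesis
  proof (rule Bochner_Integration.integrable_bound)
    show "AE z in lborel. norm (exp (- (norm (z::'a))\<^sup>2)) \<le> norm (indicator {0..<1} (norm z) * norm z powr (real DIM('a) - DIM('a)) 
     + real DIM('a) ^ DIM('a) * (indicator {1..} (norm z) * norm z powr (- real DIM('a) - DIM('a))))"
      using AE_lborel_singleton[of "0::'a"]
    proof eventually_elim
      fix z :: 'a assume "z \<noteq> 0"
      hence z: "0 < norm z" by simp
      show "norm (exp (- (norm (z::'a))\<^sup>2)) \<le> norm (indicator {0..<1} (norm z) * norm z powr (real DIM('a) - DIM('a)) 
         + real DIM('a) ^ DIM('a) * (indicator {1..} (norm z) * norm z powr (- real DIM('a) - DIM('a))))"
      proof (cases "norm z < 1")
        case True
        thus ?thesis using z by (auto simp: indicator_def)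
      next
        case False
        have "((norm z)\<^sup>2 / DIM('a)) ^ DIM('a) \<le> (1 + (norm z)\<^sup>2 / DIM('a)) ^ DIM('a)"
          by (intro power_mono) auto
        also have "\<dots> \<le> exp ((norm z)\<^sup>2)"
          by (rule exp_ge_one_plus_x_over_n_power_n) (auto intro: order_trans[of _ 0])
        finally have "norm z ^ (2 * DIM('a)) \<le> exp ((norm z)\<^sup>2) * real DIM('a) ^ DIM('a)"
          by (simp add: power_divide power_mult divide_le_eq)
        hence "exp (- (norm z)\<^sup>2) \<le> real DIM('a) ^ DIM('a) / norm z ^ (2 * DIM('a))"
          using z by (simp add: exp_minus field_simps)
        also have "\<dots> = real DIM('a) ^ DIM('a) * norm z powr (- real DIM('a) - DIM('a))"
          using z by (simp add: powr_minus_divide powr_realpow[symmetric] flip: minus_add_distrib)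
        finally show ?thesis
          using False by (simp add: indicator_def)
      qed
    qed
  qed auto
qed

section \<open>Convergence of Laplace transforms\<close>

text \<open>
  Karamata's argument. The substitution \<open>x = exp (-t)\<close> turns \<open>(0,\<infinity>)\<close> into the unit interval and
  the moments into integrals of monomials; polynomials are uniformly dense in the continuous
  functions on \<open>[0,1]\<close>, and the total masses stay bounded, so the convergence of moments extends to
  every \<open>g\<close> that is continuous on \<open>(0,\<infinity>)\<close> with limits at both ends.
\<close>

lemma tendsto_integral_exp_moments:
  fixes w :: "real \<Rightarrow> real \<Rightarrow> real" and w' g :: "real \<Rightarrow> real"
  assumes int: "\<And>R. integrable lborel (w R)" "integrable lborel w'"
    and nonneg: "\<And>R t. 0 \<le> w R t" "\<And>t. 0 \<le> w' t"
    and zero: "\<And>R t. t \<le> 0 \<Longrightarrow> w R t = 0" "\<And>t. t \<le> 0 \<Longrightarrow> w' t = 0"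
    and moments: "\<And>k::nat. ((\<lambda>R. LINT t|lborel. exp (- t) ^ k * w R t) \<longlongrightarrow>
                      (LINT t|lborel. exp (- t) ^ k * w' t)) at_top"
    and g_cont: "continuous_on {0<..} g"
    and g_0: "(g \<longlongrightarrow> a) (at_right 0)" and g_top: "(g \<longlongrightarrow> b) at_top"
  shows "((\<lambda>R. LINT t|lborel. g t * w R t) \<longlongrightarrow> (LINT t|lborel. g t * w' t)) at_top"
proof -
  \<comment> \<open>\<open>g\<close> in the variable \<open>x\<close>, continued by its limits beyond \<open>[0,1]\<close>.\<close>
  define f where "f x = (if x \<le> 0 then b else if 1 \<le> x then a else g (- ln x))" for x
  have f_cont: "isCont f x" for x
  proof -
    consider "x < 0" | "x = 0" | "0 < x" "x < 1" | "x = 1" | "1 < x" by linarith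
    thus ?thesis
    proof cases
      case 1
      have "\<forall>\<^sub>F y in nhds x. f y = b"
        using eventually_nhds_in_open[of "{..<0}" x] 1 by (auto elim!: eventually_mono simp: f_def)
      thus ?thesis by (subst isCont_cong) auto
    next
      case 5
      have "\<forall>\<^sub>F y in nhds x. f y = a"
        using eventually_nhds_in_open[of "{1<..}" x] 5 by (auto elim!: eventually_mono simp: f_def)
      thus ?thesis by (subst isCont_cong) auto
    next
      case 3
      have "\<forall>\<^sub>F y in nhds x. f y = g (- ln y)"
        using eventually_nhds_in_open[of "{0<..<1}" x] 3 by (auto elim!: eventually_mono simp: f_def)
      moreover have "isCont (\<lambda>y. g (- ln y)) x"
      proof (rule isCont_o2[where f="\<lambda>y. - ln y"])
        show "isCont (\<lambda>y. - ln y) x" using 3 by (intro continuous_intros) auto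
        show "isCont g (- ln x)"
          using g_cont 3 by (simp add: continuous_on_eq_continuous_at)
      qed
      ultimately show ?thesis using isCont_cong[of f "\<lambda>y. g (- ln y)" x] by simp
    next
      case 2
      have "(f \<longlongrightarrow> b) (at_left 0)"
        by (rule tendsto_eventually) (auto simp: eventually_at_filter f_def)
      moreover have "(f \<longlongrightarrow> b) (at_right 0)"
      proof (rule Lim_transform_eventually)
        have "filterlim (\<lambda>x::real. - ln x) at_top (at_right 0)" by real_asymp
        thus "((\<lambda>x. g (- ln x)) \<longlongrightarrow> b) (at_right 0)"
          by (rule filterlim_compose[OF g_top])
        show "\<forall>\<^sub>F x in at_right 0. g (- ln x) = f x"
          unfolding eventually_at_filter
          by (rule eventually_mono[OF eventually_nhds_in_open[of "{..<1}"]]) (auto simp: f_def)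
      qed
      ultimately show ?thesis
        using 2 by (auto simp: isCont_def f_def intro: filterlim_split_at)
    next
      case 4
      have "(f \<longlongrightarrow> a) (at_right 1)"
        by (rule tendsto_eventually) (auto simp: eventually_at_filter f_def)
      moreover have "(f \<longlongrightarrow> a) (at_left 1)"
      proof (rule Lim_transform_eventually)
        have "filterlim (\<lambda>x::real. - ln x) (at_right 0) (at_left 1)" by real_asymp
        thus "((\<lambda>x. g (- ln x)) \<longlongrightarrow> a) (at_left 1)"
          by (rule filterlim_compose[OF g_0])
        show "\<forall>\<^sub>F x in at_left 1. g (- ln x) = f x"
          by (auto simp: f_def eventually_at_filter intro!: eventually_mono[OF eventually_nhds_in_open[of "{0<..}"]])
      qed
      ultimately show ?thesis
        using 4 by (auto simp: isCont_def f_def intro: filterlim_split_at)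
    qed
  qed
  hence f_contU: "continuous_on S f" for S
    by (simp add: continuous_at_imp_continuous_on)
  have [measurable]: "f \<in> borel_measurable borel"
    by (rule borel_measurable_continuous_onI[OF f_contU])
  have [measurable]: "w R \<in> borel_measurable borel" "w' \<in> borel_measurable borel" for R
    using int(1)[of R] int(2) by auto
  have gf: "(LINT t|lborel. g t * v t) = (LINT t|lborel. f (exp (- t)) * v t)"
    if "\<And>t. t \<le> 0 \<Longrightarrow> v t = 0" for v :: "real \<Rightarrow> real"
  proof (rule Bochner_Integration.integral_cong[OF refl])
    fix t :: real
    show "g t * v t = f (exp (- t)) * v t"
      using that[of t] by (cases "t \<le> 0") (auto simp: f_def)
  qed
  define W where "W = (LINT t|lborel. w' t)"
  have W0: "0 \<le> W" unfolding W_def by (simp add: nonneg)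
  have mass: "((\<lambda>R. LINT t|lborel. w R t) \<longlongrightarrow> W) at_top"
    using moments[of 0] by (simp add: W_def)
  have "((\<lambda>R. LINT t|lborel. f (exp (- t)) * w R t) \<longlongrightarrow> (LINT t|lborel. f (exp (- t)) * w' t)) at_top"
  proof (rule tendstoI)
    fix e :: real assume e: "0 < e"
    \<comment> \<open>Approximating \<open>f\<close> up to \<open>\<delta>\<close> costs \<open>e/4\<close> for \<open>w R\<close> and for \<open>w'\<close>; another \<open>e/4\<close> goes to the polynomial.\<close>
    define \<delta> where "\<delta> = e / (4 * (W + 1))"
    have \<delta>: "0 < \<delta>" using e W0 by (simp add: \<delta>_def)
    obtain p where p: "real_polynomial_function p" and fp: "\<And>x. x \<in> {0..1} \<Longrightarrow> \<bar>f x - p x\<bar> < \<delta>"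
      using Stone_Weierstrass_real_polynomial_function[OF _ f_contU \<delta>, of "{0..1}"] by auto
    from p obtain c n where pc: "p = (\<lambda>x. \<Sum>i\<le>n. c i * x ^ i)"
      by (auto simp: real_polynomial_function_iff_sum)
    have int_mom: "integrable lborel (\<lambda>t. exp (- t) ^ k * v t)"
      if "integrable lborel v" "\<And>t. t \<le> 0 \<Longrightarrow> v t = 0" for v :: "real \<Rightarrow> real" and k
    proof (rule Bochner_Integration.integrable_bound[OF that(1)])
      show "AE t in lborel. norm (exp (- t) ^ k * v t) \<le> norm (v t)"
      proof (intro AE_I2)
        fix t :: real
        show "norm (exp (- t) ^ k * v t) \<le> norm (v t)"
        proof (cases "t \<le> 0")
          case False
          hence "exp (- t) ^ k \<le> 1" by (intro power_le_one) auto
          thus ?thesis by (simp add: abs_mult mult_left_le_one_le)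
        qed (simp add: that)
      qed
    qed (use that in measurable)
    have p_expand: "p (exp (- t)) * v = (\<Sum>i\<le>n. c i * (exp (- t) ^ i * v))" for t v
      by (simp add: pc sum_distrib_right mult.assoc)
    have int_p: "integrable lborel (\<lambda>t. p (exp (- t)) * v t)"
      if "integrable lborel v" "\<And>t. t \<le> 0 \<Longrightarrow> v t = 0" for v :: "real \<Rightarrow> real"
      unfolding p_expand
      by (intro Bochner_Integration.integrable_sum integrable_mult_right int_mom that)
    have int_p_eq: "(LINT t|lborel. p (exp (- t)) * v t) = (\<Sum>i\<le>n. c i * (LINT t|lborel. exp (- t) ^ i * v t))"
      if "integrable lborel v" "\<And>t. t \<le> 0 \<Longrightarrow> v t = 0" for v :: "real \<Rightarrow> real"
      unfolding p_expand
      by (subst Bochner_Integration.integral_sum) (auto intro!: integrable_mult_right int_mom that)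
    have p_lim: "((\<lambda>R. LINT t|lborel. p (exp (- t)) * w R t) \<longlongrightarrow> (LINT t|lborel. p (exp (- t)) * w' t)) at_top"
      by (subst (1 2) int_p_eq) (auto intro!: tendsto_intros moments int zero)
    have close: "\<bar>(LINT t|lborel. f (exp (- t)) * v t) - (LINT t|lborel. p (exp (- t)) * v t)\<bar>
         \<le> \<delta> * (LINT t|lborel. v t)"
      if v: "integrable lborel v" "\<And>t. t \<le> 0 \<Longrightarrow> v t = 0" "\<And>t. 0 \<le> v t" for v :: "real \<Rightarrow> real"
    proof -
      have [measurable]: "v \<in> borel_measurable borel" using v(1) by auto
      have bd: "\<bar>f (exp (- t)) * v t - p (exp (- t)) * v t\<bar> \<le> \<delta> * v t" for t
      proof (cases "t \<le> 0")
        case False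
        have "\<bar>f (exp (- t)) * v t - p (exp (- t)) * v t\<bar> = \<bar>f (exp (- t)) - p (exp (- t))\<bar> * v t"
          using v(3)[of t] by (simp add: left_diff_distrib[symmetric] abs_mult)
        also have "\<dots> \<le> \<delta> * v t"
          using fp[of "exp (- t)"] False v(3)[of t] by (intro mult_right_mono) auto
        finally show ?thesis .
      qed (simp add: v)
      have int_diff: "integrable lborel (\<lambda>t. f (exp (- t)) * v t - p (exp (- t)) * v t)"
      proof (rule Bochner_Integration.integrable_bound)
        show "integrable lborel (\<lambda>t. \<delta> * v t)" using v by simp
        show "AE t in lborel. norm (f (exp (- t)) * v t - p (exp (- t)) * v t) \<le> norm (\<delta> * v t)"
          using bd \<delta> v(3) by (intro AE_I2) (simp add: abs_mult)
        have [measurable]: "(\<lambda>t. p (exp (- t)) * v t) \<in> borel_measurable lborel"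
          using int_p[OF v(1,2)] by (rule borel_measurable_integrable)
        show "(\<lambda>t. f (exp (- t)) * v t - p (exp (- t)) * v t) \<in> borel_measurable lborel"
          by measurable
      qed
      have int_f: "integrable lborel (\<lambda>t. f (exp (- t)) * v t)"
        using Bochner_Integration.integrable_add[OF int_diff int_p[OF v(1,2)]] by simp
      have "\<bar>(LINT t|lborel. f (exp (- t)) * v t) - (LINT t|lborel. p (exp (- t)) * v t)\<bar>
         = \<bar>LINT t|lborel. f (exp (- t)) * v t - p (exp (- t)) * v t\<bar>"
        using int_f int_p[OF v(1,2)] by simp
      also have "\<dots> \<le> (LINT t|lborel. \<bar>f (exp (- t)) * v t - p (exp (- t)) * v t\<bar>)"
        by (rule integral_abs_bound)
      also have "\<dots> \<le> (LINT t|lborel. \<delta> * v t)"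
        by (rule integral_mono) (use bd v int_diff in auto)
      finally show ?thesis by simp
    qed
    have "\<forall>\<^sub>F R in at_top. (LINT t|lborel. w R t) < W + 1"
      using order_tendstoD(2)[OF mass, of "W + 1"] by simp
    moreover have "\<forall>\<^sub>F R in at_top. dist (LINT t|lborel. p (exp (- t)) * w R t) (LINT t|lborel. p (exp (- t)) * w' t) < e / 4"
      using tendstoD[OF p_lim, of "e/4"] e by simp
    ultimately show "\<forall>\<^sub>F R in at_top. dist (LINT t|lborel. f (exp (- t)) * w R t) (LINT t|lborel. f (exp (- t)) * w' t) < e"
    proof eventually_elim
      case (elim R)
      have "\<delta> * (LINT t|lborel. w R t) \<le> \<delta> * (W + 1)"
        using elim(1) \<delta> by simp
      moreover have "\<delta> * (LINT t|lborel. w' t) \<le> \<delta> * (W + 1)"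
        using \<delta> by (simp add: W_def)
      moreover have "\<delta> * (W + 1) = e / 4"
        using W0 by (simp add: \<delta>_def field_simps)
      moreover have "\<bar>(LINT t|lborel. f (exp (- t)) * w R t) - (LINT t|lborel. p (exp (- t)) * w R t)\<bar>
           \<le> \<delta> * (LINT t|lborel. w R t)"
        by (rule close) (use int zero nonneg in auto)
      moreover have "\<bar>(LINT t|lborel. f (exp (- t)) * w' t) - (LINT t|lborel. p (exp (- t)) * w' t)\<bar>
           \<le> \<delta> * (LINT t|lborel. w' t)"
        by (rule close) (use int zero nonneg in auto)
      ultimately show ?case
        using elim(2) e unfolding dist_real_def by linarith
    qed
  qed
  thus ?thesis
    using zero by (subst (1 2) gf) auto
qed

text \<open>
  Extension by zero to the negative half-line lets every integral over \<open>(0,\<infinity>)\<close> run over the line.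
\<close>

definition levy_density :: "(real \<Rightarrow> real) \<Rightarrow> bool" where
  "levy_density \<nu> \<longleftrightarrow> \<nu> \<in> borel_measurable borel \<and> (\<forall>t. 0 \<le> \<nu> t) \<and> (\<forall>t\<le>0. \<nu> t = 0) \<and>
     integrable lborel (\<lambda>t. min 1 t * \<nu> t)"

definition bernstein_fun :: "(real \<Rightarrow> real) \<Rightarrow> real \<Rightarrow> real" where
  "bernstein_fun \<nu> u = (LINT t|lborel. (1 - exp (- (u * t))) * \<nu> t)"

lemma levy_densityD:
  assumes "levy_density \<nu>"
  shows "\<nu> \<in> borel_measurable borel" "0 \<le> \<nu> t" "t \<le> 0 \<Longrightarrow> \<nu> t = 0"
    "integrable lborel (\<lambda>t. min 1 t * \<nu> t)"
  using assms by (auto simp: levy_density_def)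

lemma integrable_levy_density:
  assumes \<nu>: "levy_density \<nu>" and [measurable]: "k \<in> borel_measurable borel"
    and k: "\<And>t. 0 < t \<Longrightarrow> \<bar>k t\<bar> \<le> C * min 1 t"
  shows "integrable lborel (\<lambda>t. k t * \<nu> t)"
proof (rule Bochner_Integration.integrable_bound)
  show "integrable lborel (\<lambda>t. C * (min 1 t * \<nu> t))"
    using levy_densityD(4)[OF \<nu>] by simp
  show "AE t in lborel. norm (k t * \<nu> t) \<le> norm (C * (min 1 t * \<nu> t))"
  proof (intro AE_I2)
    fix t :: real
    show "norm (k t * \<nu> t) \<le> norm (C * (min 1 t * \<nu> t))"
    proof (cases "t \<le> 0")
      case False
      have "\<bar>k t\<bar> * \<nu> t \<le> C * min 1 t * \<nu> t"
        using k[of t] False levy_densityD(2)[OF \<nu>, of t] by (intro mult_right_mono) auto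
      also have "\<dots> \<le> \<bar>C\<bar> * min 1 t * \<nu> t"
        using False levy_densityD(2)[OF \<nu>, of t] by (intro mult_right_mono) auto
      finally show ?thesis
        using False levy_densityD(2)[OF \<nu>, of t] by (simp add: abs_mult mult_ac)
    qed (simp add: levy_densityD(3)[OF \<nu>])
  qed
qed (use levy_densityD(1)[OF \<nu>] in measurable)

lemma one_minus_exp_le:
  assumes "0 \<le> u" "0 < (t::real)"
  shows "\<bar>1 - exp (- (u * t))\<bar> \<le> max 1 u * min 1 t"
proof -
  have "0 \<le> 1 - exp (- (u * t))" using assms by simp
  moreover have "1 - exp (- (u * t)) \<le> u * t"
    using exp_ge_add_one_self[of "- (u * t)"] by linarith
  moreover have "u * t \<le> max 1 u * t" "1 \<le> max 1 u"
    using assms by (auto intro!: mult_right_mono)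
  moreover have "0 < exp (- (u * t))" by simp
  ultimately show ?thesis
    by (cases "1 \<le> t"; unfold min_def; simp; linarith)
qed

lemma integrable_one_minus_exp_levy:
  assumes "levy_density \<nu>" "0 \<le> u"
  shows "integrable lborel (\<lambda>t. (1 - exp (- (u * t))) * \<nu> t)"
  by (rule integrable_levy_density[OF assms(1) _ one_minus_exp_le[OF assms(2)]]) auto

text \<open>
  For Levy densities the finite measures to which the moment argument applies are
  \<open>(1 - exp (-t)) \<nu>(t) dt\<close>; their moments are the increments of the Bernstein function between
  consecutive integers.
\<close>

lemma levy_density_convergence:
  fixes \<nu> :: "real \<Rightarrow> real \<Rightarrow> real"
  assumes \<nu>: "\<And>R. levy_density (\<nu> R)" "levy_density \<nu>'"
    and conv: "\<And>u. 0 < u \<Longrightarrow> ((\<lambda>R. bernstein_fun (\<nu> R) u) \<longlongrightarrow> bernstein_fun \<nu>' u) at_top"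
    and g_cont: "continuous_on {0<..} g"
    and g_0: "(g \<longlongrightarrow> a) (at_right 0)" and g_top: "(g \<longlongrightarrow> b) at_top"
  shows "((\<lambda>R. LINT t|lborel. (1 - exp (- t)) * g t * \<nu> R t) \<longlongrightarrow>
           (LINT t|lborel. (1 - exp (- t)) * g t * \<nu>' t)) at_top"
proof -
  have moment: "(LINT t|lborel. exp (- t) ^ k * ((1 - exp (- t)) * v t)) =
      bernstein_fun v (real (Suc k)) - bernstein_fun v (real k)" if v: "levy_density v" for v k
  proof -
    have "exp (- t) ^ k * ((1 - exp (- t)) * v t) =
        (1 - exp (- (real (Suc k) * t))) * v t - (1 - exp (- (real k * t))) * v t" for t
      by (simp add: algebra_simps exp_of_nat_mult[symmetric] mult_exp_exp exp_add[symmetric])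
    thus ?thesis
      unfolding bernstein_fun_def
      using integrable_one_minus_exp_levy[OF v, of "real (Suc k)"] integrable_one_minus_exp_levy[OF v, of "real k"]
      by simp
  qed
  have conv0: "((\<lambda>R. bernstein_fun (\<nu> R) (real k)) \<longlongrightarrow> bernstein_fun \<nu>' (real k)) at_top" for k
    by (cases "k = 0") (auto simp: bernstein_fun_def[of _ 0] intro: conv)
  have "((\<lambda>R. LINT t|lborel. g t * ((1 - exp (- t)) * \<nu> R t)) \<longlongrightarrow>
           (LINT t|lborel. g t * ((1 - exp (- t)) * \<nu>' t))) at_top"
  proof (rule tendsto_integral_exp_moments[where w="\<lambda>R t. (1 - exp (- t)) * \<nu> R t"
        and w'="\<lambda>t. (1 - exp (- t)) * \<nu>' t", OF _ _ _ _ _ _ _ g_cont g_0 g_top])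
    show "integrable lborel (\<lambda>t. (1 - exp (- t)) * \<nu> R t)" for R
      using integrable_one_minus_exp_levy[OF \<nu>(1), of 1] by simp
    show "integrable lborel (\<lambda>t. (1 - exp (- t)) * \<nu>' t)"
      using integrable_one_minus_exp_levy[OF \<nu>(2), of 1] by simp
    have nn: "0 \<le> (1 - exp (- t)) * v t" if "levy_density v" for v t
      using levy_densityD(2,3)[OF that, of t] by (cases "t \<le> 0") auto
    show "0 \<le> (1 - exp (- t)) * \<nu> R t" "0 \<le> (1 - exp (- t)) * \<nu>' t" for R t
      using nn \<nu> by auto
    show "(1 - exp (- t)) * \<nu> R t = 0" "(1 - exp (- t)) * \<nu>' t = 0" if "t \<le> 0" for R t
      using levy_densityD(3)[OF \<nu>(1) that] levy_densityD(3)[OF \<nu>(2) that] by auto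
    show "((\<lambda>R. LINT t|lborel. exp (- t) ^ k * ((1 - exp (- t)) * \<nu> R t)) \<longlongrightarrow>
        (LINT t|lborel. exp (- t) ^ k * ((1 - exp (- t)) * \<nu>' t))) at_top" for k
      unfolding moment[OF \<nu>(1)] moment[OF \<nu>(2)] by (intro tendsto_intros conv0)
  qed
  thus ?thesis by (simp add: mult_ac)
qed

section \<open>Jump kernels of Levy densities\<close>

lemma jump_kernel_levy:
  assumes "levy_density \<nu>"
  shows "jump_kernel d \<nu> r = (4 * pi) powr (- (real d / 2)) *
     (LINT t|lborel. t powr (- (real d / 2)) * exp (- (r\<^sup>2 / (4 * t))) * \<nu> t)"
proof -
  have "indicator {0<..} t *\<^sub>R (t powr (- (real d / 2)) * exp (- (r\<^sup>2 / (4 * t))) * \<nu> t) =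
     t powr (- (real d / 2)) * exp (- (r\<^sup>2 / (4 * t))) * \<nu> t" for t
    using levy_densityD(3)[OF assms, of t] by (auto simp: indicator_def)
  thus ?thesis unfolding jump_kernel_def set_lebesgue_integral_def by presburger
qed

lemma powr_mult_exp_minus_le:
  fixes y p :: real
  assumes "0 < y" "0 < p"
  shows "y powr p * exp (- y) \<le> p powr p"
proof -
  have "y / p \<le> exp (y / p)"
    using exp_ge_add_one_self[of "y / p"] by linarith
  hence "(y / p) powr p \<le> exp (y / p) powr p"
    using assms by (intro powr_mono2) auto
  also have "\<dots> = exp y"
    using assms by (simp add: exp_powr_real)
  finally show ?thesis
    using assms by (simp add: powr_divide exp_minus divide_simps mult_ac)
qed

text \<open>
  With \<open>y = r\<^sup>2/(4t)\<close> the bounds \<open>y\<^sup>p exp (-y) \<le> p\<^sup>p\<close> for \<open>p = d/2\<close> and \<open>p = d/2 + 1\<close> give the bounds by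
  a constant and by a multiple of \<open>t\<close>.
\<close>

lemma heat_factor_le:
  assumes "r \<noteq> 0" "0 < d"
  obtains C where "0 \<le> C" "\<And>t. 0 < t \<Longrightarrow> t powr (- (real d / 2)) * exp (- (r\<^sup>2 / (4 * t))) \<le> C * min 1 t"
proof -
  have bd: "t powr (- (real d / 2)) * exp (- (r\<^sup>2 / (4 * t))) \<le> 
      (r\<^sup>2 / 4) powr (- p) * p powr p * t powr (p - real d / 2)" if t: "0 < t" and p: "0 < p" for t p
  proof -
    have "(r\<^sup>2 / (4 * t)) powr p * exp (- (r\<^sup>2 / (4 * t))) \<le> p powr p"
      by (rule powr_mult_exp_minus_le) (use assms t p in auto)
    moreover have "(r\<^sup>2 / (4 * t)) powr p = (r\<^sup>2 / 4) powr p * t powr (- p)"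
      using assms t by (simp add: powr_minus powr_divide powr_mult divide_simps)
    ultimately have "(r\<^sup>2 / 4) powr p * t powr (- p) * exp (- (r\<^sup>2 / (4 * t))) \<le> p powr p" by simp
    hence "((r\<^sup>2 / 4) powr (- p) * t powr (p - real d / 2)) * ((r\<^sup>2 / 4) powr p * t powr (- p) * exp (- (r\<^sup>2 / (4 * t))))
        \<le> ((r\<^sup>2 / 4) powr (- p) * t powr (p - real d / 2)) * p powr p"
      by (intro mult_left_mono) auto
    moreover have "(r\<^sup>2 / 4) powr (- p) * (r\<^sup>2 / 4) powr p = 1"
      using assms by (simp add: powr_minus)
    moreover have "t powr (p - real d / 2) * t powr (- p) = t powr (- (real d / 2))"
      by (simp add: powr_add[symmetric])
    moreover have "((r\<^sup>2 / 4) powr (- p) * t powr (p - real d / 2)) * ((r\<^sup>2 / 4) powr p * t powr (- p) * E) =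
        ((r\<^sup>2 / 4) powr (- p) * (r\<^sup>2 / 4) powr p) * (t powr (p - real d / 2) * t powr (- p)) * E" for E
      by (simp only: mult_ac)
    ultimately have "1 * t powr (- (real d / 2)) * exp (- (r\<^sup>2 / (4 * t)))
        \<le> ((r\<^sup>2 / 4) powr (- p) * t powr (p - real d / 2)) * p powr p"
      by simp
    thus ?thesis by (simp add: mult_ac)
  qed
  define C where "C = (\<Sum>p\<in>{real d / 2, real d / 2 + 1}. (r\<^sup>2 / 4) powr (- p) * p powr p)"
  show thesis
  proof (rule that)
    show "0 \<le> C" unfolding C_def by (intro sum_nonneg) auto
    fix t :: real assume t: "0 < t"
    have C: "(r\<^sup>2 / 4) powr (- p) * p powr p \<le> C" if "p \<in> {real d / 2, real d / 2 + 1}" for p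
      unfolding C_def by (rule member_le_sum[OF that]) auto
    have "t powr (- (real d / 2)) * exp (- (r\<^sup>2 / (4 * t))) \<le> C * 1"
      using bd[OF t, of "real d / 2"] C[of "real d / 2"] t \<open>0 < d\<close> by simp
    moreover have "t powr (- (real d / 2)) * exp (- (r\<^sup>2 / (4 * t))) \<le> C * t"
    proof -
      define B where "B = (r\<^sup>2 / 4) powr (- (real d / 2 + 1)) * (real d / 2 + 1) powr (real d / 2 + 1)"
      have "t powr (- (real d / 2)) * exp (- (r\<^sup>2 / (4 * t))) \<le> B * t"
        using bd[OF t, of "real d / 2 + 1"] t unfolding B_def by simp
      also have "\<dots> \<le> C * t"
        using C[of "real d / 2 + 1"] t unfolding B_def by (intro mult_right_mono) auto
      finally show ?thesis .
    qed
    ultimately show "t powr (- (real d / 2)) * exp (- (r\<^sup>2 / (4 * t))) \<le> C * min 1 t"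
      by (simp add: min_def)
  qed
qed

lemma integrable_jump_kernel:
  assumes "levy_density \<nu>" "r \<noteq> 0" "0 < d"
  shows "integrable lborel (\<lambda>t. t powr (- (real d / 2)) * exp (- (r\<^sup>2 / (4 * t))) * \<nu> t)"
proof -
  obtain C where "0 \<le> C" "\<And>t. 0 < t \<Longrightarrow> t powr (- (real d / 2)) * exp (- (r\<^sup>2 / (4 * t))) \<le> C * min 1 t"
    using heat_factor_le[OF assms(2,3)] by blast
  thus ?thesis
    by (intro integrable_levy_density[OF assms(1), where C=C]) (auto simp: abs_mult)
qed

lemma jump_kernel_nonneg:
  assumes "levy_density \<nu>"
  shows "0 \<le> jump_kernel d \<nu> r"
  unfolding jump_kernel_levy[OF assms] using levy_densityD(2)[OF assms]
  by (intro mult_nonneg_nonneg Bochner_Integration.integral_nonneg) auto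

lemma jump_kernel_antimono:
  assumes "levy_density \<nu>" "0 < d" "0 < r" "r \<le> s"
  shows "jump_kernel d \<nu> s \<le> jump_kernel d \<nu> r"
  unfolding jump_kernel_levy[OF assms(1)]
proof (intro mult_left_mono integral_mono)
  fix t :: real
  have "r\<^sup>2 \<le> s\<^sup>2" using assms by (intro power_mono) auto
  show "t powr (- (real d / 2)) * exp (- (s\<^sup>2 / (4 * t))) * \<nu> t \<le> t powr (- (real d / 2)) * exp (- (r\<^sup>2 / (4 * t))) * \<nu> t"
  proof (cases "t \<le> 0")
    case False
    thus ?thesis using \<open>r\<^sup>2 \<le> s\<^sup>2\<close> levy_densityD(2)[OF assms(1), of t]
      by (intro mult_right_mono mult_left_mono) (auto intro!: divide_right_mono)
  qed (simp add: levy_densityD(3)[OF assms(1)])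
qed (use assms integrable_jump_kernel in auto)

lemma borel_measurable_jump_kernel:
  assumes "levy_density \<nu>"
  shows "jump_kernel d \<nu> \<in> borel_measurable borel"
proof -
  have [measurable]: "\<nu> \<in> borel_measurable borel" by (rule levy_densityD(1)[OF assms])
  have "(\<lambda>r. (4 * pi) powr (- (real d / 2)) *
     (LINT t|lborel. t powr (- (real d / 2)) * exp (- (r\<^sup>2 / (4 * t))) * \<nu> t)) \<in> borel_measurable borel"
    by measurable
  thus ?thesis unfolding jump_kernel_levy[OF assms, abs_def] .
qed

lemma jump_kernel_tendsto:
  fixes \<nu> :: "real \<Rightarrow> real \<Rightarrow> real"
  assumes \<nu>: "\<And>R. levy_density (\<nu> R)" "levy_density \<nu>'"
    and conv: "\<And>u. 0 < u \<Longrightarrow> ((\<lambda>R. bernstein_fun (\<nu> R) u) \<longlongrightarrow> bernstein_fun \<nu>' u) at_top"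
    and r: "r \<noteq> 0" and d: "0 < d"
  shows "((\<lambda>R. jump_kernel d (\<nu> R) r) \<longlongrightarrow> jump_kernel d \<nu>' r) at_top"
proof -
  define g where "g t = t powr (- (real d / 2)) * exp (- (r\<^sup>2 / (4 * t))) / (1 - exp (- t))" for t :: real
  have eq: "(1 - exp (- t)) * g t * v t = t powr (- (real d / 2)) * exp (- (r\<^sup>2 / (4 * t))) * v t"
    if "levy_density v" for t v
    using levy_densityD(3)[OF that, of t] by (cases "t \<le> 0") (auto simp: g_def)
  have "r\<^sup>2 > 0" using r by simp
  have "((\<lambda>R. LINT t|lborel. (1 - exp (- t)) * g t * \<nu> R t) \<longlongrightarrow>
           (LINT t|lborel. (1 - exp (- t)) * g t * \<nu>' t)) at_top"
  proof (rule levy_density_convergence[OF \<nu> conv])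
    show "continuous_on {0<..} g"
      unfolding g_def by (intro continuous_intros) auto
    show "(g \<longlongrightarrow> 0) (at_right 0)"
      unfolding g_def using \<open>r\<^sup>2 > 0\<close> d by real_asymp
    show "(g \<longlongrightarrow> 0) at_top"
      unfolding g_def using \<open>r\<^sup>2 > 0\<close> d by real_asymp
  qed
  thus ?thesis
    unfolding eq[OF \<nu>(1)] eq[OF \<nu>(2)] jump_kernel_levy[OF \<nu>(1)] jump_kernel_levy[OF \<nu>(2)]
    by (intro tendsto_intros)
qed

text \<open>
  The number \<open>\<pi>\<close> to the power \<open>d/2\<close>; the argument carries the dimension.
\<close>

definition gauss_mass :: "'a::euclidean_space itself \<Rightarrow> real" where
  "gauss_mass _ = (LINT z|lborel. exp (- (norm (z::'a))\<^sup>2))"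

lemma has_bochner_integral_gaussian:
  assumes c: "0 < c"
  shows "has_bochner_integral lborel (\<lambda>z::'a::euclidean_space. exp (- (c * (norm z)\<^sup>2)))
     (c powr (- (DIM('a) / 2)) * gauss_mass TYPE('a))"
proof -
  have eq: "exp (- (norm (0 + sqrt c *\<^sub>R z))\<^sup>2) = exp (- (c * (norm z)\<^sup>2))" for z :: 'a
    using c by (simp add: power_mult_distrib)
  have "integrable lborel (\<lambda>z::'a. exp (- (c * (norm z)\<^sup>2)))"
    using lborel_integrable_affine[of "\<lambda>z::'a. exp (- (norm z)\<^sup>2)" "sqrt c" 0] integrable_gaussian c
    unfolding eq by simp
  moreover have "gauss_mass TYPE('a) = sqrt c ^ DIM('a) * (LINT z|lborel. exp (- (c * (norm (z::'a))\<^sup>2)))"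
    using lborel_integral_affine[of "\<lambda>z::'a. exp (- (norm z)\<^sup>2)" "sqrt c" 0] c
    unfolding eq gauss_mass_def by simp
  moreover have "sqrt c ^ DIM('a) = c powr (DIM('a) / 2)"
    using c by (simp add: powr_half_sqrt[symmetric] powr_power)
  ultimately show ?thesis
    using c by (simp add: has_bochner_integral_iff powr_minus field_simps)
qed

lemma powr_minus_le_one: "1 \<le> x \<Longrightarrow> 0 \<le> p \<Longrightarrow> x powr (- p) \<le> (1::real)"
  using powr_mono[of "- p" 0 x] by simp

lemma gauss_smoothing_le:
  assumes "0 < t"
  shows "\<bar>1 - (1 + 4 * t) powr (- (real d / 2))\<bar> \<le> max 1 (2 * real d) * min 1 t"
proof -
  have le: "(1 + 4 * t) powr (- (real d / 2)) \<le> 1"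
    using assms by (intro powr_minus_le_one) auto
  have "1 + (- (real d / 2)) * ln (1 + 4 * t) \<le> exp ((- (real d / 2)) * ln (1 + 4 * t))"
    by (rule exp_ge_add_one_self)
  moreover have "real d / 2 * ln (1 + 4 * t) \<le> real d / 2 * (4 * t)"
    using ln_add_one_self_le_self[of "4 * t"] assms by (intro mult_left_mono) auto
  moreover have "(1 + 4 * t) powr (- (real d / 2)) = exp ((- (real d / 2)) * ln (1 + 4 * t))"
    using assms by (simp add: powr_def)
  ultimately have "1 - (1 + 4 * t) powr (- (real d / 2)) \<le> 2 * real d * t"
    by (simp only: mult_minus_left)
  also have "\<dots> \<le> max 1 (2 * real d) * t"
    using assms by (intro mult_right_mono) auto
  finally have "1 - (1 + 4 * t) powr (- (real d / 2)) \<le> max 1 (2 * real d) * t" .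
  moreover have "1 - (1 + 4 * t) powr (- (real d / 2)) \<le> max 1 (2 * real d)"
    by (smt (verit) powr_ge_zero max.cobounded1)
  ultimately show ?thesis using le by (simp add: min_def)
qed

text \<open>
  The weight \<open>1 - exp (-|z|\<^sup>2)\<close> is comparable to \<open>min 1 |z|\<^sup>2\<close> and its integral against the heat
  kernel is explicit. By Tonelli its integral against the jump kernel is therefore the integral
  of an explicit function against \<open>\<nu>\<close>, so that the Laplace argument can control it.
\<close>

lemma has_bochner_integral_jump_kernel_weight:
  assumes \<nu>: "levy_density \<nu>"
  shows "has_bochner_integral lborel
     (\<lambda>z::'a::euclidean_space. (1 - exp (- (norm z)\<^sup>2)) * jump_kernel DIM('a) \<nu> (norm z))
     (pi powr (- (DIM('a) / 2)) * gauss_mass TYPE('a) *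
        (LINT t|lborel. (1 - (1 + 4 * t) powr (- (DIM('a) / 2))) * \<nu> t))"
proof (rule has_bochner_integral_nn_integral)
  define d where "d = DIM('a)"
  have d: "0 < d" by (simp add: d_def)
  define G where "G = gauss_mass TYPE('a)"
  have G: "0 \<le> G" unfolding G_def gauss_mass_def by simp
  define h where "h z t = (1 - exp (- (norm (z::'a))\<^sup>2)) * ((4 * pi) powr (- (real d / 2)) *
      (t powr (- (real d / 2)) * exp (- ((norm z)\<^sup>2 / (4 * t))) * \<nu> t))" for z t
  have [measurable]: "\<nu> \<in> borel_measurable borel" by (rule levy_densityD(1)[OF \<nu>])
  note [measurable] = borel_measurable_jump_kernel[OF \<nu>]
  show "(\<lambda>z::'a. (1 - exp (- (norm z)\<^sup>2)) * jump_kernel DIM('a) \<nu> (norm z)) \<in> borel_measurable lborel"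
    by measurable
  have h_meas [measurable]: "case_prod h \<in> borel_measurable (borel \<Otimes>\<^sub>M borel)"
    unfolding h_def by measurable
  have h0: "0 \<le> h z t" for z t
    unfolding h_def using levy_densityD(2)[OF \<nu>] by (intro mult_nonneg_nonneg) auto
  have F0: "0 \<le> (1 - (1 + 4 * t) powr (- (real d / 2))) * \<nu> t" for t
  proof (cases "t \<le> 0")
    case False
    thus ?thesis using levy_densityD(2)[OF \<nu>, of t]
      by (intro mult_nonneg_nonneg) (auto intro!: powr_minus_le_one)
  qed (simp add: levy_densityD(3)[OF \<nu>])
  have F_int: "integrable lborel (\<lambda>t. (1 - (1 + 4 * t) powr (- (real d / 2))) * \<nu> t)"
    by (rule integrable_levy_density[OF \<nu> _ gauss_smoothing_le]) auto
  have J: "ennreal ((1 - exp (- (norm z)\<^sup>2)) * jump_kernel d \<nu> (norm z)) = (\<integral>\<^sup>+t. ennreal (h z t) \<partial>lborel)" for z :: 'a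
  proof (cases "z = 0")
    case False
    have "integrable lborel (h z)"
      unfolding h_def using integrable_jump_kernel[OF \<nu>, of "norm z" d] False d by simp
    hence "(\<integral>\<^sup>+t. ennreal (h z t) \<partial>lborel) = ennreal (LINT t|lborel. h z t)"
      using h0 by (intro nn_integral_eq_integral) auto
    also have "(LINT t|lborel. h z t) = (1 - exp (- (norm z)\<^sup>2)) * jump_kernel d \<nu> (norm z)"
      unfolding h_def jump_kernel_levy[OF \<nu>] by simp
    finally show ?thesis ..
  qed (simp add: h_def)
  have inner: "(\<integral>\<^sup>+z. ennreal (h z t) \<partial>lborel) =
      ennreal (pi powr (- (real d / 2)) * G * ((1 - (1 + 4 * t) powr (- (real d / 2))) * \<nu> t))" for t
  proof (cases "t \<le> 0")
    case True
    thus ?thesis by (simp add: h_def levy_densityD(3)[OF \<nu>])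
  next
    case False
    \<comment> \<open>The weight turns the heat kernel into a difference of two Gaussians.\<close>
    define A where "A = (4 * pi) powr (- (real d / 2)) * (t powr (- (real d / 2)) * \<nu> t)"
    have h_eq: "h z t = A * (exp (- ((1 / (4 * t)) * (norm z)\<^sup>2)) - exp (- ((1 + 1 / (4 * t)) * (norm z)\<^sup>2)))" for z
      by (simp add: h_def A_def algebra_simps exp_add[symmetric])
    have "has_bochner_integral lborel (\<lambda>z. h z t)
       (A * ((1 / (4 * t)) powr (- (real d / 2)) * G - (1 + 1 / (4 * t)) powr (- (real d / 2)) * G))"
      unfolding h_eq G_def d_def
      by (intro has_bochner_integral_mult_right has_bochner_integral_diff has_bochner_integral_gaussian)
         (use False in \<open>auto intro!: add_pos_pos\<close>)
    hence "(\<integral>\<^sup>+z. ennreal (h z t) \<partial>lborel) =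
       ennreal (A * ((1 / (4 * t)) powr (- (real d / 2)) * G - (1 + 1 / (4 * t)) powr (- (real d / 2)) * G))"
      using h0 by (subst nn_integral_eq_integral) (auto simp: has_bochner_integral_iff)
    also have "A * ((1 / (4 * t)) powr (- (real d / 2)) * G - (1 + 1 / (4 * t)) powr (- (real d / 2)) * G) =
       pi powr (- (real d / 2)) * G * ((1 - (1 + 4 * t) powr (- (real d / 2))) * \<nu> t)"
    proof -
      have e: "1 + 1 / (4 * t) = (1 + 4 * t) * (1 / (4 * t))" using False by (simp add: field_simps)
      have "(1 + 1 / (4 * t)) powr (- (real d / 2)) = (1 + 4 * t) powr (- (real d / 2)) * (1 / (4 * t)) powr (- (real d / 2))"
        unfolding e using False by (subst powr_mult) auto
      hence "A * ((1 / (4 * t)) powr (- (real d / 2)) * G - (1 + 1 / (4 * t)) powr (- (real d / 2)) * G) =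
         A * (1 / (4 * t)) powr (- (real d / 2)) * (G * (1 - (1 + 4 * t) powr (- (real d / 2))))"
        by (simp add: algebra_simps)
      also have "A * (1 / (4 * t)) powr (- (real d / 2)) = pi powr (- (real d / 2)) * \<nu> t"
        using False by (simp add: A_def powr_mult powr_divide powr_minus field_simps)
      finally show ?thesis by (simp add: mult_ac)
    qed
    finally show ?thesis .
  qed
  have "(\<integral>\<^sup>+z. ennreal ((1 - exp (- (norm (z::'a))\<^sup>2)) * jump_kernel d \<nu> (norm z)) \<partial>lborel) =
      (\<integral>\<^sup>+z. (\<integral>\<^sup>+t. ennreal (h z t) \<partial>lborel) \<partial>(lborel :: 'a measure))"
    by (simp add: J)
  also have "\<dots> = (\<integral>\<^sup>+t. (\<integral>\<^sup>+z. ennreal (h z t) \<partial>(lborel :: 'a measure)) \<partial>lborel)"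
    by (rule lborel_pair.Fubini'[symmetric]) measurable
  also have "\<dots> = (\<integral>\<^sup>+t. ennreal (pi powr (- (real d / 2)) * G) * ennreal ((1 - (1 + 4 * t) powr (- (real d / 2))) * \<nu> t) \<partial>lborel)"
    unfolding inner using G F0 by (simp add: ennreal_mult[symmetric])
  also have "\<dots> = ennreal (pi powr (- (real d / 2)) * G) * ennreal (LINT t|lborel. (1 - (1 + 4 * t) powr (- (real d / 2))) * \<nu> t)"
    using F0 F_int by (subst nn_integral_cmult) (auto simp: nn_integral_eq_integral)
  also have "\<dots> = ennreal (pi powr (- (real d / 2)) * G * (LINT t|lborel. (1 - (1 + 4 * t) powr (- (real d / 2))) * \<nu> t))"
    using G F0 by (subst ennreal_mult[symmetric]) auto
  finally show "(\<integral>\<^sup>+z. ennreal ((1 - exp (- (norm (z::'a))\<^sup>2)) * jump_kernel DIM('a) \<nu> (norm z)) \<partial>lborel) =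
     ennreal (pi powr (- (DIM('a) / 2)) * gauss_mass TYPE('a) *
        (LINT t|lborel. (1 - (1 + 4 * t) powr (- (DIM('a) / 2))) * \<nu> t))"
    by (simp add: d_def G_def)
  show "0 \<le> pi powr (- (DIM('a) / 2)) * gauss_mass TYPE('a) *
        (LINT t|lborel. (1 - (1 + 4 * t) powr (- (DIM('a) / 2))) * \<nu> t)"
    using G F0 Bochner_Integration.integral_nonneg[OF F0] unfolding G_def d_def
    by (intro mult_nonneg_nonneg) auto
  show "AE z in lborel. 0 \<le> (1 - exp (- (norm (z::'a))\<^sup>2)) * jump_kernel DIM('a) \<nu> (norm z)"
    using jump_kernel_nonneg[OF \<nu>] by (intro AE_I2 mult_nonneg_nonneg) auto
qed

lemma integrable_weight_jump_kernel:
  fixes w :: "'a::euclidean_space \<Rightarrow> real"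
  assumes \<nu>: "levy_density \<nu>" and [measurable]: "w \<in> borel_measurable borel"
    and w: "\<And>z. \<bar>w z\<bar> \<le> C * (1 - exp (- (norm z)\<^sup>2))"
  shows "integrable lborel (\<lambda>z. w z * jump_kernel DIM('a) \<nu> (norm z))"
proof (rule Bochner_Integration.integrable_bound)
  note [measurable] = borel_measurable_jump_kernel[OF \<nu>]
  show "integrable lborel (\<lambda>z::'a. C * ((1 - exp (- (norm z)\<^sup>2)) * jump_kernel DIM('a) \<nu> (norm z)))"
    using has_bochner_integral_jump_kernel_weight[OF \<nu>, where 'a='a] by (simp add: has_bochner_integral_iff)
  show "AE z in lborel. norm (w z * jump_kernel DIM('a) \<nu> (norm z)) \<le>
     norm (C * ((1 - exp (- (norm z)\<^sup>2)) * jump_kernel DIM('a) \<nu> (norm z)))"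
  proof (intro AE_I2)
    fix z :: 'a
    have "\<bar>w z\<bar> * jump_kernel DIM('a) \<nu> (norm z) \<le> C * (1 - exp (- (norm z)\<^sup>2)) * jump_kernel DIM('a) \<nu> (norm z)"
      using w[of z] jump_kernel_nonneg[OF \<nu>] by (intro mult_right_mono)
    also have "\<dots> \<le> \<bar>C\<bar> * (1 - exp (- (norm z)\<^sup>2)) * jump_kernel DIM('a) \<nu> (norm z)"
      using jump_kernel_nonneg[OF \<nu>] by (intro mult_right_mono) auto
    finally show "norm (w z * jump_kernel DIM('a) \<nu> (norm z)) \<le>
     norm (C * ((1 - exp (- (norm z)\<^sup>2)) * jump_kernel DIM('a) \<nu> (norm z)))"
      using jump_kernel_nonneg[OF \<nu>, of "DIM('a)" "norm z"] by (simp add: abs_mult mult.assoc)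
  qed
  show "(\<lambda>z. w z * jump_kernel DIM('a) \<nu> (norm z)) \<in> borel_measurable lborel"
    by measurable
qed

text \<open>
  Pointwise convergence of the kernels alone says nothing about mass lost at the origin or at
  infinity. The multiple \<open>C (1 - exp (-|z|\<^sup>2))\<close> of the explicit weight serves as a moving dominator
  whose integrals converge, which excludes both for every weight below it.
\<close>

lemma integral_weight_jump_kernel_tendsto:
  fixes \<nu> :: "real \<Rightarrow> real \<Rightarrow> real" and w :: "'a::euclidean_space \<Rightarrow> real"
  assumes \<nu>: "\<And>R. levy_density (\<nu> R)" "levy_density \<nu>'"
    and conv: "\<And>u. 0 < u \<Longrightarrow> ((\<lambda>R. bernstein_fun (\<nu> R) u) \<longlongrightarrow> bernstein_fun \<nu>' u) at_top"
    and [measurable]: "w \<in> borel_measurable borel"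
    and w: "\<And>z. \<bar>w z\<bar> \<le> C * (1 - exp (- (norm z)\<^sup>2))"
  shows "((\<lambda>R. LINT z|lborel. w z * jump_kernel DIM('a) (\<nu> R) (norm z)) \<longlongrightarrow>
     (LINT z|lborel. w z * jump_kernel DIM('a) \<nu>' (norm z))) at_top"
proof (rule tendsto_integral_varying_dominator)
  note [measurable] = borel_measurable_jump_kernel[OF \<nu>(1)] borel_measurable_jump_kernel[OF \<nu>(2)]
  let ?g = "\<lambda>v (z::'a). C * ((1 - exp (- (norm z)\<^sup>2)) * jump_kernel DIM('a) v (norm z))"
  show "(\<lambda>z. w z * jump_kernel DIM('a) (\<nu> R) (norm z)) \<in> borel_measurable lborel" for R by measurable
  show "(\<lambda>z. w z * jump_kernel DIM('a) \<nu>' (norm z)) \<in> borel_measurable lborel" by measurable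
  note hb = has_bochner_integral_jump_kernel_weight[where 'a='a, unfolded has_bochner_integral_iff]
  show "integrable lborel (?g (\<nu> R))" for R using hb[OF \<nu>(1)] by simp
  show "integrable lborel (?g \<nu>')" using hb[OF \<nu>(2)] by simp
  show "\<bar>w z * jump_kernel DIM('a) (\<nu> R) (norm z)\<bar> \<le> ?g (\<nu> R) z" for R z
    using mult_right_mono[OF w[of z] jump_kernel_nonneg[OF \<nu>(1), of "DIM('a)" R "norm z"]]
      jump_kernel_nonneg[OF \<nu>(1), of "DIM('a)" R "norm z"]
    by (simp add: abs_mult mult.assoc)
  have jk: "((\<lambda>R. k z * jump_kernel DIM('a) (\<nu> R) (norm z)) \<longlongrightarrow> k z * jump_kernel DIM('a) \<nu>' (norm z)) at_top"
    if "k 0 = 0" for z :: 'a and k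
    using that by (cases "z = 0") (auto intro!: tendsto_intros jump_kernel_tendsto[OF \<nu> conv])
  have "w 0 = 0" using w[of 0] by simp
  thus "((\<lambda>R. w z * jump_kernel DIM('a) (\<nu> R) (norm z)) \<longlongrightarrow> w z * jump_kernel DIM('a) \<nu>' (norm z)) at_top" for z
    by (rule jk)
  show "((\<lambda>R. ?g (\<nu> R) z) \<longlongrightarrow> ?g \<nu>' z) at_top" for z
    by (intro tendsto_mult_left jk) auto
  define d where "d = DIM('a)"
  have d: "0 < d" by (simp add: d_def)
  define g where "g t = (1 - (1 + 4 * t) powr (- (real d / 2))) / (1 - exp (- t))" for t :: real
  have eq: "(1 - exp (- t)) * g t * v t = (1 - (1 + 4 * t) powr (- (real d / 2))) * v t"
    if "levy_density v" for t v
    using levy_densityD(3)[OF that, of t] by (cases "t \<le> 0") (auto simp: g_def)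
  have "((\<lambda>R. LINT t|lborel. (1 - exp (- t)) * g t * \<nu> R t) \<longlongrightarrow>
           (LINT t|lborel. (1 - exp (- t)) * g t * \<nu>' t)) at_top"
  proof (rule levy_density_convergence[OF \<nu> conv])
    show "continuous_on {0<..} g"
      unfolding g_def by (intro continuous_intros) auto
    show "(g \<longlongrightarrow> 2 * real d) (at_right 0)"
      unfolding g_def using d by real_asymp
    show "(g \<longlongrightarrow> 1) at_top"
      unfolding g_def using d by real_asymp
  qed
  hence "((\<lambda>R. LINT t|lborel. (1 - (1 + 4 * t) powr (- (real d / 2))) * \<nu> R t) \<longlongrightarrow>
           (LINT t|lborel. (1 - (1 + 4 * t) powr (- (real d / 2))) * \<nu>' t)) at_top"
    unfolding eq[OF \<nu>(1)] eq[OF \<nu>(2)] .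
  hence "((\<lambda>R. C * (LINT z|lborel. (1 - exp (- (norm (z::'a))\<^sup>2)) * jump_kernel DIM('a) (\<nu> R) (norm z))) \<longlongrightarrow>
     C * (LINT z|lborel. (1 - exp (- (norm (z::'a))\<^sup>2)) * jump_kernel DIM('a) \<nu>' (norm z))) at_top"
    using hb[OF \<nu>(1)] hb[OF \<nu>(2)] by (simp add: d_def tendsto_intros)
  thus "((\<lambda>R. LINT z|lborel. ?g (\<nu> R) z) \<longlongrightarrow> (LINT z|lborel. ?g \<nu>' z)) at_top"
    by simp
qed

section \<open>The scaling limit of the jump kernel\<close>

definition stable_density :: "real \<Rightarrow> real \<Rightarrow> real" where
  "stable_density a t = (if 0 < t then t powr (- 1 - a) else 0)"

lemma integral_pos_if_ge_on_Icc:
  fixes k :: "real \<Rightarrow> real" and e :: real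
  assumes "integrable lborel k" "\<And>t. 0 \<le> k t" "0 < e" "\<And>t. t \<in> {1..2} \<Longrightarrow> e \<le> k t"
  shows "0 < (LINT t|lborel. k t)"
proof -
  have "e = (LINT t|lborel. indicator {1..2::real} t *\<^sub>R e)" by simp
  also have "\<dots> \<le> (LINT t|lborel. k t)"
  proof (rule integral_mono)
    show "integrable lborel (\<lambda>t. indicator {1..2::real} t *\<^sub>R e)"
      by (rule integrable_indicator) auto
    show "indicator {1..2} t *\<^sub>R e \<le> k t" for t
      using assms by (simp add: indicator_def)
  qed (use assms in auto)
  finally show ?thesis using assms by simp
qed

lemma levy_density_stable:
  assumes "0 < a" "a < 1"
  shows "levy_density (stable_density a)"
proof -
  have meas [measurable]: "stable_density a \<in> borel_measurable borel"
    unfolding stable_density_def by measurable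
  have "integrable lborel (\<lambda>t. min 1 t * stable_density a t)"
  proof (rule Bochner_Integration.integrable_bound)
    show "integrable lborel (\<lambda>z::real. indicator {0..<1} (norm z) * norm z powr ((1 - a) - DIM(real))
       + indicator {1..} (norm z) * norm z powr (- a - DIM(real)))"
      by (intro Bochner_Integration.integrable_add
          integral_norm_powr_ball[THEN integrable.intros] integral_norm_powr_outside[THEN integrable.intros])
         (use assms in auto)
    have "norm (min 1 t * stable_density a t) \<le> norm (indicator {0..<1} (norm t) * norm t powr ((1 - a) - DIM(real))
       + indicator {1..} (norm t) * norm t powr (- a - DIM(real)))" for t :: real
    proof -
      consider "t \<le> 0" | "0 < t" "t < 1" | "1 \<le> t" by linarith
      thus ?thesis
      proof cases
        case 2
        hence "t * t powr (- 1 - a) = t powr (- a)"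
          by (simp add: powr_mult_base)
        thus ?thesis using 2 by (simp add: stable_density_def)
      next
        case 3
        moreover have "t powr (- 1 - a) = t powr (- a - 1)" by (rule arg_cong) simp
        ultimately show ?thesis by (simp add: stable_density_def)
      qed (simp add: stable_density_def)
    qed
    thus "AE t in lborel. norm (min 1 t * stable_density a t) \<le> norm (indicator {0..<1} (norm t) * norm t powr ((1 - a) - DIM(real))
       + indicator {1..} (norm t) * norm t powr (- a - DIM(real)))"
      by (intro AE_I2)
  qed measurable
  thus ?thesis using meas by (auto simp: levy_density_def stable_density_def)
qed

text \<open>
  Homogeneity of the density under \<open>t \<mapsto> t/u\<close>.
\<close>

lemma bernstein_fun_stable:
  assumes "0 < u"
  shows "bernstein_fun (stable_density a) u = u powr a * bernstein_fun (stable_density a) 1"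
proof -
  have "bernstein_fun (stable_density a) u =
      (1 / u) * (LINT t|lborel. (1 - exp (- (u * (0 + 1 / u * t)))) * stable_density a (0 + 1 / u * t))"
    unfolding bernstein_fun_def
    by (subst lborel_integral_real_affine[where c="1 / u" and t=0]) (use assms in auto)
  also have "(\<lambda>t. (1 - exp (- (u * (0 + 1 / u * t)))) * stable_density a (0 + 1 / u * t)) =
      (\<lambda>t. u powr (1 + a) * ((1 - exp (- (1 * t))) * stable_density a t))"
  proof (rule ext)
    fix t :: real
    have "(t / u) powr (- 1 - a) = u powr (1 + a) * t powr (- 1 - a)" if "0 < t"
      using that assms powr_minus_divide[of u "1 + a"] by (simp add: powr_divide)
    thus "(1 - exp (- (u * (0 + 1 / u * t)))) * stable_density a (0 + 1 / u * t) =
        u powr (1 + a) * ((1 - exp (- (1 * t))) * stable_density a t)"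
      using assms by (simp add: stable_density_def zero_less_divide_iff)
  qed
  also have "1 / u * (LINT t|lborel. u powr (1 + a) * ((1 - exp (- (1 * t))) * stable_density a t)) =
      u powr a * bernstein_fun (stable_density a) 1"
    using assms by (simp add: bernstein_fun_def powr_add)
  finally show ?thesis .
qed

lemma bernstein_fun_stable_pos:
  assumes "0 < a" "a < 1"
  shows "0 < bernstein_fun (stable_density a) 1"
  unfolding bernstein_fun_def
proof (rule integral_pos_if_ge_on_Icc)
  show "integrable lborel (\<lambda>t. (1 - exp (- (1 * t))) * stable_density a t)"
    by (rule integrable_one_minus_exp_levy[OF levy_density_stable[OF assms]]) simp
  show "0 \<le> (1 - exp (- (1 * t))) * stable_density a t" for t
    by (simp add: stable_density_def)
  show "0 < (1 - exp (- 1)) * (2::real) powr (- 1 - a)" by simp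
  show "(1 - exp (- 1)) * 2 powr (- 1 - a) \<le> (1 - exp (- (1 * t))) * stable_density a t" if "t \<in> {1..2}" for t
    using that assms by (auto simp: stable_density_def intro!: mult_mono powr_mono2')
qed

lemma jump_kernel_stable:
  assumes a: "0 < a" "a < 1" and r: "0 < r"
  shows "jump_kernel d (stable_density a) r = jump_kernel d (stable_density a) 1 * r powr (- real d - 2 * a)"
proof -
  define f where "f r t = t powr (- (real d / 2)) * exp (- (r\<^sup>2 / (4 * t))) * stable_density a t" for r t :: real
  have r2: "r\<^sup>2 = r powr 2" using r by (simp add: powr_numeral)
  have "(LINT t|lborel. f r t) = r\<^sup>2 * (LINT t|lborel. f r (0 + r\<^sup>2 * t))"
    by (subst lborel_integral_real_affine[where c="r\<^sup>2" and t=0]) (use r in auto)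
  also have "(\<lambda>t. f r (0 + r\<^sup>2 * t)) = (\<lambda>t. r powr (- real d - 2 - 2 * a) * f 1 t)"
  proof (rule ext)
    fix t :: real
    show "f r (0 + r\<^sup>2 * t) = r powr (- real d - 2 - 2 * a) * f 1 t"
    proof (cases "0 < t")
      case True
      have "(r\<^sup>2 * t) powr p = r powr (2 * p) * t powr p" for p
        using True r by (simp add: r2 powr_mult powr_powr del: powr_numeral)
      moreover have "r powr (2 * (- (real d / 2))) * r powr (2 * (- 1 - a)) = r powr (- real d - 2 - 2 * a)"
        by (simp add: powr_add[symmetric] algebra_simps)
      ultimately show ?thesis using True r by (simp add: f_def stable_density_def)
    next
      case False
      hence "\<not> 0 < r\<^sup>2 * t" using r by (simp add: zero_less_mult_iff)
      thus ?thesis using False by (simp add: f_def stable_density_def)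
    qed
  qed
  also have "r\<^sup>2 * (LINT t|lborel. r powr (- real d - 2 - 2 * a) * f 1 t) = r powr (- real d - 2 * a) * (LINT t|lborel. f 1 t)"
    by (simp add: r2 powr_add[symmetric] del: powr_numeral)
  finally show ?thesis
    unfolding jump_kernel_levy[OF levy_density_stable[OF a]] f_def by (simp add: mult_ac)
qed

lemma jump_kernel_stable_pos:
  assumes a: "0 < a" "a < 1" and d: "0 < d"
  shows "0 < jump_kernel d (stable_density a) 1"
  unfolding jump_kernel_levy[OF levy_density_stable[OF a]]
proof (intro mult_pos_pos integral_pos_if_ge_on_Icc)
  show "integrable lborel (\<lambda>t. t powr (- (real d / 2)) * exp (- (1\<^sup>2 / (4 * t))) * stable_density a t)"
    using integrable_jump_kernel[OF levy_density_stable[OF a], of 1 d] d by simp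
  show "0 \<le> t powr (- (real d / 2)) * exp (- (1\<^sup>2 / (4 * t))) * stable_density a t" for t
    by (simp add: stable_density_def)
  show "0 < 2 powr (- (real d / 2)) * exp (- 1) * 2 powr (- 1 - a)" by simp
  show "2 powr (- (real d / 2)) * exp (- 1) * 2 powr (- 1 - a) \<le> t powr (- (real d / 2)) * exp (- (1\<^sup>2 / (4 * t))) * stable_density a t"
    if "t \<in> {1..2}" for t
    using that a by (auto simp: stable_density_def divide_simps intro!: mult_mono powr_mono2')
qed simp

text \<open>
  Complete monotonicity enters through nonnegativity and through continuity, which gives
  measurability.
\<close>

lemma levy_density_of_complete_bernstein:
  assumes "complete_bernstein \<Phi> \<mu>"
  defines "\<mu>0 \<equiv> \<lambda>t. if 0 < t then \<mu> t else 0"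
  shows "levy_density \<mu>0" "\<And>u. 0 < u \<Longrightarrow> \<Phi> u = bernstein_fun \<mu>0 u" "jump_kernel d \<mu> = jump_kernel d \<mu>0"
proof -
  have cm: "completely_monotone \<mu>" using assms by (simp add: complete_bernstein_def)
  have \<mu>0: "0 \<le> \<mu> t" "isCont \<mu> t" if "0 < t" for t
    using cm[unfolded completely_monotone_def, rule_format, of t 0] that
    by (auto intro: differentiable_imp_continuous_within)
  have "continuous_on {0<..} \<mu>"
    by (intro continuous_at_imp_continuous_on) (use \<mu>0 in auto)
  hence [measurable]: "\<mu>0 \<in> borel_measurable borel"
    unfolding \<mu>0_def using borel_measurable_continuous_on_if[of "{0<..}" \<mu> "\<lambda>_. 0"] by simp
  have ind: "indicator {0<..} t *\<^sub>R (k t * \<mu> t) = k t * \<mu>0 t" for k :: "real \<Rightarrow> real" and t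
    by (simp add: \<mu>0_def indicator_def)
  have "integrable lborel (\<lambda>t. min 1 t * \<mu>0 t)"
    using assms(1) by (simp only: complete_bernstein_def set_integrable_def ind)
  moreover have "0 \<le> \<mu>0 t" "t \<le> 0 \<Longrightarrow> \<mu>0 t = 0" for t
    using \<mu>0(1)[of t] by (auto simp: \<mu>0_def)
  ultimately show levy: "levy_density \<mu>0"
    by (auto simp: levy_density_def)
  show "\<Phi> u = bernstein_fun \<mu>0 u" if "0 < u" for u
  proof -
    have "\<Phi> u = (LINT t:{0<..}|lborel. (1 - exp (- (u * t))) * \<mu> t)"
      using assms(1) that by (simp add: complete_bernstein_def)
    also have "\<dots> = bernstein_fun \<mu>0 u"
      unfolding set_lebesgue_integral_def bernstein_fun_def
      by (rule Bochner_Integration.integral_cong[OF refl]) (rule ind)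
    finally show ?thesis .
  qed
  show "jump_kernel d \<mu> = jump_kernel d \<mu>0"
  proof (rule ext)
    fix r
    show "jump_kernel d \<mu> r = jump_kernel d \<mu>0 r"
      unfolding jump_kernel_levy[OF levy] unfolding jump_kernel_def set_lebesgue_integral_def
      by (intro arg_cong2[where f="(*)"] Bochner_Integration.integral_cong refl ind)
  qed
qed

lemma bernstein_fun_nonneg: "levy_density \<nu> \<Longrightarrow> 0 \<le> u \<Longrightarrow> 0 \<le> bernstein_fun \<nu> u"
  unfolding bernstein_fun_def
proof (rule Bochner_Integration.integral_nonneg)
  fix t :: real
  assume "levy_density \<nu>" "0 \<le> u"
  thus "0 \<le> (1 - exp (- (u * t))) * \<nu> t"
    using levy_densityD(2,3)[of \<nu> t] by (cases "t \<le> 0") auto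
qed

text \<open>
  Lengths are measured in units of \<open>R\<close>, hence times in units of \<open>R\<^sup>2\<close>; the normalisation makes the
  Bernstein function equal to \<open>1\<close> at \<open>1\<close>.
\<close>

definition rescaled_density :: "(real \<Rightarrow> real) \<Rightarrow> real \<Rightarrow> real \<Rightarrow> real" where
  "rescaled_density \<nu> R t = R\<^sup>2 * \<nu> (R\<^sup>2 * t) / bernstein_fun \<nu> (1 / R\<^sup>2)"

lemma levy_density_rescaled:
  assumes \<nu>: "levy_density \<nu>"
  shows "levy_density (rescaled_density \<nu> R)"
proof (cases "R = 0")
  case True
  thus ?thesis by (simp add: rescaled_density_def[abs_def] levy_density_def)
next
  case False
  have [measurable]: "\<nu> \<in> borel_measurable borel" by (rule levy_densityD(1)[OF \<nu>])
  have R2: "0 < R\<^sup>2" using False by simp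
  have "integrable lborel (\<lambda>s. min 1 (s / R\<^sup>2) * \<nu> s)"
  proof (rule integrable_levy_density[OF \<nu>])
    show "\<bar>min 1 (s / R\<^sup>2)\<bar> \<le> max 1 (1 / R\<^sup>2) * min 1 s" if "0 < s" for s
    proof -
      have "s / R\<^sup>2 \<le> max 1 (1 / R\<^sup>2) * s"
        using mult_right_mono[of "1 / R\<^sup>2" "max 1 (1 / R\<^sup>2)" s] that by simp
      thus ?thesis using R2 that by (auto simp: min_def intro: order_trans[of _ 1])
    qed
  qed measurable
  from lborel_integrable_real_affine[OF this, of "R\<^sup>2" 0]
  have "integrable lborel (\<lambda>t. min 1 t * \<nu> (R\<^sup>2 * t))"
    using False by simp
  hence "integrable lborel (\<lambda>t. R\<^sup>2 / bernstein_fun \<nu> (1 / R\<^sup>2) * (min 1 t * \<nu> (R\<^sup>2 * t)))"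
    by simp
  hence "integrable lborel (\<lambda>t. min 1 t * rescaled_density \<nu> R t)"
    by (simp add: rescaled_density_def mult_ac)
  moreover have "rescaled_density \<nu> R \<in> borel_measurable borel"
    unfolding rescaled_density_def[abs_def] by measurable
  moreover have "0 \<le> rescaled_density \<nu> R t" for t
    unfolding rescaled_density_def
    using levy_densityD(2)[OF \<nu>] bernstein_fun_nonneg[OF \<nu>] by simp
  moreover have "rescaled_density \<nu> R t = 0" if "t \<le> 0" for t
    using levy_densityD(3)[OF \<nu>, of "R\<^sup>2 * t"] that R2
    by (simp add: rescaled_density_def mult_le_0_iff)
  ultimately show ?thesis by (simp add: levy_density_def)
qed

lemma bernstein_fun_rescaled:
  assumes "R \<noteq> 0"
  shows "bernstein_fun (rescaled_density \<nu> R) u = bernstein_fun \<nu> (u / R\<^sup>2) / bernstein_fun \<nu> (1 / R\<^sup>2)"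
proof -
  have "bernstein_fun \<nu> (u / R\<^sup>2) =
      R\<^sup>2 * (LINT t|lborel. (1 - exp (- (u / R\<^sup>2 * (0 + R\<^sup>2 * t)))) * \<nu> (0 + R\<^sup>2 * t))"
    unfolding bernstein_fun_def
    by (subst lborel_integral_real_affine[where c="R\<^sup>2" and t=0]) (use assms in auto)
  hence "bernstein_fun \<nu> (u / R\<^sup>2) / bernstein_fun \<nu> (1 / R\<^sup>2) =
      (R\<^sup>2 / bernstein_fun \<nu> (1 / R\<^sup>2)) * (LINT t|lborel. (1 - exp (- (u * t))) * \<nu> (R\<^sup>2 * t))"
    using assms by simp
  also have "\<dots> = (LINT t|lborel. (R\<^sup>2 / bernstein_fun \<nu> (1 / R\<^sup>2)) * ((1 - exp (- (u * t))) * \<nu> (R\<^sup>2 * t)))"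
    by (rule integral_mult_right_zero[symmetric])
  also have "\<dots> = bernstein_fun (rescaled_density \<nu> R) u"
    unfolding bernstein_fun_def[of "rescaled_density \<nu> R"] rescaled_density_def
    by (intro Bochner_Integration.integral_cong) auto
  finally show ?thesis ..
qed

lemma jump_kernel_rescaled:
  assumes \<nu>: "levy_density \<nu>" and R: "0 < R" and nz: "bernstein_fun \<nu> (1 / R\<^sup>2) \<noteq> 0"
  shows "jump_kernel d \<nu> (R * r) = R powr (- real d) * bernstein_fun \<nu> (1 / R\<^sup>2) * jump_kernel d (rescaled_density \<nu> R) r"
proof -
  define B where "B = bernstein_fun \<nu> (1 / R\<^sup>2)"
  define f where "f r v t = t powr (- (real d / 2)) * exp (- (r\<^sup>2 / (4 * t))) * v t" for r t :: real and v :: "real \<Rightarrow> real"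
  have "(LINT t|lborel. f (R * r) \<nu> t) = R\<^sup>2 * (LINT t|lborel. f (R * r) \<nu> (0 + R\<^sup>2 * t))"
    by (subst lborel_integral_real_affine[where c="R\<^sup>2" and t=0]) (use R in auto)
  also have "(\<lambda>t. f (R * r) \<nu> (0 + R\<^sup>2 * t)) = (\<lambda>t. R powr (- real d) * B / R\<^sup>2 * f r (rescaled_density \<nu> R) t)"
  proof (rule ext)
    fix t :: real
    show "f (R * r) \<nu> (0 + R\<^sup>2 * t) = R powr (- real d) * B / R\<^sup>2 * f r (rescaled_density \<nu> R) t"
    proof (cases "0 < t")
      case True
      have "(R\<^sup>2 * t) powr (- (real d / 2)) = R powr (- real d) * t powr (- (real d / 2))"
        using True R by (simp add: powr_mult powr_powr powr_numeral[symmetric] del: powr_numeral)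
      thus ?thesis using True R nz by (simp add: f_def rescaled_density_def B_def power_mult_distrib)
    next
      case False
      hence "R\<^sup>2 * t \<le> 0" by (simp add: mult_nonneg_nonpos)
      thus ?thesis using levy_densityD(3)[OF \<nu>] by (simp add: f_def rescaled_density_def)
    qed
  qed
  also have "R\<^sup>2 * (LINT t|lborel. R powr (- real d) * B / R\<^sup>2 * f r (rescaled_density \<nu> R) t) =
     R powr (- real d) * B * (LINT t|lborel. f r (rescaled_density \<nu> R) t)"
    using R by simp
  finally show ?thesis
    unfolding jump_kernel_levy[OF \<nu>] jump_kernel_levy[OF levy_density_rescaled[OF \<nu>]] f_def B_def by (simp add: mult_ac)
qed

text \<open>
  The Bernstein function of the rescaled density is \<open>\<Phi>(u/R\<^sup>2) / \<Phi>(1/R\<^sup>2)\<close>, and regular variation of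
  \<open>\<Phi>\<close> at zero is the statement that this tends to a power of \<open>u\<close>.
\<close>

lemma bernstein_fun_rescaled_tendsto:
  assumes \<alpha>: "0 < \<alpha>" and slow: "slowly_varying_at_zero l"
    and asymp: "\<Phi> \<sim>[at_right 0] (\<lambda>u. u powr (\<alpha> / 2) * l u)"
    and \<Phi>: "\<And>u. 0 < u \<Longrightarrow> \<Phi> u = bernstein_fun \<nu> u"
  shows "0 < u \<Longrightarrow> ((\<lambda>R. bernstein_fun (rescaled_density \<nu> R) u) \<longlongrightarrow> u powr (\<alpha> / 2)) at_top"
    and "\<forall>\<^sub>F R in at_top. bernstein_fun \<nu> (1 / R\<^sup>2) \<noteq> 0"
proof -
  define g where "g u = u powr (\<alpha> / 2) * l u" for u
  have lpos: "0 < l s" if "0 < s" for s using slow that by (simp add: slowly_varying_at_zero_def)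
  have comp: "(\<lambda>R. bernstein_fun \<nu> (v / R\<^sup>2)) \<sim>[at_top] (\<lambda>R. g (v / R\<^sup>2))" if v: "0 < v" for v
  proof -
    have "filterlim (\<lambda>R::real. v / R\<^sup>2) (at_right 0) at_top" using v by real_asymp
    hence "(\<lambda>R. \<Phi> (v / R\<^sup>2)) \<sim>[at_top] (\<lambda>R. g (v / R\<^sup>2))"
      using asymp_equiv_compose'[OF asymp] by (simp add: g_def)
    moreover have ev: "\<forall>\<^sub>F R in at_top. \<Phi> (v / R\<^sup>2) = bernstein_fun \<nu> (v / R\<^sup>2)"
      using eventually_gt_at_top[of 0] by eventually_elim (use v in \<open>simp add: \<Phi>\<close>)
    ultimately show ?thesis
      using asymp_equiv_cong[OF ev always_eventually[OF allI[OF refl]], of "\<lambda>R. g (v / R\<^sup>2)"] by simp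
  qed
  have g_nz: "g s \<noteq> 0" if "0 < s" for s using lpos[OF that] that by (simp add: g_def)
  show "\<forall>\<^sub>F R in at_top. bernstein_fun \<nu> (1 / R\<^sup>2) \<noteq> 0"
    using asymp_equiv_eventually_zeros[OF comp[OF zero_less_one]] eventually_gt_at_top[of 0]
  proof eventually_elim
    case (elim R)
    thus ?case using g_nz[of "1 / R\<^sup>2"] by simp
  qed
  show "((\<lambda>R. bernstein_fun (rescaled_density \<nu> R) u) \<longlongrightarrow> u powr (\<alpha> / 2)) at_top" if u: "0 < u"
  proof -
    have "((\<lambda>t. l (1 / (1 / u * t)) / l (1 / t)) \<longlongrightarrow> 1) at_top"
      using slow[unfolded slowly_varying_at_zero_def] zero_less_divide_1_iff[THEN iffD2, OF u] by blast
    hence "((\<lambda>R. l (1 / (1 / u * R\<^sup>2)) / l (1 / R\<^sup>2)) \<longlongrightarrow> 1) at_top"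
      by (rule filterlim_compose) real_asymp
    hence "((\<lambda>R. u powr (\<alpha> / 2) * (l (u / R\<^sup>2) / l (1 / R\<^sup>2))) \<longlongrightarrow> u powr (\<alpha> / 2) * 1) at_top"
      by (intro tendsto_intros) simp
    moreover have "\<forall>\<^sub>F R in at_top. u powr (\<alpha> / 2) * (l (u / R\<^sup>2) / l (1 / R\<^sup>2)) = g (u / R\<^sup>2) / g (1 / R\<^sup>2)"
      using eventually_gt_at_top[of 0]
    proof eventually_elim
      case (elim R)
      have "(u / R\<^sup>2) powr (\<alpha> / 2) / (1 / R\<^sup>2) powr (\<alpha> / 2) = u powr (\<alpha> / 2)"
        using elim u by (simp add: powr_divide)
      thus ?case by (simp add: g_def flip: times_divide_times_eq)
    qed
    ultimately have "((\<lambda>R. g (u / R\<^sup>2) / g (1 / R\<^sup>2)) \<longlongrightarrow> u powr (\<alpha> / 2)) at_top"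
      using Lim_transform_eventually by fastforce
    hence "((\<lambda>R. bernstein_fun \<nu> (u / R\<^sup>2) / bernstein_fun \<nu> (1 / R\<^sup>2)) \<longlongrightarrow> u powr (\<alpha> / 2)) at_top"
      using asymp_equiv_tendsto_transfer[OF
          asymp_equiv_sym[THEN iffD1, OF asymp_equiv_divide[OF comp[OF u] comp[OF zero_less_one]]]] by blast
    moreover have "\<forall>\<^sub>F R in at_top. bernstein_fun \<nu> (u / R\<^sup>2) / bernstein_fun \<nu> (1 / R\<^sup>2) = bernstein_fun (rescaled_density \<nu> R) u"
      using eventually_gt_at_top[of 0] by eventually_elim (simp add: bernstein_fun_rescaled)
    ultimately show ?thesis
      using Lim_transform_eventually by fastforce
  qed
qed


text \<open>
  The regular variation of the jump kernel in the form used below: \<open>q R\<close> is the kernel seen at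
  scale \<open>R\<close>, up to the factor \<open>N R\<close>, and it converges to a multiple of the isotropic stable kernel
  both pointwise and when integrated against weights that are \<open>O(min 1 |z|\<^sup>2)\<close>.
\<close>

lemma jump_kernel_scaling_limit:
  assumes bernstein: "complete_bernstein \<Phi> \<mu>"
    and \<alpha>: "0 < \<alpha>" "\<alpha> < 2" and slow: "slowly_varying_at_zero l"
    and asymp: "\<Phi> \<sim>[at_right 0] (\<lambda>u. u powr (\<alpha> / 2) * l u)"
  obtains q :: "real \<Rightarrow> real \<Rightarrow> real" and N :: "real \<Rightarrow> real" and A :: real where
    "0 < A" "\<And>R. q R \<in> borel_measurable borel" "\<And>R r. 0 \<le> q R r"
    "\<And>R r s. 0 < r \<Longrightarrow> r \<le> s \<Longrightarrow> q R s \<le> q R r"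
    "\<forall>\<^sub>F R in at_top. 0 < N R \<and> (\<forall>r. jump_kernel DIM('a::euclidean_space) \<mu> (R * r) = N R * q R r)"
    "\<And>r. 0 < r \<Longrightarrow> ((\<lambda>R. q R r) \<longlongrightarrow> A * r powr (- real DIM('a) - \<alpha>)) at_top"
    "\<And>(w::'a \<Rightarrow> real) C R. w \<in> borel_measurable borel \<Longrightarrow>
        (\<And>z. \<bar>w z\<bar> \<le> C * (1 - exp (- (norm z)\<^sup>2))) \<Longrightarrow> integrable lborel (\<lambda>z. w z * q R (norm z))"
    "\<And>(w::'a \<Rightarrow> real) C. w \<in> borel_measurable borel \<Longrightarrow>
        (\<And>z. \<bar>w z\<bar> \<le> C * (1 - exp (- (norm z)\<^sup>2))) \<Longrightarrow>
        ((\<lambda>R. LINT z|lborel. w z * q R (norm z)) \<longlongrightarrow>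
           A * (LINT z|lborel. w z * norm z powr (- real DIM('a) - \<alpha>))) at_top"
proof -
  define \<nu> where "\<nu> = (\<lambda>t. if 0 < t then \<mu> t else 0)"
  note \<nu> = levy_density_of_complete_bernstein[OF bernstein, folded \<nu>_def]
  have a: "0 < \<alpha> / 2" "\<alpha> / 2 < 1" using \<alpha> by auto
  define c where "c = bernstein_fun (stable_density (\<alpha> / 2)) 1"
  have c: "0 < c" unfolding c_def by (rule bernstein_fun_stable_pos[OF a])
  define \<nu>' where "\<nu>' t = stable_density (\<alpha> / 2) t / c" for t
  have \<nu>': "levy_density \<nu>'"
    using levy_density_stable[OF a] c
    by (auto simp: levy_density_def \<nu>'_def[abs_def] mult.commute)
  have bern': "bernstein_fun \<nu>' u = u powr (\<alpha> / 2)" if "0 < u" for u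
  proof -
    have "bernstein_fun \<nu>' u = bernstein_fun (stable_density (\<alpha> / 2)) u / c"
      by (simp add: bernstein_fun_def \<nu>'_def)
    thus ?thesis using bernstein_fun_stable[OF that, of "\<alpha> / 2"] c by (simp add: c_def)
  qed
  define d where "d = DIM('a)"
  have d: "0 < d" by (simp add: d_def)
  define A where "A = jump_kernel d (stable_density (\<alpha> / 2)) 1 / c"
  have jump': "jump_kernel d \<nu>' r = A * r powr (- real d - \<alpha>)" if "0 < r" for r
  proof -
    have "jump_kernel d \<nu>' r = jump_kernel d (stable_density (\<alpha> / 2)) r / c"
      unfolding jump_kernel_levy[OF \<nu>'] jump_kernel_levy[OF levy_density_stable[OF a]]
      by (simp add: \<nu>'_def)
    thus ?thesis using jump_kernel_stable[OF a that, of d] by (simp add: A_def)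
  qed
  define q where "q R = jump_kernel d (rescaled_density \<nu> R)" for R
  define N where "N R = R powr (- real d) * bernstein_fun \<nu> (1 / R\<^sup>2)" for R
  note lev = levy_density_rescaled[OF \<nu>(1)]
  note lim = bernstein_fun_rescaled_tendsto[OF \<alpha>(1) slow asymp \<nu>(2)]
  have conv: "((\<lambda>R. bernstein_fun (rescaled_density \<nu> R) u) \<longlongrightarrow> bernstein_fun \<nu>' u) at_top" if "0 < u" for u
    using lim(1)[OF _ that] bern'[OF that] by simp
  show thesis
  proof (rule that[of A q N])
    show "0 < A" unfolding A_def using jump_kernel_stable_pos[OF a d] c by simp
    show "q R \<in> borel_measurable borel" for R
      unfolding q_def by (rule borel_measurable_jump_kernel[OF lev])
    show "0 \<le> q R r" for R r
      unfolding q_def by (rule jump_kernel_nonneg[OF lev])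
    show "q R s \<le> q R r" if "0 < r" "r \<le> s" for R r s
      unfolding q_def by (rule jump_kernel_antimono[OF lev d that])
    have "\<forall>\<^sub>F R in at_top. bernstein_fun \<nu> (1 / R\<^sup>2) \<noteq> 0"
      by (rule lim(2))
    thus "\<forall>\<^sub>F R in at_top. 0 < N R \<and> (\<forall>r. jump_kernel DIM('a) \<mu> (R * r) = N R * q R r)"
      using eventually_gt_at_top[of 0]
    proof eventually_elim
      case (elim R)
      have "0 \<le> bernstein_fun \<nu> (1 / R\<^sup>2)" by (rule bernstein_fun_nonneg[OF \<nu>(1)]) simp
      hence "0 < N R" using elim by (simp add: N_def less_le)
      thus ?case
        using jump_kernel_rescaled[OF \<nu>(1) elim(2,1), of d] \<nu>(3)[of d] by (simp add: N_def q_def d_def)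
    qed
    show "((\<lambda>R. q R r) \<longlongrightarrow> A * r powr (- real DIM('a) - \<alpha>)) at_top" if r: "0 < r" for r
      using jump_kernel_tendsto[OF lev \<nu>' conv, of r d] jump'[OF r] r d
      unfolding q_def d_def by simp
    fix w :: "'a \<Rightarrow> real" and C :: real
    assume w: "w \<in> borel_measurable borel" "\<And>z. \<bar>w z\<bar> \<le> C * (1 - exp (- (norm z)\<^sup>2))"
    show "integrable lborel (\<lambda>z. w z * q R (norm z))" for R
      unfolding q_def d_def by (rule integrable_weight_jump_kernel[OF lev w])
    have "(LINT z|lborel. w z * jump_kernel DIM('a) \<nu>' (norm z)) =
        (LINT z|lborel. A * (w z * norm z powr (- real DIM('a) - \<alpha>)))"
    proof (rule Bochner_Integration.integral_cong[OF refl])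
      fix z :: 'a
      show "w z * jump_kernel DIM('a) \<nu>' (norm z) = A * (w z * norm z powr (- real DIM('a) - \<alpha>))"
        using jump'[of "norm z"] w(2)[of 0] by (cases "z = 0") (auto simp: d_def)
    qed
    thus "((\<lambda>R. LINT z|lborel. w z * q R (norm z)) \<longlongrightarrow>
           A * (LINT z|lborel. w z * norm z powr (- real DIM('a) - \<alpha>))) at_top"
      using integral_weight_jump_kernel_tendsto[OF lev \<nu>' conv w] unfolding q_def d_def by simp
  qed
qed

section \<open>Elementary estimates for \<open>H_plus\<close>\<close>

lemma powr_le_affine:
  fixes y p :: real
  assumes "0 < y" "0 \<le> p" "p \<le> 1"
  shows "y powr p \<le> p * y + (1 - p)"
  using Youngs_inequality_0[of p "1 - p" y 1] assms by simp

text \<open>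
  The minimum of \<open>b\<^sup>x/x\<close> is \<open>exp 1 * ln b\<close>, so the claim amounts to \<open>1 \<le> exp 1 * ln (3/2)\<close>; the proof
  uses \<open>3/8 \<le> ln (3/2)\<close> and \<open>8/3 \<le> exp 1\<close>.
\<close>

lemma le_three_halves_powr:
  fixes x :: real
  assumes "0 \<le> x"
  shows "x \<le> (3 / 2) powr x"
proof -
  have "exp (- (3/32)) \<ge> (29/32::real)"
    using exp_ge_add_one_self[of "- (3/32) :: real"] by simp
  hence "(29/32::real) ^ 4 \<le> exp (- (3/32)) ^ 4" by (intro power_mono) auto
  also have "\<dots> = exp (- (3/8))" by (simp add: exp_of_nat_mult[symmetric])
  finally have "exp (3/8) \<le> (3/2::real)"
    by (simp add: exp_minus power_divide field_simps)
  hence ln32: "3 / 8 \<le> ln (3/2::real)" by (subst ln_ge_iff) auto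
  have "(1 + 1/4 + (1/4)\<^sup>2 / 2) ^ 4 \<le> exp (1/4::real) ^ 4"
    by (intro power_mono exp_lower_Taylor_quadratic) auto
  also have "\<dots> = exp 1" by (simp add: exp_of_nat_mult[symmetric])
  finally have e: "8 / 3 \<le> exp (1::real)" by (simp add: power2_eq_square power_divide)
  have "x = 8 / 3 * (3 / 8 * x)" by simp
  also have "\<dots> \<le> exp 1 * exp (3 / 8 * x - 1)"
    using e assms exp_ge_add_one_self[of "3 / 8 * x - 1"] by (intro mult_mono) auto
  also have "\<dots> = exp (3 / 8 * x)" by (simp add: exp_add[symmetric])
  also have "\<dots> \<le> exp (x * ln (3/2))"
    using ln32 mult_right_mono[OF ln32 assms] by (simp add: mult.commute)
  finally show ?thesis by (simp add: powr_def)
qed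

text \<open>
  The constant \<open>(u/(u+1))\<^sup>u\<close> decreases from \<open>1\<close> to \<open>1/exp 1\<close>. Weighted means of two numbers give
  \<open>2 \<le> (1 + 1/u)\<^sup>u\<close> for \<open>u \<ge> 1\<close>, and the upper bound \<open>1/(u+1)\<close> for \<open>u \<le> 1\<close>.
\<close>

lemma ratio_powr_le:
  fixes u :: real
  assumes u: "0 < u"
  shows "1 \<le> u \<Longrightarrow> (u / (u + 1)) powr u \<le> 1 / 2"
    and "(u / (u + 1)) powr u \<le> 1"
    and "u * (u / (u + 1)) powr u \<le> max (u / 2) (1 / 2)"
proof -
  show half: "(u / (u + 1)) powr u \<le> 1 / 2" if "1 \<le> u"
  proof -
    have "2 powr (1 / u) \<le> (u + 1) / u"
    proof -
      have "1 / u * 2 + (1 - 1 / u) = (u + 1) / u" using u by (simp add: field_simps)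
      thus ?thesis using powr_le_affine[of 2 "1 / u"] that by simp
    qed
    hence "(2 powr (1 / u)) powr u \<le> ((u + 1) / u) powr u"
      using u by (intro powr_mono2) auto
    hence "2 \<le> ((u + 1) / u) powr u" using u by (simp add: powr_powr)
    moreover have "(u / (u + 1)) powr u = 1 / ((u + 1) / u) powr u"
      using u by (simp add: powr_divide)
    ultimately show ?thesis by (simp only:) (intro frac_le, auto)
  qed
  show "(u / (u + 1)) powr u \<le> 1"
    using u by (intro powr_le1) auto
  show "u * (u / (u + 1)) powr u \<le> max (u / 2) (1 / 2)"
  proof (cases "1 \<le> u")
    case True
    thus ?thesis using half mult_left_mono[OF half, of u] u by simp
  next
    case False
    have "(u / (u + 1)) powr u \<le> u * (u / (u + 1)) + (1 - u)"
      using powr_le_affine[of "u / (u + 1)" u] u False by simp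
    also have "\<dots> = 1 / (u + 1)" using u by (simp add: field_simps)
    finally have "u * (u / (u + 1)) powr u \<le> u * (1 / (u + 1))"
      using u by (intro mult_left_mono) auto
    also have "\<dots> \<le> 1 / 2" using u False by (simp add: field_simps)
    finally show ?thesis by simp
  qed
qed

text \<open>
  The five terms have separate origins. Relative to \<open>\<phi>(x)\<close> and to the kernel at scale \<open>|x|\<close>, and for
  the \<open>x\<close>-centred variable \<open>h = |x| z\<close>, they are: the mass of \<open>\<phi>\<close> in the ball of radius \<open>(1-t)|x|\<close> around
  the origin; a lower bound for the mass of \<open>\<phi>\<close> elsewhere; the subtraction of \<open>\<phi>(x)\<close> over that ball;
  the subtraction of \<open>\<phi>(x)\<close> over \<open>|z| \<ge> t\<close>; and the second differences over \<open>|z| < t\<close>.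
\<close>

lemma H_plus_eq:
  assumes d: "0 < d" and \<alpha>: "0 < \<alpha>" "\<alpha> < 2" and \<kappa>: "0 < \<kappa>" "2 * \<kappa> < real d" and t: "0 < t" "t < 1"
  shows "H_plus d \<alpha> \<kappa> t =
     (1 - t) powr (d - 2 * \<kappa>) / ((2 - t) powr (d + \<alpha>) * (d - 2 * \<kappa>))
     + ((2 * \<kappa> + \<alpha>) / (2 * \<kappa> + \<alpha> + 1)) powr (2 * \<kappa> + \<alpha>) * (1 + t) powr (- (2 * \<kappa> + \<alpha>))
     - (1 - t) ^ d / (d * t powr (d + \<alpha>))
     - t powr (- \<alpha>) / \<alpha>
     - 2 * \<kappa> * (2 * \<kappa> + 1) * (real d)\<^sup>2 * t powr (2 - \<alpha>) / ((2 - \<alpha>) * (1 - t) powr (2 * \<kappa> + 2))"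
proof -
  define u where "u = 2 * \<kappa> + \<alpha>"
  define D where "D = real d - 2 * \<kappa>"
  define P Q T W where "P = (1 - t) powr D" and "Q = (2 - t) powr (d + \<alpha>)" and "T = t powr (d + \<alpha>)"
    and "W = (1 - t) powr (2 * \<kappa> + 2)"
  define E U where "E = (1 + t) powr u" and "U = (u + 1) powr u"
  have u: "0 < u" using \<alpha> \<kappa> by (simp add: u_def)
  have pos: "0 < P" "0 < Q" "0 < T" "0 < W" "0 < E" "0 < U" "0 < D" "0 < real d"
    using t \<kappa> d u by (auto simp: P_def Q_def T_def W_def E_def U_def D_def)
  have W2: "(1 - t) powr (d + 2 * \<kappa> + 2) = (1 - t) ^ d * W"
    using t by (simp add: W_def powr_add powr_realpow add.assoc)
  have T1: "t ^ d = T * t powr (- \<alpha>)"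
    using t by (simp add: T_def powr_add[symmetric] powr_realpow[symmetric])
  have T2: "t ^ (d + 2) = T * t powr (2 - \<alpha>)"
  proof -
    have "t ^ (d + 2) = t powr real (d + 2)" using t by (simp only: powr_realpow)
    thus ?thesis by (simp add: T_def powr_add[symmetric] add.commute)
  qed
  have "H_plus d \<alpha> \<kappa> t = (P * E * U + u powr u * Q * D) / (Q * E * D * U)
    - (\<alpha> * ((1 - t) ^ d * W) * (2 - \<alpha>) + d * (T * t powr (- \<alpha>)) * (2 - \<alpha>) * W
        + 2*\<kappa> * (2*\<kappa> + 1) * d ^ 3 * \<alpha> * (T * t powr (2 - \<alpha>))) / (d * \<alpha> * (2 - \<alpha>) * T * W)"
    unfolding H_plus_def W2 T1 T2 P_def Q_def T_def W_def E_def U_def D_def u_def by simp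
  also have "(P * E * U + u powr u * Q * D) / (Q * E * D * U) = P / (Q * D) + u powr u / U * (1 / E)"
    using pos by (simp add: field_simps)
  also have "(\<alpha> * ((1 - t) ^ d * W) * (2 - \<alpha>) + d * (T * t powr (- \<alpha>)) * (2 - \<alpha>) * W
        + 2*\<kappa> * (2*\<kappa> + 1) * d ^ 3 * \<alpha> * (T * t powr (2 - \<alpha>))) / (d * \<alpha> * (2 - \<alpha>) * T * W)
      = (1 - t) ^ d / (d * T) + t powr (- \<alpha>) / \<alpha> + 2*\<kappa> * (2*\<kappa> + 1) * (real d)\<^sup>2 * t powr (2 - \<alpha>) / ((2 - \<alpha>) * W)"
  proof -
    have "2 - \<alpha> \<noteq> 0" using \<alpha> by simp
    thus ?thesis using pos \<alpha> by (simp add: add_divide_distrib power3_eq_cube power2_eq_square)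
  qed
  also have "u powr u / U = (u / (u + 1)) powr u"
    using u by (simp add: U_def powr_divide)
  also have "1 / E = (1 + t) powr (- u)"
    by (simp add: E_def powr_minus divide_inverse)
  finally show ?thesis
    by (simp add: P_def Q_def D_def T_def W_def u_def)
qed

text \<open>
  The second and third terms of \<open>H_plus\<close> combined are at most the contribution that can be
  guaranteed to the integral from outside the ball. On the right, \<open>0\<close> comes from dropping this
  part, which is nonnegative, and the other entry from reflecting \<open>z\<close> to \<open>-z\<close>. For \<open>t \<le> 1/2\<close> the
  subtracted term \<open>S\<close> alone exceeds the second term: \<open>((1-t)/t) (1+t) \<ge> 3/2\<close> and Bernoulli's
  inequality beat the factor \<open>d\<close>. For \<open>t \<ge> 1/2\<close> the second term lies below the reflected one; after
  multiplication by \<open>u (1+t)\<^sup>u\<close> this follows from \<open>(3/2)\<^sup>x \<ge> x\<close> and lemma \<open>ratio_powr_le\<close>, since \<open>1+t\<close>, \<open>(1+t)/t\<close> and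
  \<open>(1+t)\<^sup>2/(1+t\<^sup>2)\<close> are all at least \<open>3/2\<close>.
\<close>

lemma far_term_le:
  fixes \<alpha> \<kappa> t :: real and d :: nat
  assumes d: "0 < d" and \<alpha>: "0 < \<alpha>" and \<kappa>: "real d - 1 < 2 * \<kappa>" "0 < \<kappa>" and t: "0 < t" "t < 1"
  defines "u \<equiv> 2 * \<kappa> + \<alpha>"
  defines "S \<equiv> (1 - t) ^ d / (d * t powr (d + \<alpha>))"
  shows "(u / (u + 1)) powr u * (1 + t) powr (- u) - S
     \<le> max 0 (min (1 / 2) ((1 + t\<^sup>2) powr (- \<kappa>)) * t powr (- \<alpha>) / u - S)"
proof -
  have u: "0 < u" using \<alpha> \<kappa> by (simp add: u_def)
  define c where "c = (u / (u + 1)) powr u"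
  have c0: "0 \<le> c" by (simp add: c_def)
  show ?thesis
  proof (cases "t \<le> 1 / 2")
    case True
    have "c * real d \<le> (real d + 1) / 2"
    proof (cases "d = 1")
      case True
      thus ?thesis using ratio_powr_le(2)[OF u] by (simp add: c_def)
    next
      case False
      hence "2 \<le> real d" using d by simp
      hence "1 \<le> u" using \<kappa> \<alpha> by (simp add: u_def)
      hence "c \<le> 1 / 2" using ratio_powr_le(1)[OF u] by (simp add: c_def)
      hence "c * real d \<le> 1 / 2 * real d" by (intro mult_right_mono) auto
      thus ?thesis by simp
    qed
    also have "(real d + 1) / 2 = 1 + real (d - 1) * (1 / 2)"
      using d by (simp add: of_nat_diff field_simps)
    also have "\<dots> \<le> (1 + 1 / 2) ^ (d - 1)"
      by (rule Bernoulli_inequality) simp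
    also have "\<dots> \<le> ((1 - t) / t * (1 + t)) ^ (d - 1)"
    proof (intro power_mono)
      have "t * 3 + t * t * 2 \<le> 2"
        using True t mult_mono[of t "1/2" t "1/2"] by simp
      thus "1 + 1 / 2 \<le> (1 - t) / t * (1 + t)" using t by (simp add: field_simps)
    qed simp
    also have "\<dots> = 1 * ((1 - t) / t) ^ (d - 1) * (1 + t) ^ (d - 1)"
      by (simp only: power_mult_distrib mult_1)
    also have "\<dots> \<le> ((1 - t) / t) * ((1 - t) / t) ^ (d - 1) * (1 + t) ^ (d - 1)"
      using True t by (intro mult_right_mono) (auto simp: field_simps)
    also have "\<dots> = ((1 - t) / t) ^ d * (1 + t) ^ (d - 1)"
      using d by (simp add: power_eq_if)
    finally have main: "c * real d \<le> ((1 - t) / t) ^ d * (1 + t) ^ (d - 1)" .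
    have "real (d - 1) \<le> u" using \<kappa> \<alpha> d by (simp add: u_def of_nat_diff)
    hence "(1 + t) powr real (d - 1) \<le> (1 + t) powr u"
      using t by (intro powr_mono) auto
    hence "(1 + t) ^ (d - 1) \<le> (1 + t) powr u"
      using t by (simp add: powr_realpow)
    hence "c * real d \<le> ((1 - t) / t) ^ d * (1 + t) powr u"
      using t by (intro order_trans[OF main] mult_left_mono) auto
    hence "c * (1 + t) powr (- u) \<le> ((1 - t) / t) ^ d / real d"
      using d t by (simp add: powr_minus field_simps)
    also have "\<dots> \<le> ((1 - t) / t) ^ d / real d * t powr (- \<alpha>)"
    proof -
      have "1 \<le> t powr (- \<alpha>)" using t \<alpha> powr_mono'[of "- \<alpha>" 0 t] by simp
      thus ?thesis using t mult_left_mono[of 1 "t powr (- \<alpha>)" "((1 - t) / t) ^ d / real d"] by simp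
    qed
    also have "\<dots> = S"
      using t by (simp add: S_def powr_add powr_realpow powr_minus power_divide field_simps)
    finally show ?thesis by (simp add: c_def)
  next
    case False
    hence t2: "1 / 2 \<le> t" by simp
    define Y where "Y = (1 + t) powr (2 * \<kappa>) * ((1 + t) / t) powr \<alpha>"
    have r: "3 / 2 \<le> (1 + t) / t" using t by (simp add: field_simps)
    have "max (u / 2) (1 / 2) \<le> 1 / 2 * (3 / 2) powr u"
      using le_three_halves_powr[of u] u ge_one_powr_ge_zero[of "3/2" u] by simp
    also have "(3 / 2) powr u = (3 / 2) powr (2 * \<kappa>) * (3 / 2) powr \<alpha>"
      by (simp add: u_def powr_add)
    also have "1 / 2 * ((3 / 2) powr (2 * \<kappa>) * (3 / 2) powr \<alpha>) \<le> 1 / 2 * Y"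
      unfolding Y_def using t2 r \<kappa> \<alpha> by (intro mult_left_mono mult_mono powr_mono2) auto
    finally have Y1: "max (u / 2) (1 / 2) \<le> 1 / 2 * Y" .
    have q: "3 / 2 \<le> (1 + t)\<^sup>2 / (1 + t\<^sup>2)"
    proof -
      have "t * t \<le> 1 * t" using t by (intro mult_right_mono) auto
      hence "t\<^sup>2 \<le> t" by (simp add: power2_eq_square)
      moreover have "3 * (1 + t\<^sup>2) \<le> 2 * (1 + t)\<^sup>2"
        using \<open>t\<^sup>2 \<le> t\<close> t2 by (simp add: power2_sum)
      ultimately show ?thesis by (simp add: pos_le_divide_eq add_pos_nonneg)
    qed
    have "max (u / 2) (1 / 2) \<le> (3 / 2) powr (u / 2)"
      using le_three_halves_powr[of "u / 2"] u ge_one_powr_ge_zero[of "3/2" "u / 2"] by simp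
    also have "\<dots> \<le> (3 / 2) powr (\<kappa> + \<alpha>)"
      using \<alpha> by (intro powr_mono) (auto simp: u_def)
    also have "\<dots> = (3 / 2) powr \<kappa> * (3 / 2) powr \<alpha>"
      by (simp add: powr_add)
    also have "\<dots> \<le> ((1 + t)\<^sup>2 / (1 + t\<^sup>2)) powr \<kappa> * ((1 + t) / t) powr \<alpha>"
      using q r \<kappa> \<alpha> by (intro mult_mono powr_mono2) auto
    also have "((1 + t)\<^sup>2 / (1 + t\<^sup>2)) powr \<kappa> = (1 + t\<^sup>2) powr (- \<kappa>) * (1 + t) powr (2 * \<kappa>)"
    proof -
      have "((1 + t)\<^sup>2) powr \<kappa> = (1 + t) powr (2 * \<kappa>)"
        using t by (simp add: powr_powr flip: powr_numeral)
      moreover have "((1 + t)\<^sup>2 / (1 + t\<^sup>2)) powr \<kappa> = ((1 + t)\<^sup>2) powr \<kappa> / (1 + t\<^sup>2) powr \<kappa>"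
        by (rule powr_divide)
      ultimately show ?thesis by (simp add: powr_minus divide_inverse mult.commute)
    qed
    finally have Y2: "max (u / 2) (1 / 2) \<le> (1 + t\<^sup>2) powr (- \<kappa>) * Y"
      by (simp add: Y_def mult.assoc)
    have "u * c \<le> min (1 / 2) ((1 + t\<^sup>2) powr (- \<kappa>)) * Y"
      using Y1 Y2 ratio_powr_le(3)[OF u] unfolding c_def min_def by (auto intro: order_trans)
    also have "Y = t powr (- \<alpha>) * (1 + t) powr u"
      using t by (simp add: Y_def u_def powr_add powr_divide powr_minus field_simps)
    finally have "c * (1 + t) powr (- u) \<le> min (1 / 2) ((1 + t\<^sup>2) powr (- \<kappa>)) * t powr (- \<alpha>) / u"
    proof -
      assume *: "u * c \<le> min (1 / 2) ((1 + t\<^sup>2) powr (- \<kappa>)) * (t powr (- \<alpha>) * (1 + t) powr u)"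
      have "c * (1 + t) powr (- u) = u * c * ((1 + t) powr (- u) / u)" using u by simp
      also have "\<dots> \<le> min (1 / 2) ((1 + t\<^sup>2) powr (- \<kappa>)) * (t powr (- \<alpha>) * (1 + t) powr u) * ((1 + t) powr (- u) / u)"
        using u by (intro mult_right_mono[OF *]) auto
      also have "\<dots> = min (1 / 2) ((1 + t\<^sup>2) powr (- \<kappa>)) * t powr (- \<alpha>) / u"
        using t by (simp add: powr_minus)
      finally show ?thesis .
    qed
    thus ?thesis by (simp add: c_def)
  qed
qed

text \<open>
  \<open>H_plus\<close> is continuous and tends to \<open>-\<infinity>\<close> at both ends of the interval, because of its fourth term
  at \<open>0\<close> and its fifth term at \<open>1\<close>; hence its maximum is attained and \<open>GREATEST\<close> denotes it.
\<close>

lemma K_plus_pos_imp: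
  assumes d: "0 < d" and \<alpha>: "0 < \<alpha>" "\<alpha> < 2" and \<kappa>: "0 < \<kappa>" "2 * \<kappa> < real d"
    and K: "0 < K_plus d \<alpha> \<kappa>"
  obtains t where "0 < t" "t < 1" "0 < H_plus d \<alpha> \<kappa> t"
proof -
  define B where "B = 1 / (real d - 2 * \<kappa>) + 1"
  define E where "E = 2 * \<kappa> * (2 * \<kappa> + 1) * (real d)\<^sup>2 / (2 - \<alpha>)"
  have E: "0 < E" using \<alpha> \<kappa> d by (simp add: E_def)
  have H_le: "H_plus d \<alpha> \<kappa> t \<le> B - t powr (- \<alpha>) / \<alpha> - E * (t powr (2 - \<alpha>) / (1 - t) powr (2 * \<kappa> + 2))"
    if t: "0 < t" "t < 1" for t
  proof -
    have "(1 - t) powr (d - 2 * \<kappa>) \<le> 1" using t \<kappa> by (intro powr_le1) auto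
    moreover have "1 \<le> (2 - t) powr (d + \<alpha>)" using t \<alpha> by (intro ge_one_powr_ge_zero) auto
    ultimately have "(1 - t) powr (d - 2 * \<kappa>) / (2 - t) powr (d + \<alpha>) \<le> 1 / 1"
      by (intro frac_le) auto
    hence "(1 - t) powr (d - 2 * \<kappa>) / (2 - t) powr (d + \<alpha>) / (d - 2 * \<kappa>) \<le> 1 / 1 / (real d - 2 * \<kappa>)"
      using \<kappa> by (intro divide_right_mono) auto
    hence "(1 - t) powr (d - 2 * \<kappa>) / ((2 - t) powr (d + \<alpha>) * (d - 2 * \<kappa>)) \<le> 1 / (real d - 2 * \<kappa>)"
      by simp
    moreover have "((2 * \<kappa> + \<alpha>) / (2 * \<kappa> + \<alpha> + 1)) powr (2 * \<kappa> + \<alpha>) * (1 + t) powr (- (2 * \<kappa> + \<alpha>)) \<le> 1 * 1"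
      using t \<alpha> \<kappa> by (intro mult_mono ratio_powr_le powr_minus_le_one) auto
    moreover have "0 \<le> (1 - t) ^ d / (d * t powr (d + \<alpha>))" using t by simp
    moreover have "2 * \<kappa> * (2 * \<kappa> + 1) * (real d)\<^sup>2 * t powr (2 - \<alpha>) / ((2 - \<alpha>) * (1 - t) powr (2 * \<kappa> + 2))
        = E * (t powr (2 - \<alpha>) / (1 - t) powr (2 * \<kappa> + 2))"
      by (simp add: E_def)
    ultimately show ?thesis
      unfolding H_plus_eq[OF d \<alpha> \<kappa> t] B_def by linarith
  qed
  define v where "v = H_plus d \<alpha> \<kappa> (1 / 2)"
  have "\<forall>\<^sub>F t in at_right 0. B - t powr (- \<alpha>) / \<alpha> < v"
  proof -
    have "filterlim (\<lambda>t. B - t powr (- \<alpha>) / \<alpha>) at_bot (at_right 0)" using \<alpha> by real_asymp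
    thus ?thesis by (auto simp: filterlim_at_bot_dense)
  qed
  then obtain a where a: "0 < a" "\<And>t. 0 < t \<Longrightarrow> t < a \<Longrightarrow> B - t powr (- \<alpha>) / \<alpha> < v"
    by (auto simp: eventually_at_right[of 0 1, simplified])
  have "\<forall>\<^sub>F t in at_left 1. B - E * (t powr (2 - \<alpha>) / (1 - t) powr (2 * \<kappa> + 2)) < v"
  proof -
    have "filterlim (\<lambda>t. B - E * (t powr (2 - \<alpha>) / (1 - t) powr (2 * \<kappa> + 2))) at_bot (at_left 1)"
      using \<alpha> \<kappa> E by real_asymp
    thus ?thesis by (auto simp: filterlim_at_bot_dense)
  qed
  then obtain b where b: "b < 1" "\<And>t. b < t \<Longrightarrow> t < 1 \<Longrightarrow> B - E * (t powr (2 - \<alpha>) / (1 - t) powr (2 * \<kappa> + 2)) < v"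
    by (auto simp: eventually_at_left[of 0 1, simplified])
  define a' b' where "a' = min a (1 / 2)" and "b' = max b (1 / 2)"
  have ab: "0 < a'" "a' \<le> 1 / 2" "1 / 2 \<le> b'" "b' < 1" using a b by (auto simp: a'_def b'_def)
  have "continuous_on {a'..b'} (H_plus d \<alpha> \<kappa>)"
    unfolding H_plus_def using ab \<alpha> \<kappa> d by (intro continuous_intros) auto
  moreover have "{a'..b'} \<noteq> {}" using ab by auto
  ultimately obtain s where s: "s \<in> {a'..b'}" "\<And>t. t \<in> {a'..b'} \<Longrightarrow> H_plus d \<alpha> \<kappa> t \<le> H_plus d \<alpha> \<kappa> s"
    using continuous_attains_sup[OF compact_Icc, of a' b' "H_plus d \<alpha> \<kappa>"] by auto
  have vs: "v \<le> H_plus d \<alpha> \<kappa> s" unfolding v_def using ab by (intro s) auto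
  have "H_plus d \<alpha> \<kappa> t \<le> H_plus d \<alpha> \<kappa> s" if t: "0 < t" "t < 1" for t
  proof -
    have E0: "0 \<le> E * (t powr (2 - \<alpha>) / (1 - t) powr (2 * \<kappa> + 2))" "0 \<le> t powr (- \<alpha>) / \<alpha>"
      using E \<alpha> by auto
    consider "t < a'" | "t \<in> {a'..b'}" | "b' < t" by fastforce
    thus ?thesis
    proof cases
      case 1
      thus ?thesis using a(2)[of t] H_le[OF t] t E0 vs by (simp add: a'_def)
    next
      case 3
      thus ?thesis using b(2)[of t] H_le[OF t] t E0 vs by (simp add: b'_def)
    qed (rule s)
  qed
  hence "K_plus d \<alpha> \<kappa> = H_plus d \<alpha> \<kappa> s"
    unfolding K_plus_def using s(1) ab by (intro Greatest_equality) auto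
  thus thesis
    using that[of s] s(1) ab K by auto
qed

section \<open>A lower bound for the second difference integral\<close>

lemma near_weight_le:
  assumes "t < 1"
  shows "\<bar>indicator {..<t} (norm z) * (norm z)\<^sup>2\<bar> \<le> 2 * (1 - exp (- (norm z)\<^sup>2))"
proof (cases "norm z < t")
  case True
  define s where "s = (norm z)\<^sup>2"
  have s: "0 \<le> s" "s \<le> 1" using True assms by (auto simp: s_def intro!: power_le_one)
  have le: "exp (- s) \<le> 1 / (1 + s)"
    using exp_ge_add_one_self[of s] s by (simp add: exp_minus divide_simps)
  have "s / 2 \<le> s / (1 + s)" using s by (intro divide_left_mono) auto
  also have "\<dots> = 1 - 1 / (1 + s)" using s by (simp add: field_simps)
  also have "\<dots> \<le> 1 - exp (- s)" using le by (rule diff_left_mono)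
  finally have "s / 2 \<le> 1 - exp (- s)" .
  hence "s \<le> 2 * (1 - exp (- s))" by simp
  thus ?thesis using True by (simp add: s_def)
qed simp

lemma far_weight_le:
  assumes t: "0 < t" and K: "0 \<le> K" and w: "norm z < t \<Longrightarrow> w = 0" "\<bar>w\<bar> \<le> K"
  shows "\<bar>w\<bar> \<le> K / (1 - exp (- t\<^sup>2)) * (1 - exp (- (norm z)\<^sup>2))"
proof -
  have pos: "0 < 1 - exp (- t\<^sup>2)" using t by simp
  show ?thesis
  proof (cases "norm z < t")
    case True
    thus ?thesis using w pos K by simp
  next
    case False
    hence "t\<^sup>2 \<le> (norm z)\<^sup>2" using t by (intro power_mono) auto
    hence "1 - exp (- t\<^sup>2) \<le> 1 - exp (- (norm z)\<^sup>2)" by simp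
    hence "K * 1 \<le> K * ((1 - exp (- (norm z)\<^sup>2)) / (1 - exp (- t\<^sup>2)))"
      using pos K by (intro mult_left_mono) (auto simp: divide_simps)
    thus ?thesis using w by simp
  qed
qed

text \<open>
  By the parallelogram law \<open>|e+z|\<^sup>2 + |e-z|\<^sup>2 = 2 (1 + |z|\<^sup>2)\<close>. If both points lie outside the unit ball,
  the inequality between arithmetic and geometric means gives the mean value at least
  \<open>(1 + |z|\<^sup>2)\<close> to the power \<open>-\<kappa>\<close>; if one of them lies inside, it contributes \<open>1/2\<close> by itself.
  The decay in \<open>|z|\<close> is kept as a pure power so that the kernel integral is explicit.
\<close>

lemma powr_max_pair_ge:
  fixes e z :: "'a::real_inner"
  assumes e: "norm e = 1" and t: "0 < t" "t \<le> norm z" and \<kappa>: "0 < \<kappa>"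
  shows "min (1 / 2) ((1 + t\<^sup>2) powr (- \<kappa>)) * (norm z / t) powr (- (2 * \<kappa>))
     \<le> (max 1 (norm (e + z)) powr (- (2 * \<kappa>)) + max 1 (norm (e - z)) powr (- (2 * \<kappa>))) / 2"
proof -
  define a b r where "a = norm (e + z)" and "b = norm (e - z)" and "r = norm z"
  have r: "0 < r" "1 \<le> r / t" using t by (auto simp: r_def)
  have q1: "(r / t) powr (- (2 * \<kappa>)) \<le> 1"
    using r \<kappa> by (intro powr_minus_le_one) auto
  show ?thesis
  proof (cases "a \<le> 1 \<or> b \<le> 1")
    case True
    have "min (1 / 2) ((1 + t\<^sup>2) powr (- \<kappa>)) * (r / t) powr (- (2 * \<kappa>)) \<le> 1 / 2 * 1"
      using q1 by (intro mult_mono) auto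
    also have "\<dots> \<le> (max 1 a powr (- (2 * \<kappa>)) + max 1 b powr (- (2 * \<kappa>))) / 2"
      using True by (auto simp: max_def)
    finally show ?thesis by (simp add: a_def b_def r_def)
  next
    case False
    hence ab: "1 < a" "1 < b" by auto
    have "a\<^sup>2 + b\<^sup>2 = 2 * (1 + r\<^sup>2)"
      using e by (simp add: a_def b_def r_def power2_norm_eq_inner inner_simps norm_eq_1 inner_commute)
    moreover have "0 \<le> (a - b)\<^sup>2" by simp
    ultimately have ab_le: "a * b \<le> 1 + r\<^sup>2" by (simp add: power2_diff)
    also have "1 + r\<^sup>2 \<le> (1 + t\<^sup>2) * (r / t)\<^sup>2"
    proof -
      have "1 \<le> (r / t)\<^sup>2" using r by (intro one_le_power)
      moreover have "(1 + t\<^sup>2) * (r / t)\<^sup>2 = (r / t)\<^sup>2 + r\<^sup>2"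
        using t by (simp add: field_simps power_divide)
      ultimately show ?thesis by simp
    qed
    finally have "((1 + t\<^sup>2) * (r / t)\<^sup>2) powr (- \<kappa>) \<le> (a * b) powr (- \<kappa>)"
      using ab \<kappa> by (intro powr_mono2') auto
    moreover have "((1 + t\<^sup>2) * (r / t)\<^sup>2) powr (- \<kappa>) = (1 + t\<^sup>2) powr (- \<kappa>) * (r / t) powr (- (2 * \<kappa>))"
    proof -
      have "((r / t)\<^sup>2) powr (- \<kappa>) = (r / t) powr (- (2 * \<kappa>))"
        using r t by (simp add: powr_powr flip: powr_numeral)
      thus ?thesis by (simp add: powr_mult)
    qed
    moreover have "min (1 / 2) ((1 + t\<^sup>2) powr (- \<kappa>)) * (r / t) powr (- (2 * \<kappa>)) \<le>
        (1 + t\<^sup>2) powr (- \<kappa>) * (r / t) powr (- (2 * \<kappa>))"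
      by (intro mult_right_mono) auto
    moreover have "(a * b) powr (- \<kappa>) \<le> (a powr (- (2 * \<kappa>)) + b powr (- (2 * \<kappa>))) / 2"
    proof -
      define X Y where "X = a powr (- \<kappa>)" and "Y = b powr (- \<kappa>)"
      have "a powr (- (2 * \<kappa>)) = X\<^sup>2" "b powr (- (2 * \<kappa>)) = Y\<^sup>2"
        by (simp_all add: X_def Y_def power2_eq_square powr_add[symmetric])
      moreover have "(a * b) powr (- \<kappa>) = X * Y"
        by (simp add: X_def Y_def powr_mult)
      moreover have "0 \<le> (X - Y)\<^sup>2" by simp
      ultimately show ?thesis by (simp add: power2_diff)
    qed
    ultimately show ?thesis
      using ab by (simp add: max_def a_def b_def r_def)
  qed
qed

lemma integral_reflect:
  fixes f :: "'a::euclidean_space \<Rightarrow> real"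
  assumes "f \<in> borel_measurable borel"
  shows "(LINT z|lborel. f (- z)) = (LINT z|lborel. f z)"
  using lborel_integral_affine[OF assms, of "-1" 0] by simp

text \<open>
  Here \<open>z = h/R\<close> with \<open>R = |x|\<close>. For \<open>|z| < t\<close> the second difference is bounded below by
  \<open>- lam |z|\<^sup>2\<close>. For \<open>|z| \<ge> t\<close> the two shifted values contribute equally by symmetry, and half of their
  sum splits at the ball \<open>B\<close> of those \<open>z\<close> for which \<open>x + R z\<close> is closer to the origin than \<open>(1-t) R\<close>. On
  \<open>B\<close> the kernel is at least \<open>q (2 - t)\<close>. Off \<open>B\<close> the integral is nonnegative; moreover, adding \<open>\<phi> x\<close>
  over \<open>B\<close>, which costs at most \<open>\<phi> x * q t\<close> times the volume of \<open>B\<close>, makes the integrand at least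
  the minimum of \<open>\<phi> x\<close> and \<open>\<phi> (x + R z)\<close> on all of \<open>|z| \<ge> t\<close>. That minimum is a power of
  \<open>max 1 |e+z|\<close> up to the constant \<open>\<beta>\<close>, and the pairing of \<open>z\<close> with \<open>-z\<close> applies to it.
\<close>

lemma integral_second_diff_lower_bound:
  fixes \<phi> :: "'a::euclidean_space \<Rightarrow> real" and x :: 'a and \<rho> q :: "real \<Rightarrow> real"
  assumes t: "0 < t" "t < 1" and \<kappa>: "0 < \<kappa>" and R: "0 < R" "R = norm x"
    and \<phi>: "\<And>y. \<phi> y = \<rho> (norm y)" "\<And>r. 0 \<le> r \<Longrightarrow> 0 \<le> \<rho> r" "antimono_on {0..} \<rho>"
    and \<phi>_meas: "\<phi> \<in> borel_measurable borel"
    and near: "\<And>z. norm z < t \<Longrightarrow> \<bar>second_diff (R *\<^sub>R z) \<phi> x\<bar> \<le> lam * (norm z)\<^sup>2"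
    and tail: "0 \<le> \<beta>" "\<And>r. R \<le> r \<Longrightarrow> \<beta> * r powr (- (2 * \<kappa>)) \<le> \<rho> r"
    and q: "q \<in> borel_measurable borel" "\<And>r. 0 \<le> q r" "\<And>r s. 0 < r \<Longrightarrow> r \<le> s \<Longrightarrow> q s \<le> q r"
    and q_int: "\<And>(w::'a \<Rightarrow> real) C. w \<in> borel_measurable borel \<Longrightarrow>
        (\<And>z. \<bar>w z\<bar> \<le> C * (1 - exp (- (norm z)\<^sup>2))) \<Longrightarrow> integrable lborel (\<lambda>z. w z * q (norm z))"
  defines "Q1 \<equiv> LINT z|lborel. (indicator {..<t} (norm (z::'a)) * (norm z)\<^sup>2) * q (norm z)"
    and "Q2 \<equiv> LINT z|lborel. indicator {t..} (norm (z::'a)) * q (norm z)"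
    and "Q3 \<equiv> LINT z|lborel. (indicator {t..} (norm (z::'a)) * norm z powr (- (2 * \<kappa>))) * q (norm z)"
  shows "q (2 - t) * (LINT y|lborel. indicator {..<1-t} (norm (y::'a)) * \<phi> (R *\<^sub>R y))
       - lam / 2 * Q1 - \<phi> x * Q2
       + max 0 (\<beta> * R powr (- (2 * \<kappa>)) * (min (1 / 2) ((1 + t\<^sup>2) powr (- \<kappa>)) * t powr (2 * \<kappa>)) * Q3
                  - \<phi> x * q t * (unit_ball_vol DIM('a) * (1 - t) ^ DIM('a)))
     \<le> (LINT z|lborel. second_diff (R *\<^sub>R z) \<phi> x * q (norm z)) / 2"
proof -
  note [measurable] = \<phi>_meas q(1)
  define e where "e = (1 / R) *\<^sub>R x"
  have e: "norm e = 1" "x = R *\<^sub>R e" using R by (auto simp: e_def)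
  have \<phi>0: "0 \<le> \<phi> y" for y using \<phi>(1,2) by simp
  have \<phi>_mono: "\<phi> y \<le> \<phi> y'" if "norm y' \<le> norm y" for y y'
    using that \<phi>(1,3) by (auto simp: monotone_on_def)
  have \<phi>_le: "\<phi> y \<le> \<phi> 0" for y by (rule \<phi>_mono) simp
  have far_int: "integrable lborel (\<lambda>z. (indicator {t..} (norm z) * w z) * q (norm z))"
    if "w \<in> borel_measurable borel" "\<And>z. t \<le> norm z \<Longrightarrow> \<bar>w z\<bar> \<le> K" "0 \<le> K" for w :: "'a \<Rightarrow> real" and K
  proof (rule q_int)
    show "(\<lambda>z. indicator {t..} (norm z) * w z) \<in> borel_measurable borel" using that(1) by measurable
    show "\<bar>indicator {t..} (norm z) * w z\<bar> \<le> K / (1 - exp (- t\<^sup>2)) * (1 - exp (- (norm z)\<^sup>2))" for z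
      by (rule far_weight_le[OF t(1)]) (use that in \<open>auto simp: indicator_def\<close>)
  qed
  have near_int: "integrable lborel (\<lambda>z::'a. (indicator {..<t} (norm z) * (norm z)\<^sup>2) * q (norm z))"
    by (rule q_int[OF _ near_weight_le[OF t(2)]]) measurable
  define P where "P = (LINT z|lborel. (indicator {t..} (norm z) * \<phi> (x + R *\<^sub>R z)) * q (norm z))"
  have P_int: "integrable lborel (\<lambda>z. (indicator {t..} (norm z) * \<phi> (x + R *\<^sub>R z)) * q (norm z))"
    by (rule far_int[where K="\<phi> 0"]) (use \<phi>0 \<phi>_le in \<open>auto simp: abs_le_iff intro: order_trans[of _ 0]\<close>)
  have P_int': "integrable lborel (\<lambda>z. (indicator {t..} (norm z) * \<phi> (x - R *\<^sub>R z)) * q (norm z))"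
    by (rule far_int[where K="\<phi> 0"]) (use \<phi>0 \<phi>_le in \<open>auto simp: abs_le_iff intro: order_trans[of _ 0]\<close>)
  have Q2_int: "integrable lborel (\<lambda>z::'a. indicator {t..} (norm z) * q (norm z))"
    using far_int[of "\<lambda>_. 1" 1] by simp
  have P_refl: "(LINT z|lborel. (indicator {t..} (norm z) * \<phi> (x - R *\<^sub>R z)) * q (norm z)) = P"
    unfolding P_def
    by (subst integral_reflect[symmetric]) auto

  define D where "D z = second_diff (R *\<^sub>R z) \<phi> x" for z
  have [measurable]: "D \<in> borel_measurable borel"
    unfolding D_def second_diff_def by measurable
  have near_int_D: "integrable lborel (\<lambda>z. (indicator {..<t} (norm z) * D z) * q (norm z))"
  proof (rule q_int)
    show "(\<lambda>z. indicator {..<t} (norm z) * D z) \<in> borel_measurable borel" by measurable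
    show "\<bar>indicator {..<t} (norm z) * D z\<bar> \<le> (2 * \<bar>lam\<bar>) * (1 - exp (- (norm z)\<^sup>2))" for z
    proof (cases "norm z < t")
      case True
      have "\<bar>D z\<bar> \<le> lam * (norm z)\<^sup>2" using near[OF True] by (simp add: D_def)
      also have "\<dots> \<le> \<bar>lam\<bar> * (norm z)\<^sup>2" by (intro mult_right_mono) auto
      also have "\<dots> \<le> \<bar>lam\<bar> * (2 * (1 - exp (- (norm z)\<^sup>2)))"
        using near_weight_le[OF t(2), of z] True by (intro mult_left_mono) auto
      finally show ?thesis using True by (simp add: algebra_simps)
    qed simp
  qed
  have near_bd: "- (lam * Q1) \<le> (LINT z|lborel. (indicator {..<t} (norm z) * D z) * q (norm z))"
  proof -
    have "(LINT z|lborel. - lam * ((indicator {..<t} (norm (z::'a)) * (norm z)\<^sup>2) * q (norm z)))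
        \<le> (LINT z|lborel. (indicator {..<t} (norm z) * D z) * q (norm z))"
    proof (rule integral_mono)
      fix z :: 'a
      show "- lam * ((indicator {..<t} (norm (z::'a)) * (norm z)\<^sup>2) * q (norm z)) \<le> (indicator {..<t} (norm z) * D z) * q (norm z)"
      proof (cases "norm z < t")
        case True
        have "- (lam * (norm z)\<^sup>2) \<le> D z" using near[OF True] by (auto simp: D_def)
        hence "- (lam * (norm z)\<^sup>2) * q (norm z) \<le> D z * q (norm z)" by (intro mult_right_mono q)
        thus ?thesis using True by (simp add: mult_ac)
      qed simp
    qed (use near_int near_int_D in auto)
    thus ?thesis by (simp add: Q1_def)
  qed
  have far_eq: "(indicator {t..} (norm z) * D z) * q (norm z) =
      (indicator {t..} (norm z) * \<phi> (x + R *\<^sub>R z)) * q (norm z)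
      + (indicator {t..} (norm z) * \<phi> (x - R *\<^sub>R z)) * q (norm z)
      - 2 * \<phi> x * (indicator {t..} (norm z) * q (norm z))" for z
    by (simp add: D_def second_diff_def algebra_simps)
  have far_int_D: "integrable lborel (\<lambda>z. (indicator {t..} (norm z) * D z) * q (norm z))"
    unfolding far_eq using P_int P_int' Q2_int by (intro Bochner_Integration.integrable_add
      Bochner_Integration.integrable_diff integrable_mult_right)
  have far_val: "(LINT z|lborel. (indicator {t..} (norm z) * D z) * q (norm z)) = 2 * P - 2 * \<phi> x * Q2"
    unfolding far_eq using P_int P_int' Q2_int P_refl by (simp add: P_def Q2_def)
  have split: "D z * q (norm z) = (indicator {..<t} (norm z) * D z) * q (norm z) + (indicator {t..} (norm z) * D z) * q (norm z)" for z
    by (auto simp: indicator_def)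
  have total: "(LINT z|lborel. D z * q (norm z)) \<ge> - (lam * Q1) + (2 * P - 2 * \<phi> x * Q2)"
    unfolding split using near_int_D far_int_D near_bd far_val by simp

  \<comment> \<open>The ball \<open>B\<close>, on which \<open>t \<le> |z| \<le> 2 - t\<close>.\<close>
  define B where "B = {z::'a. norm (e + z) < 1 - t}"
  have [measurable]: "B \<in> sets borel" unfolding B_def by measurable
  have B: "t \<le> norm z" "norm z \<le> 2 - t" if "z \<in> B" for z
    using that norm_triangle_ineq2[of e "- z"] norm_triangle_ineq[of "e + z" "- e"] e(1)
    by (auto simp: B_def)
  have x_eq: "x + R *\<^sub>R z = R *\<^sub>R (e + z)" for z by (simp add: e(2)[symmetric] scaleR_add_right)
  define PB where "PB = (LINT z|lborel. (indicator B z * \<phi> (x + R *\<^sub>R z)) * q (norm z))"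
  define PO where "PO = (LINT z|lborel. (indicator ({z. t \<le> norm z} - B) z * \<phi> (x + R *\<^sub>R z)) * q (norm z))"
  have PB_int: "integrable lborel (\<lambda>z. (indicator B z * \<phi> (x + R *\<^sub>R z)) * q (norm z))"
  proof -
    have eq: "(indicator {t..} (norm z) * (indicator B z * \<phi> (x + R *\<^sub>R z))) * q (norm z) = (indicator B z * \<phi> (x + R *\<^sub>R z)) * q (norm z)" for z
      using B(1)[of z] by (auto simp: indicator_def)
    have "integrable lborel (\<lambda>z. (indicator {t..} (norm z) * (indicator B z * \<phi> (x + R *\<^sub>R z))) * q (norm z))"
      by (rule far_int[where K="\<phi> 0"]) (use \<phi>0 \<phi>_le in \<open>auto simp: indicator_def abs_le_iff intro: order_trans[of _ 0]\<close>)
    thus ?thesis unfolding eq .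
  qed
  have P_split: "(indicator {t..} (norm z) * \<phi> (x + R *\<^sub>R z)) * q (norm z) =
     (indicator B z * \<phi> (x + R *\<^sub>R z)) * q (norm z) + (indicator ({z. t \<le> norm z} - B) z * \<phi> (x + R *\<^sub>R z)) * q (norm z)" for z
    using B(1)[of z] by (auto simp: indicator_def)
  have PO_int: "integrable lborel (\<lambda>z. (indicator ({z. t \<le> norm z} - B) z * \<phi> (x + R *\<^sub>R z)) * q (norm z))"
    using Bochner_Integration.integrable_diff[OF P_int PB_int] unfolding P_split by simp
  have P_sum: "P = PB + PO"
    unfolding P_def P_split PB_def PO_def using PB_int PO_int by simp
  have PO0: "0 \<le> PO"
    unfolding PO_def using \<phi>0 q(2) by (intro Bochner_Integration.integral_nonneg) auto

  have fin_ball: "emeasure lborel {y::'a. norm y < 1 - t} < \<infinity>"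
    using emeasure_lborel_ball_finite[of "0::'a" "1 - t"] by (simp add: ball_def dist_norm)
  have ball_int: "integrable lborel (\<lambda>y::'a. indicator {..<1-t} (norm y) * \<phi> (R *\<^sub>R y))"
  proof (rule Bochner_Integration.integrable_bound)
    show "integrable lborel (\<lambda>y::'a. indicator {y. norm y < 1 - t} y * \<phi> 0)"
      using fin_ball by (intro integrable_mult_left integrable_real_indicator) auto
    show "AE y in lborel. norm (indicator {..<1-t} (norm (y::'a)) * \<phi> (R *\<^sub>R y)) \<le> norm (indicator {y. norm y < 1 - t} y * \<phi> 0)"
      using \<phi>0 \<phi>_le by (intro AE_I2) (auto simp: indicator_def)
  qed measurable
  have ball_trans: "(LINT y|lborel. indicator {..<1-t} (norm (y::'a)) * \<phi> (R *\<^sub>R y)) = (LINT z|lborel. indicator B z * \<phi> (x + R *\<^sub>R z))"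
  proof -
    have "(LINT y|lborel. indicator {..<1-t} (norm (y::'a)) * \<phi> (R *\<^sub>R y)) =
       (LINT z|lborel. indicator {..<1-t} (norm (e + 1 *\<^sub>R z)) * \<phi> (R *\<^sub>R (e + 1 *\<^sub>R z)))"
      by (subst lborel_integral_affine[of _ 1 e]) auto
    also have "\<dots> = (LINT z|lborel. indicator B z * \<phi> (x + R *\<^sub>R z))"
      by (intro Bochner_Integration.integral_cong) (auto simp: x_eq B_def indicator_def)
    finally show ?thesis .
  qed
  have ball_trans_int: "integrable lborel (\<lambda>z. indicator B z * \<phi> (x + R *\<^sub>R z))"
  proof -
    have "integrable lborel (\<lambda>z. indicator {..<1-t} (norm (e + 1 *\<^sub>R z)) * \<phi> (R *\<^sub>R (e + 1 *\<^sub>R z)))"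
      by (subst lborel_integrable_affine[where f="\<lambda>y. indicator {..<1-t} (norm y) * \<phi> (R *\<^sub>R y)"])
         (use ball_int in auto)
    thus ?thesis by (simp add: x_eq B_def indicator_def)
  qed
  have PB_ge: "q (2 - t) * (LINT y|lborel. indicator {..<1-t} (norm (y::'a)) * \<phi> (R *\<^sub>R y)) \<le> PB"
  proof -
    have "(LINT z|lborel. q (2 - t) * (indicator B z * \<phi> (x + R *\<^sub>R z))) \<le> PB"
      unfolding PB_def
    proof (rule integral_mono)
      fix z
      show "q (2 - t) * (indicator B z * \<phi> (x + R *\<^sub>R z)) \<le> (indicator B z * \<phi> (x + R *\<^sub>R z)) * q (norm z)"
      proof (cases "z \<in> B")
        case True
        have "q (2 - t) \<le> q (norm z)" using B[OF True] t by (intro q) auto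
        thus ?thesis using True \<phi>0 mult_right_mono[of "q (2 - t)" "q (norm z)" "\<phi> (x + R *\<^sub>R z)"] by (simp add: mult.commute)
      qed simp
    qed (use ball_trans_int PB_int in auto)
    thus ?thesis by (simp add: ball_trans)
  qed

  \<comment> \<open>The complement of \<open>B\<close>; \<open>p\<close> is the limiting shape of the minimum of \<open>\<phi> x\<close> and \<open>\<phi> (x + R z)\<close>.\<close>
  define b where "b = min (1 / 2) ((1 + t\<^sup>2) powr (- \<kappa>))"
  define p where "p z = max 1 (norm (e + z)) powr (- (2 * \<kappa>))" for z
  have [measurable]: "p \<in> borel_measurable borel" unfolding p_def by measurable
  have p01: "0 \<le> p z" "p z \<le> 1" for z using \<kappa> by (auto simp: p_def intro!: powr_minus_le_one)
  have b0: "0 \<le> b" by (simp add: b_def)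
  define IB where "IB = (LINT z|lborel. indicator B z * q (norm z))"
  have IB_int: "integrable lborel (\<lambda>z. indicator B z * q (norm z))"
  proof -
    have eq: "(indicator {t..} (norm z) * indicator B z) * q (norm z) = indicator B z * q (norm z)" for z
      using B(1)[of z] by (auto simp: indicator_def)
    have "integrable lborel (\<lambda>z. (indicator {t..} (norm z) * indicator B z) * q (norm z))"
      by (rule far_int[where K=1]) (auto simp: indicator_def)
    thus ?thesis unfolding eq .
  qed
  have IB_le: "IB \<le> q t * (unit_ball_vol DIM('a) * (1 - t) ^ DIM('a))"
  proof -
    have "B = ball (- e) (1 - t)" by (auto simp: B_def dist_norm norm_minus_commute add.commute)
    hence mB: "measure lborel B = unit_ball_vol DIM('a) * (1 - t) ^ DIM('a)" "emeasure lborel B < \<infinity>"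
      using t content_ball[of "1 - t" "- e"] emeasure_lborel_ball_finite[of "- e" "1 - t"] by auto
    have "IB \<le> (LINT z|lborel. indicator B z * q t)"
      unfolding IB_def
    proof (rule integral_mono)
      show "integrable lborel (\<lambda>z. indicator B z * q t)"
        using mB by (intro integrable_mult_left integrable_real_indicator) auto
      show "indicator B z * q (norm z) \<le> indicator B z * q t" for z
        using B(1)[of z] t by (auto simp: indicator_def intro!: q)
    qed (rule IB_int)
    also have "\<dots> = q t * (unit_ball_vol DIM('a) * (1 - t) ^ DIM('a))"
      using mB by simp
    finally show ?thesis .
  qed
  have pq_int: "integrable lborel (\<lambda>z. (indicator {t..} (norm z) * p z) * q (norm z))"
    by (rule far_int[where K=1]) (use p01 in auto)
  have pq_int': "integrable lborel (\<lambda>z. (indicator {t..} (norm z) * p (- z)) * q (norm z))"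
    by (rule far_int[where K=1]) (use p01 in auto)
  have Q3_int: "integrable lborel (\<lambda>z::'a. (indicator {t..} (norm z) * norm z powr (- (2 * \<kappa>))) * q (norm z))"
    by (rule far_int[where K="t powr (- (2 * \<kappa>))"]) (use t \<kappa> in \<open>auto intro!: powr_mono2'\<close>)
  have PO_ge: "\<beta> * R powr (- (2 * \<kappa>)) * (LINT z|lborel. (indicator {t..} (norm z) * p z) * q (norm z)) \<le> PO + \<phi> x * IB"
  proof -
    have "(LINT z|lborel. \<beta> * R powr (- (2 * \<kappa>)) * ((indicator {t..} (norm z) * p z) * q (norm z)))
       \<le> (LINT z|lborel. (indicator ({z. t \<le> norm z} - B) z * \<phi> (x + R *\<^sub>R z)) * q (norm z) + \<phi> x * (indicator B z * q (norm z)))"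
    proof (rule integral_mono)
      fix z
      have m: "\<beta> * R powr (- (2 * \<kappa>)) * p z \<le> \<rho> (R * max 1 (norm (e + z)))"
      proof -
        have "\<beta> * R powr (- (2 * \<kappa>)) * p z = \<beta> * (R * max 1 (norm (e + z))) powr (- (2 * \<kappa>))"
          using R by (simp add: p_def powr_mult)
        also have "\<dots> \<le> \<rho> (R * max 1 (norm (e + z)))"
          using R by (intro tail(2)) auto
        finally show ?thesis .
      qed
      have \<rho>_anti: "\<rho> s \<le> \<rho> r" if "0 \<le> r" "r \<le> s" for r s
        using monotone_onD[OF \<phi>(3), of r s] that by simp
      have \<phi>x: "\<phi> x = \<rho> R" using \<phi>(1)[of x] R(2) by simp
      have m1: "\<rho> (R * max 1 (norm (e + z))) \<le> \<phi> x"
        unfolding \<phi>x using R(1) by (intro \<rho>_anti) auto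
      have "\<phi> (x + R *\<^sub>R z) = \<rho> (R * norm (e + z))"
        unfolding x_eq \<phi>(1) using R(1) by simp
      hence m2: "\<rho> (R * max 1 (norm (e + z))) \<le> \<phi> (x + R *\<^sub>R z)"
        using R(1) by (auto intro!: \<rho>_anti)
      show "\<beta> * R powr (- (2 * \<kappa>)) * ((indicator {t..} (norm z) * p z) * q (norm z)) \<le>
         (indicator ({z. t \<le> norm z} - B) z * \<phi> (x + R *\<^sub>R z)) * q (norm z) + \<phi> x * (indicator B z * q (norm z))"
      proof (cases "t \<le> norm z")
        case True
        have "\<beta> * R powr (- (2 * \<kappa>)) * p z * q (norm z) \<le> \<phi> x * q (norm z)"
          "\<beta> * R powr (- (2 * \<kappa>)) * p z * q (norm z) \<le> \<phi> (x + R *\<^sub>R z) * q (norm z)"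
          by (intro mult_right_mono q(2) order_trans[OF m] m1 m2)+
        thus ?thesis using True by (auto simp: indicator_def mult_ac)
      next
        case False
        thus ?thesis using B(1)[of z] by (auto simp: indicator_def)
      qed
    qed (use pq_int PO_int IB_int in auto)
    thus ?thesis using PO_int IB_int by (simp add: PO_def IB_def)
  qed
  have pair: "b * t powr (2 * \<kappa>) * Q3 \<le> (LINT z|lborel. (indicator {t..} (norm z) * p z) * q (norm z))"
  proof -
    have "(LINT z|lborel. b * t powr (2 * \<kappa>) * ((indicator {t..} (norm (z::'a)) * norm z powr (- (2 * \<kappa>))) * q (norm z)))
      \<le> (LINT z|lborel. ((indicator {t..} (norm z) * p z) * q (norm z) + (indicator {t..} (norm z) * p (- z)) * q (norm z)) / 2)"
    proof (rule integral_mono)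
      fix z :: 'a
      show "b * t powr (2 * \<kappa>) * ((indicator {t..} (norm (z::'a)) * norm z powr (- (2 * \<kappa>))) * q (norm z)) \<le>
         ((indicator {t..} (norm z) * p z) * q (norm z) + (indicator {t..} (norm z) * p (- z)) * q (norm z)) / 2"
      proof (cases "t \<le> norm z")
        case True
        have "b * (norm z / t) powr (- (2 * \<kappa>)) \<le> (p z + p (- z)) / 2"
          using powr_max_pair_ge[OF e(1) t(1) True \<kappa>] by (simp add: b_def p_def)
        moreover have "(norm z / t) powr (- (2 * \<kappa>)) = t powr (2 * \<kappa>) * norm z powr (- (2 * \<kappa>))"
          unfolding powr_divide by (simp add: powr_minus divide_inverse mult.commute)
        ultimately have "b * (t powr (2 * \<kappa>) * norm z powr (- (2 * \<kappa>))) * q (norm z) \<le> (p z + p (- z)) / 2 * q (norm z)"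
          by (intro mult_right_mono q) auto
        thus ?thesis using True by (simp add: algebra_simps add_divide_distrib)
      qed simp
    qed (use pq_int pq_int' Q3_int in auto)
    moreover have "(LINT z|lborel. (indicator {t..} (norm z) * p (- z)) * q (norm z)) = (LINT z|lborel. (indicator {t..} (norm z) * p z) * q (norm z))"
      by (subst integral_reflect[symmetric]) auto
    ultimately show ?thesis
      using pq_int pq_int' by (simp add: Q3_def)
  qed
  have "\<beta> * R powr (- (2 * \<kappa>)) * (b * t powr (2 * \<kappa>)) * Q3 - \<phi> x * q t * (unit_ball_vol DIM('a) * (1 - t) ^ DIM('a)) \<le> PO"
  proof -
    have "\<beta> * R powr (- (2 * \<kappa>)) * (b * t powr (2 * \<kappa>) * Q3) \<le> PO + \<phi> x * IB"
      using tail(1) by (intro order_trans[OF mult_left_mono[OF pair] PO_ge]) auto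
    moreover have "\<phi> x * IB \<le> \<phi> x * (q t * (unit_ball_vol DIM('a) * (1 - t) ^ DIM('a)))"
      by (intro mult_left_mono IB_le \<phi>0)
    ultimately show ?thesis by (simp add: mult_ac)
  qed
  hence mx: "max 0 (\<beta> * R powr (- (2 * \<kappa>)) * (b * t powr (2 * \<kappa>)) * Q3 - \<phi> x * q t * (unit_ball_vol DIM('a) * (1 - t) ^ DIM('a))) \<le> PO"
    using PO0 by simp
  have "lam / 2 * Q1 = lam * Q1 / 2" by simp
  with mx total PB_ge P_sum show ?thesis unfolding D_def b_def by linarith
qed

section \<open>Asymptotics and positivity of the potential\<close>

lemma asymp_equiv_powr_tendsto:
  fixes \<rho> :: "real \<Rightarrow> real" and C \<kappa> :: real
  assumes "\<rho> \<sim>[at_top] (\<lambda>r. C * r powr (- (2 * \<kappa>)))"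
  shows "((\<lambda>r. r powr (2 * \<kappa>) * \<rho> r) \<longlongrightarrow> C) at_top"
proof -
  have "(\<lambda>r. r powr (2 * \<kappa>) * \<rho> r) \<sim>[at_top] (\<lambda>r. r powr (2 * \<kappa>) * (C * r powr (- (2 * \<kappa>))))"
    by (intro asymp_equiv_intros assms)
  moreover have "((\<lambda>r. r powr (2 * \<kappa>) * (C * r powr (- (2 * \<kappa>)))) \<longlongrightarrow> C) at_top"
    by (rule tendsto_eventually) (use eventually_gt_at_top[of 0] in \<open>eventually_elim, simp add: powr_minus\<close>)
  ultimately show ?thesis
    using asymp_equiv_tendsto_transfer asymp_equiv_sym by blast
qed

text \<open>
  Since \<open>2 \<kappa> < d\<close>, the limiting power is integrable at the origin and a multiple of it dominates
  \<open>R\<close> to the power \<open>2 \<kappa>\<close> times \<open>\<rho> (R |y|)\<close> uniformly in \<open>R\<close>: near zero \<open>\<rho>\<close> is bounded by \<open>\<rho> 0\<close>.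
\<close>

lemma ball_integral_tendsto:
  fixes \<rho> :: "real \<Rightarrow> real" and \<kappa> s C :: real
  assumes \<rho>: "\<And>r. 0 \<le> r \<Longrightarrow> 0 \<le> \<rho> r" "antimono_on {0..} \<rho>"
    and lim: "((\<lambda>r. r powr (2 * \<kappa>) * \<rho> r) \<longlongrightarrow> C) at_top"
    and \<kappa>: "0 < \<kappa>" "2 * \<kappa> < DIM('a::euclidean_space)" and s: "0 < s"
    and meas: "(\<lambda>y::'a. \<rho> (norm y)) \<in> borel_measurable borel"
  shows "((\<lambda>R. R powr (2 * \<kappa>) * (LINT y|lborel. indicator {..<s} (norm (y::'a)) * \<rho> (R * norm y))) \<longlongrightarrow>
     C * (real DIM('a) * unit_ball_vol DIM('a) * (s powr (DIM('a) - 2 * \<kappa>) / (DIM('a) - 2 * \<kappa>)))) at_top"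
proof -
  have mono: "\<rho> r' \<le> \<rho> r" if "0 \<le> r" "r \<le> r'" for r r'
    using monotone_onD[OF \<rho>(2), of r r'] that by simp
  have "\<forall>\<^sub>F r in at_top. r powr (2 * \<kappa>) * \<rho> r < C + 1"
    using order_tendstoD(2)[OF lim, of "C + 1"] by simp
  then obtain r0 where r0: "\<And>r. r0 \<le> r \<Longrightarrow> r powr (2 * \<kappa>) * \<rho> r < C + 1"
    by (auto simp: eventually_at_top_linorder)
  define r1 where "r1 = max r0 1"
  define K where "K = max (C + 1) (r1 powr (2 * \<kappa>) * \<rho> 0)"
  have K: "r powr (2 * \<kappa>) * \<rho> r \<le> K" if "0 < r" for r
  proof (cases "r1 \<le> r")
    case True
    thus ?thesis using r0[of r] by (simp add: K_def r1_def)
  next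
    case False
    have "r powr (2 * \<kappa>) * \<rho> r \<le> r1 powr (2 * \<kappa>) * \<rho> 0"
      using False that \<kappa> \<rho>(1)[of r] mono[of 0 r] by (intro mult_mono powr_mono2) auto
    thus ?thesis by (simp add: K_def)
  qed
  have hb: "has_bochner_integral lborel
     (\<lambda>y::'a. indicator {0..<s} (norm y) * norm y powr ((DIM('a) - 2 * \<kappa>) - DIM('a)))
     (real DIM('a) * unit_ball_vol DIM('a) * (s powr (DIM('a) - 2 * \<kappa>) / (DIM('a) - 2 * \<kappa>)))"
    by (rule integral_norm_powr_ball) (use s \<kappa> in auto)
  have split: "R powr (2 * \<kappa>) * \<rho> (R * norm y) = norm y powr (- (2 * \<kappa>)) * ((R * norm y) powr (2 * \<kappa>) * \<rho> (R * norm y))"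
    if "0 < R" "y \<noteq> 0" for R and y :: 'a
    using that by (simp add: powr_mult powr_minus)
  have meas_scale [measurable]: "(\<lambda>y::'a. \<rho> (R * norm y)) \<in> borel_measurable borel" if "0 \<le> R" for R
  proof -
    have "(\<lambda>y::'a. \<rho> (norm (R *\<^sub>R y))) \<in> borel_measurable borel"
      by (rule measurable_compose[OF _ meas]) measurable
    thus ?thesis using that by simp
  qed
  have lim_abs: "((\<lambda>R. LINT y|lborel. indicator {0..<s} (norm (y::'a)) * (\<bar>R\<bar> powr (2 * \<kappa>) * \<rho> (\<bar>R\<bar> * norm y))) \<longlongrightarrow>
     (LINT y|lborel. C * (indicator {0..<s} (norm (y::'a)) * norm y powr ((DIM('a) - 2 * \<kappa>) - DIM('a))))) at_top"
  proof (rule integral_dominated_convergence_at_top)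
    show "integrable lborel (\<lambda>y::'a. K * (indicator {0..<s} (norm y) * norm y powr ((DIM('a) - 2 * \<kappa>) - DIM('a))))"
      using hb by (simp add: has_bochner_integral_iff)
    show "(\<lambda>y::'a. indicator {0..<s} (norm y) * (\<bar>R\<bar> powr (2 * \<kappa>) * \<rho> (\<bar>R\<bar> * norm y))) \<in> borel_measurable lborel" for R
      using meas_scale[of "\<bar>R\<bar>"] by measurable
    show "(\<lambda>y::'a. C * (indicator {0..<s} (norm y) * norm y powr ((DIM('a) - 2 * \<kappa>) - DIM('a)))) \<in> borel_measurable lborel"
      by measurable
    show "AE y in lborel. ((\<lambda>R. indicator {0..<s} (norm (y::'a)) * (\<bar>R\<bar> powr (2 * \<kappa>) * \<rho> (\<bar>R\<bar> * norm y))) \<longlongrightarrow>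
       C * (indicator {0..<s} (norm y) * norm y powr ((DIM('a) - 2 * \<kappa>) - DIM('a)))) at_top"
      using AE_lborel_singleton[of "0::'a"]
    proof eventually_elim
      case (elim y)
      have "filterlim (\<lambda>R. R * norm y) at_top at_top" using elim by real_asymp
      hence "((\<lambda>R. (R * norm y) powr (2 * \<kappa>) * \<rho> (R * norm y)) \<longlongrightarrow> C) at_top"
        by (rule filterlim_compose[OF lim])
      hence "((\<lambda>R. indicator {0..<s} (norm y) * (norm y powr (- (2 * \<kappa>)) * ((R * norm y) powr (2 * \<kappa>) * \<rho> (R * norm y))))
           \<longlongrightarrow> indicator {0..<s} (norm y) * (norm y powr (- (2 * \<kappa>)) * C)) at_top"
        by (intro tendsto_intros)
      moreover have "\<forall>\<^sub>F R in at_top. indicator {0..<s} (norm y) * (norm y powr (- (2 * \<kappa>)) * ((R * norm y) powr (2 * \<kappa>) * \<rho> (R * norm y)))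
          = indicator {0..<s} (norm y) * (\<bar>R\<bar> powr (2 * \<kappa>) * \<rho> (\<bar>R\<bar> * norm y))"
        using eventually_gt_at_top[of 0] by eventually_elim (simp add: split[OF _ elim])
      ultimately show ?case
        by (auto simp: mult_ac intro: Lim_transform_eventually)
    qed
    show "\<forall>\<^sub>F R in at_top. AE y in lborel. norm (indicator {0..<s} (norm (y::'a)) * (\<bar>R\<bar> powr (2 * \<kappa>) * \<rho> (\<bar>R\<bar> * norm y)))
       \<le> K * (indicator {0..<s} (norm y) * norm y powr ((DIM('a) - 2 * \<kappa>) - DIM('a)))"
      using eventually_gt_at_top[of 0]
    proof eventually_elim
      case (elim R)
      show ?case
        using AE_lborel_singleton[of "0::'a"]
      proof eventually_elim
        case (elim y)
        have "norm y powr (- (2 * \<kappa>)) * ((R * norm y) powr (2 * \<kappa>) * \<rho> (R * norm y)) \<le> norm y powr (- (2 * \<kappa>)) * K"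
          using elim \<open>0 < R\<close> by (intro mult_left_mono K) auto
        hence "R powr (2 * \<kappa>) * \<rho> (R * norm y) \<le> K * norm y powr (- (2 * \<kappa>))"
          unfolding split[OF \<open>0 < R\<close> elim] by (simp only: mult.commute[of K])
        thus ?case using \<open>0 < R\<close> \<rho>(1)[of "R * norm y"] by (simp add: indicator_def abs_mult)
      qed
    qed
  qed
  have val: "(LINT y|lborel. C * (indicator {0..<s} (norm (y::'a)) * norm y powr ((DIM('a) - 2 * \<kappa>) - DIM('a))))
     = C * (real DIM('a) * unit_ball_vol DIM('a) * (s powr (DIM('a) - 2 * \<kappa>) / (DIM('a) - 2 * \<kappa>)))"
    using hb by (simp add: has_bochner_integral_iff)
  have ev: "\<forall>\<^sub>F R in at_top. (LINT y|lborel. indicator {0..<s} (norm (y::'a)) * (\<bar>R\<bar> powr (2 * \<kappa>) * \<rho> (\<bar>R\<bar> * norm y)))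
     = R powr (2 * \<kappa>) * (LINT y|lborel. indicator {..<s} (norm (y::'a)) * \<rho> (R * norm y))"
    using eventually_gt_at_top[of 0]
  proof eventually_elim
    case (elim R)
    have "(LINT y|lborel. indicator {0..<s} (norm (y::'a)) * (\<bar>R\<bar> powr (2 * \<kappa>) * \<rho> (\<bar>R\<bar> * norm y)))
       = (LINT y|lborel. R powr (2 * \<kappa>) * (indicator {..<s} (norm (y::'a)) * \<rho> (R * norm y)))"
      using elim by (intro Bochner_Integration.integral_cong) (auto simp: indicator_def)
    thus ?case by simp
  qed
  show ?thesis
    using Lim_transform_eventually[OF lim_abs ev] unfolding val .
qed

lemma nonlocal_potential_scaled:
  fixes \<phi> :: "'a::euclidean_space \<Rightarrow> real"
  assumes [measurable]: "\<phi> \<in> borel_measurable borel" "q \<in> borel_measurable borel"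
    and R: "0 < R" and J: "\<And>r. jump_kernel DIM('a) \<mu> (R * r) = N * q r"
  shows "nonlocal_potential \<mu> \<phi> x =
     1 / (2 * \<phi> x) * (R ^ DIM('a) * N * (LINT z|lborel. second_diff (R *\<^sub>R z) \<phi> x * q (norm z)))"
proof -
  have "jump_kernel DIM('a) \<mu> = (\<lambda>r. N * q (r / R))"
    using J[of "_ / R"] R by auto
  hence [measurable]: "jump_kernel DIM('a) \<mu> \<in> borel_measurable borel" by simp
  let ?F = "\<lambda>h. second_diff h \<phi> x * jump_kernel DIM('a) \<mu> (norm h)"
  have meas: "?F \<in> borel_measurable borel"
    unfolding second_diff_def by measurable
  have "(LINT h|lebesgue. ?F h) = (LINT h|lborel. ?F h)"
    using meas by (intro integral_completion) simp
  also have "\<dots> = R ^ DIM('a) * (LINT z|lborel. ?F (0 + R *\<^sub>R z))"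
    using lborel_integral_affine[OF meas, of R 0] R by simp
  also have "(LINT z|lborel. ?F (0 + R *\<^sub>R z)) = (LINT z|lborel. N * (second_diff (R *\<^sub>R z) \<phi> x * q (norm z)))"
    using R J by (intro Bochner_Integration.integral_cong) auto
  finally show ?thesis by (simp add: nonlocal_potential_def)
qed

text \<open>
  After rescaling, the sign of \<open>V x\<close> is that of the second difference integral, whose lower bound
  times \<open>|x|\<close> to the power \<open>2 \<kappa>\<close> converges to a positive multiple of a number that is arbitrarily
  close to an upper bound of \<open>C\<phi> * H_plus\<close>.
\<close>

theorem theorem6p2:
  fixes \<Phi> \<mu> l \<rho> :: "real \<Rightarrow> real"
    and \<phi> V :: "'a::euclidean_space \<Rightarrow> real"
    and M :: "real \<Rightarrow> real" and L :: "real \<Rightarrow> 'a \<Rightarrow> real"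
    and \<alpha> \<kappa> C\<phi> :: real
  assumes bernstein: "complete_bernstein \<Phi> \<mu>"
    and phi_L2: "in_L2 \<phi>"
    and phi_Linf: "in_Linf_on UNIV \<phi>"
    and phi_pos: "\<And>x. 0 < \<phi> x"
    and zero_energy: "schroedinger_zero \<Phi> V \<phi>"
    and potential: "\<And>x. V x = nonlocal_potential \<mu> \<phi> x"
    and phi_Z: "\<And>C. C \<in> {0<..<1} \<Longrightarrow> \<phi> \<in> Z_space C"
    and alpha: "\<alpha> \<in> {0<..<2}"
    and slow: "slowly_varying_at_zero l"
    and Phi_asymp: "\<Phi> \<sim>[at_right 0] (\<lambda>u. u powr (\<alpha> / 2) * l u)"
    and C\<phi>_pos: "0 < C\<phi>"
    and kappa: "\<kappa> \<in> {(real DIM('a) - 1) / 2 <..< real DIM('a) / 2}"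
    and rho_nonneg: "\<And>r. 0 \<le> r \<Longrightarrow> 0 \<le> \<rho> r"
    and rho_decreasing: "antimono_on {0..} \<rho>"
    and phi_radial: "\<And>x. \<phi> x = \<rho> (norm x)"
    and rho_asymp: "\<rho> \<sim>[at_top] (\<lambda>r. C\<phi> * r powr (- (2 * \<kappa>)))"
    and L_bound: "\<And>C. C \<in> {0<..<1} \<Longrightarrow> Z_bound C \<phi> (M C) (L C)"
    and L_asymp: "\<And>C. C \<in> {0<..<1} \<Longrightarrow>
      L C \<sim>[at_infinity] (\<lambda>x. C\<phi> * (4 * \<kappa> * (2 * \<kappa> + 1) * (real DIM('a))\<^sup>2)
        / ((1 - C) powr (2 * \<kappa> + 2) * norm x powr (2 * \<kappa> + 2)))"
    and K_pos: "K_plus DIM('a) \<alpha> \<kappa> > 0"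
  shows "\<exists>R>0. \<forall>x \<in> - ball 0 R. V x > 0"
proof -
  define d where "d = DIM('a)"
  have d: "0 < d" by (simp add: d_def)
  have \<alpha>: "0 < \<alpha>" "\<alpha> < 2" using alpha by auto
  have "1 \<le> real d" using d by simp
  hence \<kappa>: "0 < \<kappa>" "2 * \<kappa> < real d" "real d - 1 < 2 * \<kappa>"
    using kappa unfolding d_def by (simp_all, linarith)
  obtain t where t: "0 < t" "t < 1" and H: "0 < H_plus d \<alpha> \<kappa> t"
    using K_plus_pos_imp[OF d \<alpha> \<kappa>(1,2)] K_pos by (auto simp: d_def)
  obtain q N A where A: "0 < A"
    and q: "\<And>R. q R \<in> borel_measurable borel" "\<And>R r. 0 \<le> q R r"
      "\<And>R r s. 0 < r \<Longrightarrow> r \<le> s \<Longrightarrow> q R s \<le> q R r"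
    and J: "\<forall>\<^sub>F R in at_top. 0 < N R \<and> (\<forall>r. jump_kernel DIM('a) \<mu> (R * r) = N R * q R r)"
    and q_lim: "\<And>r. 0 < r \<Longrightarrow> ((\<lambda>R. q R r) \<longlongrightarrow> A * r powr (- real DIM('a) - \<alpha>)) at_top"
    and q_int: "\<And>(w::'a \<Rightarrow> real) C R. w \<in> borel_measurable borel \<Longrightarrow>
        (\<And>z. \<bar>w z\<bar> \<le> C * (1 - exp (- (norm z)\<^sup>2))) \<Longrightarrow> integrable lborel (\<lambda>z. w z * q R (norm z))"
    and w_lim: "\<And>(w::'a \<Rightarrow> real) C. w \<in> borel_measurable borel \<Longrightarrow>
        (\<And>z. \<bar>w z\<bar> \<le> C * (1 - exp (- (norm z)\<^sup>2))) \<Longrightarrow>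
        ((\<lambda>R. LINT z|lborel. w z * q R (norm z)) \<longlongrightarrow>
           A * (LINT z|lborel. w z * norm z powr (- real DIM('a) - \<alpha>))) at_top"
    apply (rule jump_kernel_scaling_limit[where 'a='a, OF bernstein \<alpha> slow Phi_asymp])
    subgoal premises prems for q N A
      by (rule prems(1)[OF prems(2-9)])
    done
  define \<omega> where "\<omega> = unit_ball_vol (real d)"
  define W where "W = real d * \<omega>"
  have W: "0 < W" "0 < \<omega>" using d by (auto simp: W_def \<omega>_def)
  define u where "u = 2 * \<kappa> + \<alpha>"
  have u: "0 < u" using \<kappa> \<alpha> by (simp add: u_def)

  have \<rho>_meas: "(\<lambda>r. \<rho> (max 0 r)) \<in> borel_measurable borel"
  proof -
    have "mono (\<lambda>r. - \<rho> (max 0 r))"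
      using monotone_onD[OF rho_decreasing] by (intro monoI) auto
    hence "(\<lambda>r. - \<rho> (max 0 r)) \<in> borel_measurable borel" by (rule borel_measurable_mono)
    from borel_measurable_uminus[OF this] show ?thesis by simp
  qed
  have \<phi>_meas: "\<phi> \<in> borel_measurable borel"
  proof -
    have "(\<lambda>x::'a. \<rho> (max 0 (norm x))) \<in> borel_measurable borel"
      by (rule measurable_compose[OF _ \<rho>_meas]) measurable
    moreover have "(\<lambda>x. \<rho> (max 0 (norm x))) = \<phi>"
      by (rule ext) (simp add: phi_radial)
    ultimately show ?thesis by simp
  qed
  note \<rho>_lim = asymp_equiv_powr_tendsto[OF rho_asymp]

  define Q1 where "Q1 R = (LINT z|lborel. (indicator {..<t} (norm (z::'a)) * (norm z)\<^sup>2) * q R (norm z))" for R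
  define Q2 where "Q2 R = (LINT z|lborel. indicator {t..} (norm (z::'a)) * q R (norm z))" for R
  define Q3 where "Q3 R = (LINT z|lborel. (indicator {t..} (norm (z::'a)) * norm z powr (- (2 * \<kappa>))) * q R (norm z))" for R
  have Q1: "(Q1 \<longlongrightarrow> A * (W * (t powr (2 - \<alpha>) / (2 - \<alpha>)))) at_top"
  proof -
    have "(LINT z|lborel. (indicator {..<t} (norm (z::'a)) * (norm z)\<^sup>2) * norm z powr (- real DIM('a) - \<alpha>)) =
        (LINT z|lborel. indicator {0..<t} (norm (z::'a)) * norm z powr ((2 - \<alpha>) - DIM('a)))"
    proof (rule Bochner_Integration.integral_cong[OF refl])
      fix z :: 'a
      have "(norm z)\<^sup>2 * norm z powr (- real DIM('a) - \<alpha>) = norm z powr ((2 - \<alpha>) - DIM('a))" if "z \<noteq> 0"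
        using that by (simp add: powr_numeral[symmetric] powr_add[symmetric] algebra_simps del: powr_numeral)
      thus "(indicator {..<t} (norm (z::'a)) * (norm z)\<^sup>2) * norm z powr (- real DIM('a) - \<alpha>) =
         indicator {0..<t} (norm (z::'a)) * norm z powr ((2 - \<alpha>) - DIM('a))"
        by (cases "z = 0") (auto simp: indicator_def)
    qed
    also have "\<dots> = W * (t powr (2 - \<alpha>) / (2 - \<alpha>))"
      using integral_norm_powr_ball[where 'a='a, of t "2 - \<alpha>"] t \<alpha>
      by (simp add: has_bochner_integral_iff W_def \<omega>_def d_def)
    finally show ?thesis
      using w_lim[OF _ near_weight_le[OF t(2)]] unfolding Q1_def[abs_def] by simp
  qed
  have far: "((\<lambda>R. LINT z|lborel. (indicator {t..} (norm (z::'a)) * norm z powr (- p)) * q R (norm z)) \<longlongrightarrow>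
      A * (W * (t powr (- (p + \<alpha>)) / (p + \<alpha>)))) at_top" if p: "0 \<le> p" for p
  proof -
    have bd: "\<bar>indicator {t..} (norm (z::'a)) * norm z powr (- p)\<bar> \<le> t powr (- p) / (1 - exp (- t\<^sup>2)) * (1 - exp (- (norm z)\<^sup>2))" for z
      by (rule far_weight_le[OF t(1)]) (use t p in \<open>auto simp: indicator_def intro!: powr_mono2'\<close>)
    have "(LINT z|lborel. (indicator {t..} (norm (z::'a)) * norm z powr (- p)) * norm z powr (- real DIM('a) - \<alpha>)) =
        (LINT z|lborel. indicator {t..} (norm (z::'a)) * norm z powr (- (p + \<alpha>) - DIM('a)))"
    proof (rule Bochner_Integration.integral_cong[OF refl])
      fix z :: 'a
      have "- p + (- real DIM('a) - \<alpha>) = - (p + \<alpha>) - DIM('a)" by simp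
      thus "(indicator {t..} (norm z) * norm z powr (- p)) * norm z powr (- real DIM('a) - \<alpha>) =
          indicator {t..} (norm z) * norm z powr (- (p + \<alpha>) - DIM('a))"
        by (simp only: mult.assoc powr_add[symmetric])
    qed
    also have "\<dots> = W * (t powr (- (p + \<alpha>)) / (p + \<alpha>))"
      using integral_norm_powr_outside[where 'a='a, of t "p + \<alpha>"] t \<alpha> p
      by (simp add: has_bochner_integral_iff W_def \<omega>_def d_def)
    finally show ?thesis using w_lim[OF _ bd] by simp
  qed
  have Q2: "(Q2 \<longlongrightarrow> A * (W * (t powr (- \<alpha>) / \<alpha>))) at_top"
  proof -
    have eq: "indicator {t..} (norm (z::'a)) * norm z powr (- 0) = indicator {t..} (norm z)" for z :: 'a
      using t by (auto simp: indicator_def)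
    show ?thesis using far[OF order_refl, unfolded eq] unfolding Q2_def[abs_def] by simp
  qed
  have Q3: "(Q3 \<longlongrightarrow> A * (W * (t powr (- u) / u))) at_top"
    using far[of "2 * \<kappa>"] \<kappa> unfolding Q3_def[abs_def] u_def by simp
  define I where "I R = (LINT y|lborel. indicator {..<1-t} (norm (y::'a)) * \<rho> (R * norm y))" for R
  have I: "((\<lambda>R. R powr (2 * \<kappa>) * I R) \<longlongrightarrow> C\<phi> * (W * ((1 - t) powr (d - 2 * \<kappa>) / (d - 2 * \<kappa>)))) at_top"
    using ball_integral_tendsto[where 'a='a, OF rho_nonneg rho_decreasing \<rho>_lim \<kappa>(1), of "1 - t"] \<kappa> t \<phi>_meas
    by (simp add: I_def W_def \<omega>_def d_def phi_radial[abs_def])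

  define b where "b = min (1 / 2) ((1 + t\<^sup>2) powr (- \<kappa>))"
  define X where "X = (1 - t) powr (d - 2 * \<kappa>) / ((2 - t) powr (d + \<alpha>) * (d - 2 * \<kappa>)) - t powr (- \<alpha>) / \<alpha>
     - 2 * \<kappa> * (2 * \<kappa> + 1) * (real d)\<^sup>2 * t powr (2 - \<alpha>) / ((2 - \<alpha>) * (1 - t) powr (2 * \<kappa> + 2))"
  define S where "S = (1 - t) ^ d / (d * t powr (d + \<alpha>))"
  \<comment> \<open>Only for \<open>\<beta> < C\<phi>\<close> is \<open>\<beta> r powr (- 2 \<kappa>) \<le> \<rho> r\<close> guaranteed for large \<open>r\<close>; continuity leaves room for such a \<open>\<beta>\<close>.\<close>
  define G where "G \<beta> = C\<phi> * X + max 0 (\<beta> * (b * t powr (- \<alpha>) / u) - C\<phi> * S)" for \<beta>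
  have "0 < G C\<phi>"
  proof -
    have "0 < X + max 0 (b * t powr (- \<alpha>) / u - S)"
      using H far_term_le[OF d \<alpha>(1) \<kappa>(3,1) t] unfolding H_plus_eq[OF d \<alpha> \<kappa>(1,2) t] X_def S_def b_def u_def by linarith
    hence "0 < C\<phi> * (X + max 0 (b * t powr (- \<alpha>) / u - S))"
      using C\<phi>_pos by simp
    also have "C\<phi> * (X + max 0 (b * t powr (- \<alpha>) / u - S)) = G C\<phi>"
      using C\<phi>_pos max_mult_distrib_left[of C\<phi> 0 "b * t powr (- \<alpha>) / u - S"]
      by (simp add: G_def distrib_left right_diff_distrib)
    finally show ?thesis .
  qed
  moreover have "(G \<longlongrightarrow> G C\<phi>) (at_left C\<phi>)"
    unfolding G_def by (intro tendsto_intros)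
  ultimately have "\<forall>\<^sub>F \<beta> in at_left C\<phi>. 0 < G \<beta>"
    by (rule order_tendstoD(1)[rotated])
  moreover have "\<forall>\<^sub>F \<beta> in at_left C\<phi>. \<beta> \<in> {0<..<C\<phi>}"
    using C\<phi>_pos by (intro eventually_at_leftI[of 0]) auto
  ultimately have "\<forall>\<^sub>F \<beta> in at_left C\<phi>. 0 < G \<beta> \<and> \<beta> \<in> {0<..<C\<phi>}"
    by (rule eventually_conj)
  then obtain \<beta> where \<beta>: "0 < G \<beta>" "0 < \<beta>" "\<beta> < C\<phi>"
    using eventually_happens[of _ "at_left C\<phi>"] by (auto simp: trivial_limit_at_left_real)

  define E where "E x = norm x powr (2 * \<kappa>) *
      (q (norm x) (2 - t) * I (norm x) - L t x * (norm x)\<^sup>2 / 2 * Q1 (norm x) - \<rho> (norm x) * Q2 (norm x)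
       + max 0 (\<beta> * norm x powr (- (2 * \<kappa>)) * (b * t powr (2 * \<kappa>)) * Q3 (norm x)
                  - \<rho> (norm x) * q (norm x) t * (\<omega> * (1 - t) ^ d)))" for x :: 'a
  have E_lim: "(E \<longlongrightarrow> A * W * G \<beta>) at_infinity"
  proof -
    have norm_lim: "filterlim (norm :: 'a \<Rightarrow> real) at_top at_infinity"
      by (rule filterlim_norm_at_top)
    note lims = Q1[THEN filterlim_compose, OF norm_lim] Q2[THEN filterlim_compose, OF norm_lim]
      Q3[THEN filterlim_compose, OF norm_lim] I[THEN filterlim_compose, OF norm_lim]
      \<rho>_lim[THEN filterlim_compose, OF norm_lim]
      q_lim[THEN filterlim_compose, OF _ norm_lim]
    \<comment> \<open>\<open>E\<close> with the powers of \<open>|x|\<close> distributed so that every factor converges.\<close>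
    define E' where "E' x = q (norm x) (2 - t) * (norm x powr (2 * \<kappa>) * I (norm x))
       - L t x * norm x powr (2 * \<kappa> + 2) / 2 * Q1 (norm x)
       - (norm x powr (2 * \<kappa>) * \<rho> (norm x)) * Q2 (norm x)
       + max 0 (\<beta> * (b * t powr (2 * \<kappa>)) * Q3 (norm x)
                  - (norm x powr (2 * \<kappa>) * \<rho> (norm x)) * q (norm x) t * (\<omega> * (1 - t) ^ d))" for x :: 'a
    define c where "c = C\<phi> * (4 * \<kappa> * (2 * \<kappa> + 1) * (real d)\<^sup>2) / (1 - t) powr (2 * \<kappa> + 2)"
    have L: "((\<lambda>x. L t x * norm x powr (2 * \<kappa> + 2)) \<longlongrightarrow> c) at_infinity"
    proof -
      have "(\<lambda>x. L t x * norm x powr (2 * \<kappa> + 2)) \<sim>[at_infinity]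
          (\<lambda>x. C\<phi> * (4 * \<kappa> * (2 * \<kappa> + 1) * (real DIM('a))\<^sup>2)
        / ((1 - t) powr (2 * \<kappa> + 2) * norm x powr (2 * \<kappa> + 2)) * norm x powr (2 * \<kappa> + 2))"
        using t by (intro asymp_equiv_intros L_asymp) auto
      moreover have "((\<lambda>x::'a. C\<phi> * (4 * \<kappa> * (2 * \<kappa> + 1) * (real DIM('a))\<^sup>2)
        / ((1 - t) powr (2 * \<kappa> + 2) * norm x powr (2 * \<kappa> + 2)) * norm x powr (2 * \<kappa> + 2)) \<longlongrightarrow> c) at_infinity"
      proof (rule tendsto_eventually)
        have "\<forall>\<^sub>F x in at_infinity. 1 \<le> norm (x::'a)"
          by (auto simp: eventually_at_infinity)
        thus "\<forall>\<^sub>F x in at_infinity. C\<phi> * (4 * \<kappa> * (2 * \<kappa> + 1) * (real DIM('a))\<^sup>2)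
          / ((1 - t) powr (2 * \<kappa> + 2) * norm (x::'a) powr (2 * \<kappa> + 2)) * norm x powr (2 * \<kappa> + 2) = c"
        proof eventually_elim
          case (elim x)
          hence "norm x powr (2 * \<kappa> + 2) \<noteq> 0" by auto
          thus ?case by (simp add: c_def d_def)
        qed
      qed
      ultimately show ?thesis
        using asymp_equiv_tendsto_transfer asymp_equiv_sym by blast
    qed
    have "(E' \<longlongrightarrow> (A * (2 - t) powr (- real d - \<alpha>)) * (C\<phi> * (W * ((1 - t) powr (d - 2 * \<kappa>) / (d - 2 * \<kappa>))))
       - c / 2 * (A * (W * (t powr (2 - \<alpha>) / (2 - \<alpha>))))
       - C\<phi> * (A * (W * (t powr (- \<alpha>) / \<alpha>)))
       + max 0 (\<beta> * (b * t powr (2 * \<kappa>)) * (A * (W * (t powr (- u) / u)))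
                  - C\<phi> * (A * t powr (- real d - \<alpha>)) * (\<omega> * (1 - t) ^ d))) at_infinity"
      unfolding E'_def using t
      by (intro tendsto_intros L lims(1-5) lims(6)[unfolded d_def[symmetric]]) auto
    also have "(A * (2 - t) powr (- real d - \<alpha>)) * (C\<phi> * (W * ((1 - t) powr (d - 2 * \<kappa>) / (d - 2 * \<kappa>))))
       - c / 2 * (A * (W * (t powr (2 - \<alpha>) / (2 - \<alpha>))))
       - C\<phi> * (A * (W * (t powr (- \<alpha>) / \<alpha>))) = A * W * (C\<phi> * X)"
    proof -
      have p: "(2 - t) powr (- real d - \<alpha>) = 1 / (2 - t) powr (d + \<alpha>)"
        using powr_minus_divide[of "2 - t" "d + \<alpha>"] by simp
      have e3: "c / 2 * (A * (W * (t powr (2 - \<alpha>) / (2 - \<alpha>)))) = A * W * (C\<phi> *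
          (2 * \<kappa> * (2 * \<kappa> + 1) * (real d)\<^sup>2 * t powr (2 - \<alpha>) / ((2 - \<alpha>) * (1 - t) powr (2 * \<kappa> + 2))))"
      proof -
        define k where "k = 2 * \<kappa> + 1"
        show ?thesis unfolding c_def k_def[symmetric] by (simp add: mult_ac)
      qed
      have e1: "(A * (1 / Q)) * (C\<phi> * (W * (P / D))) = A * W * (C\<phi> * (P / (Q * D)))" for P Q D
        by (simp add: mult_ac)
      have e2: "C\<phi> * (A * (W * y)) = A * W * (C\<phi> * y)" for y by (simp add: mult_ac)
      show ?thesis unfolding p e1 e2 e3 X_def by (simp only: right_diff_distrib)
    qed
    also have "max 0 (\<beta> * (b * t powr (2 * \<kappa>)) * (A * (W * (t powr (- u) / u)))
                  - C\<phi> * (A * t powr (- real d - \<alpha>)) * (\<omega> * (1 - t) ^ d))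
        = A * W * max 0 (\<beta> * (b * t powr (- \<alpha>) / u) - C\<phi> * S)"
    proof -
      have p: "t powr (2 * \<kappa>) * t powr (- u) = t powr (- \<alpha>)"
        by (simp add: powr_add[symmetric] u_def)
      have r: "\<omega> * (1 - t) ^ d * t powr (- real d - \<alpha>) = W * S"
        using powr_minus_divide[of t "d + \<alpha>"] d by (simp add: W_def S_def)
      have "\<beta> * (b * t powr (2 * \<kappa>)) * (A * (W * (t powr (- u) / u))) =
          A * W * (\<beta> * (b * (t powr (2 * \<kappa>) * t powr (- u)) / u))"
        by (simp add: mult_ac)
      hence e4: "\<beta> * (b * t powr (2 * \<kappa>)) * (A * (W * (t powr (- u) / u))) = A * W * (\<beta> * (b * t powr (- \<alpha>) / u))"
        unfolding p .
      have "C\<phi> * (A * t powr (- real d - \<alpha>)) * (\<omega> * (1 - t) ^ d) =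
          A * C\<phi> * (\<omega> * (1 - t) ^ d * t powr (- real d - \<alpha>))"
        by (simp add: mult_ac)
      hence e5: "C\<phi> * (A * t powr (- real d - \<alpha>)) * (\<omega> * (1 - t) ^ d) = A * W * (C\<phi> * S)"
        unfolding r by (simp add: mult_ac)
      have "max 0 (A * W * y - A * W * z) = A * W * max 0 (y - z)" for y z
        using A W max_mult_distrib_left[of "A * W" 0 "y - z"] by (simp add: right_diff_distrib)
      thus ?thesis unfolding e4 e5 .
    qed
    also have "A * W * (C\<phi> * X) + A * W * max 0 (\<beta> * (b * t powr (- \<alpha>) / u) - C\<phi> * S) = A * W * G \<beta>"
      by (simp add: G_def distrib_left)
    finally have "(E' \<longlongrightarrow> A * W * G \<beta>) at_infinity" .
    moreover have "\<forall>\<^sub>F x in at_infinity. E' x = E x"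
    proof -
      have "\<forall>\<^sub>F x in at_infinity. 1 \<le> norm (x::'a)"
        by (auto simp: eventually_at_infinity)
      thus ?thesis
      proof eventually_elim
        case (elim x)
        define r where "r = norm x"
        have r: "0 < r" using elim unfolding r_def by linarith
        have p2: "r powr (2 * \<kappa> + 2) = r powr (2 * \<kappa>) * r\<^sup>2"
          using r by (simp add: powr_add)
        have p0: "r powr (2 * \<kappa>) * r powr (- (2 * \<kappa>)) = 1"
          using r by (simp add: powr_minus)
        have mx: "r powr (2 * \<kappa>) * max 0 y = max 0 (r powr (2 * \<kappa>) * y)" for y
          using max_mult_distrib_left[of "r powr (2 * \<kappa>)" 0 y] by simp
        define y where "y = \<beta> * r powr (- (2 * \<kappa>)) * (b * t powr (2 * \<kappa>)) * Q3 r - \<rho> r * q r t * (\<omega> * (1 - t) ^ d)"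
        have "r powr (2 * \<kappa>) * y = \<beta> * (b * t powr (2 * \<kappa>)) * Q3 r * (r powr (2 * \<kappa>) * r powr (- (2 * \<kappa>)))
            - (r powr (2 * \<kappa>) * \<rho> r) * q r t * (\<omega> * (1 - t) ^ d)"
          unfolding y_def by (simp only: right_diff_distrib mult_ac)
        hence y: "\<beta> * (b * t powr (2 * \<kappa>)) * Q3 r - (r powr (2 * \<kappa>) * \<rho> r) * q r t * (\<omega> * (1 - t) ^ d) = r powr (2 * \<kappa>) * y"
          unfolding p0 by simp
        show ?case
          unfolding E_def E'_def r_def[symmetric] y y_def[symmetric] mx[symmetric] p2
          by (simp add: algebra_simps)
      qed
    qed
    ultimately show ?thesis by (rule Lim_transform_eventually)
  qed
  have "0 < A * W * G \<beta>" using A W \<beta> by simp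
  from order_tendstoD(1)[OF E_lim this] have E_pos: "\<forall>\<^sub>F x in at_infinity. 0 < E x" .

  have "\<forall>\<^sub>F r in at_top. \<beta> < r powr (2 * \<kappa>) * \<rho> r"
    by (rule order_tendstoD(1)[OF \<rho>_lim \<beta>(3)])
  then obtain r0 where r0: "\<And>r. r0 \<le> r \<Longrightarrow> \<beta> < r powr (2 * \<kappa>) * \<rho> r"
    by (auto simp: eventually_at_top_linorder)
  have Z: "Z_bound t \<phi> (M t) (L t)" using L_bound t by simp
  have big: "\<forall>\<^sub>F x in at_infinity. max (max r0 (M t)) 1 \<le> norm (x::'a)"
    unfolding eventually_at_infinity by blast
  have JN: "\<forall>\<^sub>F x in at_infinity. 0 < N (norm (x::'a)) \<and> (\<forall>r. jump_kernel DIM('a) \<mu> (norm x * r) = N (norm x) * q (norm x) r)"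
    using filterlim_iff[THEN iffD1, OF filterlim_norm_at_top, rule_format, OF J] .
  have "\<forall>\<^sub>F x in at_infinity. 0 < V x"
    using E_pos big JN
  proof eventually_elim
    case (elim x)
    define R where "R = norm x"
    have R: "0 < R" "r0 \<le> R" "M t \<le> R" using elim(2) by (auto simp: R_def)
    define T where "T = (LINT z|lborel. second_diff (R *\<^sub>R z) \<phi> x * q R (norm z))"
    have near: "\<bar>second_diff (R *\<^sub>R z) \<phi> x\<bar> \<le> (L t x * R\<^sup>2) * (norm z)\<^sup>2" if "norm z < t" for z
    proof -
      have "x \<in> - ball 0 (M t)" "R *\<^sub>R z \<in> ball 0 (t * norm x)"
        using R that by (auto simp: R_def)
      hence "\<bar>second_diff (R *\<^sub>R z) \<phi> x\<bar> \<le> L t x * (norm (R *\<^sub>R z))\<^sup>2"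
        using Z unfolding Z_bound_def by blast
      thus ?thesis using R by (simp add: power_mult_distrib mult.assoc)
    qed
    have tail: "\<beta> * r powr (- (2 * \<kappa>)) \<le> \<rho> r" if "R \<le> r" for r
    proof -
      have "0 < r" using that R by simp
      have "\<beta> * r powr (- (2 * \<kappa>)) \<le> r powr (2 * \<kappa>) * \<rho> r * r powr (- (2 * \<kappa>))"
        using r0[of r] that R by (intro mult_right_mono) auto
      also have "\<dots> = \<rho> r" using \<open>0 < r\<close> by (simp add: powr_minus)
      finally show ?thesis .
    qed
    have "E x / R powr (2 * \<kappa>) \<le> T / 2"
    proof -
      have Ix: "I R = (LINT y|lborel. indicator {..<1-t} (norm (y::'a)) * \<phi> (R *\<^sub>R y))"
        using R by (simp add: I_def phi_radial)
      have "E x / R powr (2 * \<kappa>) = q R (2 - t) * I R - (L t x * R\<^sup>2) / 2 * Q1 R - \<phi> x * Q2 R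
       + max 0 (\<beta> * R powr (- (2 * \<kappa>)) * (b * t powr (2 * \<kappa>)) * Q3 R - \<phi> x * q R t * (\<omega> * (1 - t) ^ d))"
        using R by (simp add: E_def phi_radial flip: R_def)
      also have "\<dots> \<le> T / 2"
        unfolding Ix Q1_def Q2_def Q3_def b_def \<omega>_def d_def T_def
        by (rule integral_second_diff_lower_bound[where q="q R", OF t \<kappa>(1) R(1) R_def phi_radial rho_nonneg
              rho_decreasing \<phi>_meas near less_imp_le[OF \<beta>(2)] tail q(1) q(2) q(3)]) (auto intro: q_int)
      finally show ?thesis .
    qed
    moreover have "0 < E x / R powr (2 * \<kappa>)" using elim(1) R by simp
    ultimately have "0 < T" by linarith
    moreover have "V x = 1 / (2 * \<phi> x) * (R ^ DIM('a) * N R * T)"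
      unfolding potential T_def
      by (rule nonlocal_potential_scaled[OF \<phi>_meas q(1) R(1)]) (use elim(3) in \<open>simp add: R_def\<close>)
    moreover have "0 < N R" using elim(3) by (simp add: R_def)
    ultimately show ?case using phi_pos[of x] R by simp
  qed
  then obtain b where b: "\<And>x. b \<le> norm x \<Longrightarrow> 0 < V x"
    by (auto simp: eventually_at_infinity)
  show ?thesis
    by (intro exI[of _ "max b 1"]) (auto intro: b)
qed

end
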